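(* Assume $K>0$ and $L>0$, and fix a control band policy $\varphi=\{d,D,U,u\}$ with $d<D<U<u$. If there exist a constant $\gamma$ and a twice continuously differentiable function $V:[d,u]\to\mathbb R$ satisfying $$\Gamma V(x)+h(x)=\gamma,\qquad d\le x\le u,$$ with boundary conditions $$V(d)-V(D)=K+k(D-d),\qquad V(u)-V(U)=L+\ell(u-U),$$ then the long-run average cost $\mathrm{AC}(x,\varphi)$ is independent of the starting point $x\in\mathbb R$ and equals $\gamma$.
   Context: Parameters: $\mu\in\mathbb{R}$, $\sigma>0$, fixed costs $K,L>0$, proportional costs $k>0$, $\ell>0$; $\lambda=2\mu/\sigma^2$. $W$ is a standard Brownian motion with respect to a filtration $\{\mathcal F_t\}$ and $X(t)=x+\mu t+\sigma W(t)$. $\Gamma V=\frac12\sigma^2V''+\mu V'$. A policy is a pair $(Y_1,Y_2)$ of adapted, nondecreasing, right-continuous processes with left limits, $Y_i(0-)=0$; the inventory process is $Z(t)=X(t)+Y_1(t)-Y_2(t)$, with $Z(0-)=x$. A time $t\ge0$ is an increasing point of $Y_i$ if $Y_i(s)-Y_i(t-)>0$ for each $s>t$, and $N_i(t)$ is the number of increasing points of $Y_i$ in $[0,t]$. The long-run average cost is $$\mathrm{AC}(x,\varphi)=\limsup_{t\to\infty}\frac1t\,\mathbb E_x\Big[\int_0^t h(Z(s))\,ds+KN_1(t)+LN_2(t)+kY_1(t)+\ell Y_2(t)\Big],$$ where $\mathbb E_x$ is expectation given $Z(0-)=x$. Control band policy $\{d,D,U,u\}$ (pure-jump policy): at time $T_0=0$,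 the inventory is adjusted by $\xi_0=D-x$ if $x\le d$, by $\xi_0=0$ if $d<x<u$, by $\xi_0=U-x$ if $x\ge u$. For $n\ge1$, $T_n=\inf\{t>T_{n-1}:Z(t-)\in\{d,u\}\}$, and at time $T_n$ the inventory is adjusted by $\xi_n=D-d$ if $Z(T_n-)=d$ and by $\xi_n=U-u$ if $Z(T_n-)=u$. Positive adjustments are the jumps of $Y_1$, absolute values of negative adjustments are the jumps of $Y_2$, and $Y_1,Y_2$ are otherwise constant. Standing assumption on $h:\mathbb R\to[0,\infty)$: $h$ is continuous and convex; there is $a\in\mathbb R$ such that $h$ is $C^2$ on $\mathbb R\setminus\{a\}$ and $h(a)=0$; $h'(x)<0$ for $x<a$ and $h'(x)>0$ for $x>a$; if $\lambda>0$ then $\int_{-\infty}^a|h'(y)|e^{\lambda(y-a)}dy<\infty$; if $\lambda<0$ then $\int_a^\infty|h'(y)|e^{\lambda(y-a)}dy<\infty$. *)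

theory Defs
  imports "HOL-Probability.Probability"
begin

section \<open>Brownian motion\<close>

text \<open>Time is \<open>[0,\<infinity>)\<close>; the values of processes and of the filtration at negative times are
  irrelevant. Paths are continuous for every outcome, not only almost surely.\<close>

locale brownian_motion = prob_space M for M :: "'a measure" +
  fixes F :: "real \<Rightarrow> 'a measure" and W :: "real \<Rightarrow> 'a \<Rightarrow> real"
  assumes subalgebra_F: "0 \<le> t \<Longrightarrow> subalgebra M (F t)"
    and mono_F: "0 \<le> s \<Longrightarrow> s \<le> t \<Longrightarrow> subalgebra (F t) (F s)"
    and adapted: "0 \<le> t \<Longrightarrow> W t \<in> borel_measurable (F t)"
    and start: "\<omega> \<in> space M \<Longrightarrow> W 0 \<omega> = 0"
    and continuous_paths: "\<omega> \<in> space M \<Longrightarrow> continuous_on {0..} (\<lambda>t. W t \<omega>)"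
    and normal_increments: "0 \<le> s \<Longrightarrow> s < t \<Longrightarrow>
      distributed M lborel (\<lambda>\<omega>. W t \<omega> - W s \<omega>) (normal_density 0 (sqrt (t - s)))"
    and indep_increments: "0 \<le> s \<Longrightarrow> s < t \<Longrightarrow>
      indep_set (sets (F s)) {(\<lambda>\<omega>. W t \<omega> - W s \<omega>) -` A \<inter> space M | A. A \<in> sets borel}"

definition drifted :: "real \<Rightarrow> real \<Rightarrow> (real \<Rightarrow> 'a \<Rightarrow> real) \<Rightarrow> real \<Rightarrow> real \<Rightarrow> 'a \<Rightarrow> real" where
  "drifted \<mu> \<sigma> W x t \<omega> = x + \<mu> * t + \<sigma> * W t \<omega>"

section \<open>Holding cost\<close>

definition holding_cost :: "real \<Rightarrow> (real \<Rightarrow> real) \<Rightarrow> bool" where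
  "holding_cost lam h \<longleftrightarrow>
     (\<forall>x. 0 \<le> h x) \<and> continuous_on UNIV h \<and> convex_on UNIV h \<and>
     (\<exists>a. h a = 0 \<and>
       (\<forall>x. x \<noteq> a \<longrightarrow> h differentiable (at x) \<and> deriv h differentiable (at x)) \<and>
       continuous_on (- {a}) (deriv (deriv h)) \<and>
       (\<forall>x<a. deriv h x < 0) \<and> (\<forall>x>a. 0 < deriv h x) \<and>
       (0 < lam \<longrightarrow>
         (\<integral>\<^sup>+y\<in>{..<a}. ennreal (\<bar>deriv h y\<bar> * exp (lam * (y - a))) \<partial>lborel) < \<infinity>) \<and>
       (lam < 0 \<longrightarrow>
         (\<integral>\<^sup>+y\<in>{a<..}. ennreal (\<bar>deriv h y\<bar> * exp (lam * (y - a))) \<partial>lborel) < \<infinity>))"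

section \<open>Long-run average cost\<close>

text \<open>Left limit \<open>y(t-)\<close> of a path on \<open>[0,\<infinity>)\<close>, where \<open>y0\<close> is the prescribed value of \<open>y(0-)\<close>.\<close>

definition left_lim :: "real \<Rightarrow> (real \<Rightarrow> real) \<Rightarrow> real \<Rightarrow> real" where
  "left_lim y0 y t = (if t \<le> 0 then y0 else Lim (at_left t) y)"

definition increasing_points :: "(real \<Rightarrow> real) \<Rightarrow> real \<Rightarrow> real set" where
  "increasing_points y t = {r \<in> {0..t}. \<forall>s>r. y s - left_lim 0 y r > 0}"

definition num_increasing :: "(real \<Rightarrow> real) \<Rightarrow> real \<Rightarrow> ennreal" where
  "num_increasing y t = emeasure (count_space UNIV) (increasing_points y t)"

definition path_cost ::
  "(real \<Rightarrow> real) \<Rightarrow> real \<Rightarrow> real \<Rightarrow> real \<Rightarrow> real \<Rightarrow>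
    (real \<Rightarrow> real) \<Rightarrow> (real \<Rightarrow> real) \<Rightarrow> (real \<Rightarrow> real) \<Rightarrow> real \<Rightarrow> ennreal" where
  "path_cost h K L k l X Y1 Y2 t =
     (\<integral>\<^sup>+s\<in>{0..t}. ennreal (h (X s + Y1 s - Y2 s)) \<partial>lborel)
     + ennreal K * num_increasing Y1 t + ennreal L * num_increasing Y2 t
     + ennreal (k * Y1 t) + ennreal (l * Y2 t)"

text \<open>All costs are nonnegative, so the expectation exists in \<open>[0,\<infinity>]\<close>.\<close>

definition avg_cost ::
  "'a measure \<Rightarrow> (real \<Rightarrow> real) \<Rightarrow> real \<Rightarrow> real \<Rightarrow> real \<Rightarrow> real \<Rightarrow>
    (real \<Rightarrow> 'a \<Rightarrow> real) \<Rightarrow> (real \<Rightarrow> 'a \<Rightarrow> real) \<Rightarrow> (real \<Rightarrow> 'a \<Rightarrow> real) \<Rightarrow> ereal" where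
  "avg_cost M h K L k l X Y1 Y2 =
     Limsup at_top (\<lambda>t::real. ereal (1 / t) *
       enn2ereal (\<integral>\<^sup>+\<omega>. path_cost h K L k l (\<lambda>s. X s \<omega>) (\<lambda>s. Y1 s \<omega>) (\<lambda>s. Y2 s \<omega>) t \<partial>M))"

section \<open>Control band policies\<close>

text \<open>\<open>band d D U u X n = (T\<^sub>n, \<xi>\<^sub>n, \<xi>\<^sub>0 + \<dots> + \<xi>\<^sub>n)\<close> for an uncontrolled path \<open>X\<close> starting in
  \<open>X 0 = Z(0-)\<close>. Up to and including \<open>T\<^sub>n\<^sub>+\<^sub>1\<close>, the left limit of the controlled path is
  \<open>Z(t-) = X t + (\<xi>\<^sub>0 + \<dots> + \<xi>\<^sub>n)\<close>, which gives the recursion; the theorem \<open>band_policy\<close> below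
  restates it in terms of \<open>Z(t-)\<close>. If the infimum is over the empty set, \<open>T\<^sub>n\<^sub>+\<^sub>1 = \<infinity>\<close> and
  \<open>\<xi>\<^sub>n\<^sub>+\<^sub>1\<close> is never applied.\<close>

primrec band ::
  "real \<Rightarrow> real \<Rightarrow> real \<Rightarrow> real \<Rightarrow> (real \<Rightarrow> real) \<Rightarrow> nat \<Rightarrow> ereal \<times> real \<times> real" where
  "band d D U u X 0 =
     (let \<xi> = (if X 0 \<le> d then D - X 0 else if X 0 < u then 0 else U - X 0) in (0, \<xi>, \<xi>))"
| "band d D U u X (Suc n) =
     (let (T, \<xi>, S) = band d D U u X n;
          T' = Inf {ereal t | t. T < ereal t \<and> X t + S \<in> {d, u}};
          \<xi>' = (if X (real_of_ereal T') + S = d then D - d else U - u)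
      in (T', \<xi>', S + \<xi>'))"

definition band_time :: "real \<Rightarrow> real \<Rightarrow> real \<Rightarrow> real \<Rightarrow> (real \<Rightarrow> real) \<Rightarrow> nat \<Rightarrow> ereal" where
  "band_time d D U u X n = fst (band d D U u X n)"

definition band_adj :: "real \<Rightarrow> real \<Rightarrow> real \<Rightarrow> real \<Rightarrow> (real \<Rightarrow> real) \<Rightarrow> nat \<Rightarrow> real" where
  "band_adj d D U u X n = fst (snd (band d D U u X n))"

definition band_up :: "real \<Rightarrow> real \<Rightarrow> real \<Rightarrow> real \<Rightarrow> (real \<Rightarrow> real) \<Rightarrow> real \<Rightarrow> real" where
  "band_up d D U u X t =
     (\<Sum>n | band_time d D U u X n \<le> ereal t. max 0 (band_adj d D U u X n))"

definition band_down :: "real \<Rightarrow> real \<Rightarrow> real \<Rightarrow> real \<Rightarrow> (real \<Rightarrow> real) \<Rightarrow> real \<Rightarrow> real" where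
  "band_down d D U u X t =
     (\<Sum>n | band_time d D U u X n \<le> ereal t. max 0 (- band_adj d D U u X n))"

definition band_cost ::
  "'a measure \<Rightarrow> (real \<Rightarrow> real) \<Rightarrow> real \<Rightarrow> real \<Rightarrow> real \<Rightarrow> real \<Rightarrow>
    (real \<Rightarrow> 'a \<Rightarrow> real) \<Rightarrow> real \<Rightarrow> real \<Rightarrow> real \<Rightarrow> real \<Rightarrow> ereal" where
  "band_cost M h K L k l X d D U u =
     avg_cost M h K L k l X
       (\<lambda>t \<omega>. band_up d D U u (\<lambda>s. X s \<omega>) t) (\<lambda>t \<omega>. band_down d D U u (\<lambda>s. X s \<omega>) t)"

subsection \<open>The construction is the control band policy\<close>

context
  fixes d D U u :: real and X :: "real \<Rightarrow> real"
begin

private abbreviation "T \<equiv> band_time d D U u X"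
private abbreviation "xi \<equiv> band_adj d D U u X"
private abbreviation "S \<equiv> \<lambda>n. snd (snd (band d D U u X n))"
private abbreviation "Z \<equiv> \<lambda>t. X t + band_up d D U u X t - band_down d D U u X t"

private lemma T_0: "T 0 = 0"
  by (simp add: band_time_def Let_def)

private lemma T_Suc: "T (Suc n) = Inf {ereal t | t. T n < ereal t \<and> X t + S n \<in> {d, u}}"
  by (simp add: band_time_def Let_def split: prod.split)

private lemma xi_0: "xi 0 = (if X 0 \<le> d then D - X 0 else if X 0 < u then 0 else U - X 0)"
  by (simp add: band_adj_def Let_def)

private lemma xi_Suc:
  "T (Suc n) = ereal t \<Longrightarrow> xi (Suc n) = (if X t + S n = d then D - d else U - u)"
  by (cases "band d D U u X n") (simp add: band_time_def band_adj_def Let_def)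

private lemma S_0: "S 0 = xi 0"
  by (simp add: band_adj_def Let_def)

private lemma S_Suc: "S (Suc n) = S n + xi (Suc n)"
  by (simp add: band_adj_def Let_def split: prod.split)

private lemma S_sum: "S n = (\<Sum>i\<le>n. xi i)"
  by (induction n) (simp_all only: S_0 S_Suc sum.atMost_Suc, simp)

private lemma T_le_Suc: "T n \<le> T (Suc n)"
  unfolding T_Suc by (intro Inf_greatest) auto

private lemma T_mono: "m \<le> n \<Longrightarrow> T m \<le> T n"
  by (rule lift_Suc_mono_le[of T, OF T_le_Suc])

private lemma T_nonneg: "0 \<le> T n"
  using T_mono[of 0 n] by (simp add: T_0)

private lemma Z_eq:
  assumes "T n \<le> ereal s" "ereal s < T (Suc n)"
  shows "Z s = X s + S n"
proof -
  have "{m. T m \<le> ereal s} = {..n}"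
  proof (intro set_eqI iffI)
    fix m assume "m \<in> {m. T m \<le> ereal s}"
    then show "m \<in> {..n}"
      using assms T_mono[of "Suc n" m] by (cases "m \<le> n") (auto simp: not_less_eq_eq)
  next
    fix m assume "m \<in> {..n}"
    then show "m \<in> {m. T m \<le> ereal s}"
      using assms T_mono[of m n] by auto
  qed
  then have "Z s = X s + (\<Sum>i\<le>n. max 0 (xi i) - max 0 (- xi i))"
    by (simp add: band_up_def band_down_def sum_subtractf)
  also have "\<dots> = X s + S n"
    unfolding S_sum by (intro arg_cong2[where f="(+)"] sum.cong) auto
  finally show ?thesis .
qed

context
  assumes cont: "continuous_on {0..} X" and order: "d < D" "D < U" "U < u"
begin

private lemma first_exit:
  assumes T: "T n = ereal t0" "T (Suc n) = ereal t1" and inside: "d < X t0 + S n" "X t0 + S n < u"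
  shows "t0 < t1 \<and> X t1 + S n \<in> {d, u}"
proof -
  let ?A = "{t \<in> {t0..}. X t + S n \<in> {d, u}}"
  have t0: "0 \<le> t0" using T_nonneg[of n] T by simp
  have "continuous_on {t0..} (\<lambda>t. X t + S n)"
    using t0 by (intro continuous_intros continuous_on_subset[OF cont]) auto
  then have "closed ((\<lambda>t. X t + S n) -` {d, u} \<inter> {t0..})"
    by (intro closed_vimage_Int) auto
  moreover have "(\<lambda>t. X t + S n) -` {d, u} \<inter> {t0..} = ?A" by auto
  ultimately have "closed ?A" by simp
  moreover have A: "{ereal t | t. T n < ereal t \<and> X t + S n \<in> {d, u}} = ereal ` ?A"
  proof -
    have "X t + S n \<in> {d, u} \<Longrightarrow> t \<noteq> t0" for t using inside by auto
    then have "t0 < t \<and> X t + S n \<in> {d, u} \<longleftrightarrow> t0 \<le> t \<and> X t + S n \<in> {d, u}" for t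
      by (auto simp only: less_le)
    then show ?thesis unfolding T(1) by auto
  qed
  moreover have "?A \<noteq> {}"
  proof
    assume "?A = {}"
    then have "Inf (ereal ` ?A) = \<infinity>" by (simp only: image_empty Inf_empty top_ereal_def)
    then show False using T_Suc[of n] T(2) unfolding A by simp
  qed
  moreover have bdd: "bdd_below ?A" by (rule bdd_belowI[of _ t0]) auto
  ultimately have "Inf ?A \<in> ?A" by (intro closed_contains_Inf)
  moreover have "t1 = Inf ?A"
    using T_Suc[of n] ereal_Inf'[OF bdd \<open>?A \<noteq> {}\<close>] T(2) unfolding A by (metis ereal.inject)
  ultimately have "t1 \<in> ?A" by simp
  moreover from this have "t1 \<noteq> t0" using inside by auto
  ultimately show ?thesis by auto
qed

private lemma T_pred: "T (Suc n) = ereal t \<Longrightarrow> \<exists>t0. T n = ereal t0"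
  using T_le_Suc[of n] T_nonneg[of n] by (cases "T n") auto

private lemma inside_0: "d < X 0 + S 0" "X 0 + S 0 < u"
  unfolding S_0 xi_0 using order by auto

private lemma inside: "T n = ereal t \<Longrightarrow> d < X t + S n \<and> X t + S n < u"
proof (induction n arbitrary: t)
  case 0
  then show ?case using inside_0 by (simp add: T_0 zero_ereal_def)
next
  case (Suc n)
  obtain t0 where t0: "T n = ereal t0" using T_pred[OF Suc.prems] by blast
  have "X t + S n \<in> {d, u}"
    using first_exit[OF t0 Suc.prems] Suc.IH[OF t0] by simp
  then show ?case
    unfolding S_Suc xi_Suc[OF Suc.prems] using order by auto
qed

private lemma left_lim_Z:
  assumes "T n < ereal t" "ereal t \<le> T (Suc n)"
  shows "left_lim (X 0) Z t = X t + S n"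
proof -
  obtain t0 where t0: "T n = ereal t0"
    using assms(1) T_nonneg[of n] by (cases "T n") auto
  then have *: "t0 < t" "0 \<le> t0" using assms(1) T_nonneg[of n] by auto
  have "isCont X t"
    using * continuous_on_interior[OF cont, of t] by (simp add: interior_real_atLeast)
  then have "(X \<longlongrightarrow> X t) (at_left t)"
    by (simp add: isCont_def filterlim_at_split)
  then have "((\<lambda>s. X s + S n) \<longlongrightarrow> X t + S n) (at_left t)"
    by (intro tendsto_intros)
  moreover have "eventually (\<lambda>s. X s + S n = Z s) (at_left t)"
    using eventually_at_left_real[OF *(1)]
  proof eventually_elim
    case (elim s)
    then have "ereal s < ereal t" by simp
    with elim t0 assms(2) show ?case 
      by (intro Z_eq[symmetric]) (auto intro: less_le_trans[of "ereal s" "ereal t" "T (Suc n)"])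
  qed
  ultimately have "(Z \<longlongrightarrow> X t + S n) (at_left t)"
    by (rule Lim_transform_eventually)
  then have "Lim (at_left t) Z = X t + S n"
    by (intro tendsto_Lim) (auto simp: trivial_limit_at_left_real)
  then show ?thesis using * by (simp add: left_lim_def)
qed

private lemma time_step:
  assumes "T n < \<infinity>"
  shows "T n < T (Suc n)"
proof (cases "T (Suc n)")
  case (real t)
  then obtain t0 where "T n = ereal t0" using T_pred by blast
  with first_exit[OF this real] inside[OF this] real show ?thesis by simp
qed (use assms T_nonneg[of "Suc n"] in auto)

theorem band_policy:
  shows "band_time d D U u X 0 = 0"
    and "band_adj d D U u X 0 = (if X 0 \<le> d then D - X 0 else if X 0 < u then 0 else U - X 0)"
    and "band_time d D U u X (Suc n) =
      Inf {ereal t | t. band_time d D U u X n < ereal t \<and> left_lim (X 0) Z t \<in> {d, u}}"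
      (is "_ = Inf ?B")
    and "band_time d D U u X (Suc n) = ereal t \<Longrightarrow> left_lim (X 0) Z t = d \<Longrightarrow>
      band_adj d D U u X (Suc n) = D - d"
    and "band_time d D U u X (Suc n) = ereal t \<Longrightarrow> left_lim (X 0) Z t = u \<Longrightarrow>
      band_adj d D U u X (Suc n) = U - u"
    and "finite {n. band_time d D U u X n \<le> ereal r}"
proof -
  show "T 0 = 0" "xi 0 = (if X 0 \<le> d then D - X 0 else if X 0 < u then 0 else U - X 0)"
    by (rule T_0 xi_0)+
  show "T (Suc n) = Inf ?B"
  proof (rule antisym)
    show "T (Suc n) \<le> Inf ?B"
    proof (rule Inf_greatest, clarify)
      fix t assume t: "T n < ereal t" "left_lim (X 0) Z t \<in> {d, u}"
      show "T (Suc n) \<le> ereal t"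
      proof (rule ccontr)
        assume c: "\<not> T (Suc n) \<le> ereal t"
        then have "X t + S n \<in> {d, u}" using left_lim_Z[of n t] t by simp
        then have "T (Suc n) \<le> ereal t" unfolding T_Suc using t by (intro Inf_lower) blast
        with c show False by simp
      qed
    qed
    show "Inf ?B \<le> T (Suc n)"
    proof (cases "T (Suc n)")
      case (real t1)
      then obtain t0 where t0: "T n = ereal t0" using T_pred by blast
      have "t0 < t1 \<and> X t1 + S n \<in> {d, u}"
        using first_exit[OF t0 real] inside[OF t0] by simp
      then have "ereal t1 \<in> ?B" using left_lim_Z[of n t1] t0 real by simp
      then show ?thesis unfolding real by (rule Inf_lower)
    qed (use T_nonneg[of "Suc n"] in auto)
  qed
  have "left_lim (X 0) Z t = X t + S n" if "T (Suc n) = ereal t"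
    using that T_le_Suc[of n] time_step[of n] T_pred[OF that] by (intro left_lim_Z) auto
  then show "xi (Suc n) = D - d" if "T (Suc n) = ereal t" "left_lim (X 0) Z t = d"
    using xi_Suc that by simp
  show "xi (Suc n) = U - u" if "T (Suc n) = ereal t" "left_lim (X 0) Z t = u"
    using xi_Suc[OF that(1)] that \<open>_ \<Longrightarrow> left_lim (X 0) Z t = X t + S n\<close> order by simp
  show "finite {n. T n \<le> ereal r}"
  proof (rule ccontr)
    assume inf: "infinite {n. T n \<le> ereal r}"
    have le: "T n \<le> ereal r" for n
    proof -
      obtain m where "n \<le> m" "T m \<le> ereal r"
        using inf unfolding infinite_nat_iff_unbounded_le by auto
      then show ?thesis using T_mono[of n m] by (meson order_trans)
    qed
    define \<tau> where "\<tau> n = real_of_ereal (T n)" for n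
    have \<tau>: "T n = ereal (\<tau> n)" for n
      using le[of n] T_nonneg[of n] unfolding \<tau>_def by (cases "T n") auto
    have "incseq \<tau>" using T_mono \<tau> by (auto simp: incseq_def)
    moreover have "\<tau> n \<le> r" for n using le[of n] \<tau> by simp
    ultimately obtain c where c: "\<tau> \<longlonglongrightarrow> c" "\<And>n. \<tau> n \<le> c"
      using incseq_convergent[of \<tau> r] by blast
    have \<tau>0: "0 \<le> \<tau> n" for n using T_nonneg[of n] \<tau> by simp
    then have "0 \<le> c" using c(2)[of 0] \<tau>0[of 0] by linarith
    then have lim: "(\<lambda>n. X (\<tau> n)) \<longlonglongrightarrow> X c"
      using \<tau>0 by (intro continuous_on_tendsto_compose[OF cont c(1)]) auto
    have "(\<lambda>n. X (\<tau> (Suc (Suc n))) - X (\<tau> (Suc n))) \<longlonglongrightarrow> X c - X c"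
      by (intro tendsto_diff LIMSEQ_Suc lim)
    moreover define e where "e = min (min (D - d) (U - d)) (min (u - D) (u - U))"
    have "0 < e" using order by (simp add: e_def)
    ultimately have "eventually (\<lambda>n. \<bar>X (\<tau> (Suc (Suc n))) - X (\<tau> (Suc n))\<bar> < e) sequentially"
      by (auto simp: tendsto_iff dist_real_def)
    then obtain n where n: "\<bar>X (\<tau> (Suc (Suc n))) - X (\<tau> (Suc n))\<bar> < e"
      by (auto simp: eventually_sequentially)
    have hit: "X (\<tau> (Suc m)) + S m \<in> {d, u}" for m
      using first_exit[OF \<tau> \<tau>] inside[OF \<tau>] by blast
    have "X (\<tau> (Suc n)) + S (Suc n) \<in> {D, U}"
      using hit[of n] unfolding S_Suc xi_Suc[OF \<tau>] by auto
    then show False using hit[of "Suc n"] n order by (auto simp: e_def)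
  qed
qed

end
end

end

theory Submission
  imports Defs
begin

text \<open>
  The function \<open>V\<close> acts as a potential: while the inventory moves freely, \<open>V(Z)\<close> drifts at
  rate \<open>\<Gamma>V(Z) = \<gamma> - h(Z)\<close>, and by the boundary conditions every adjustment lowers \<open>V(Z)\<close>
  by exactly its own cost. Hence \<open>V(Z(t))\<close> plus the cost paid up to time \<open>t\<close> grows on average
  at rate \<open>\<gamma>\<close>. As \<open>V\<close> is bounded on \<open>[d,u]\<close>, where \<open>Z\<close> lives, the expected cost differs
  from \<open>\<gamma> t\<close> by at most a constant, and dividing by \<open>t\<close> gives the claim.

  The growth statement is an Ito formula for a controlled process. It is obtained here from a
  discretization of time, without stochastic integrals and without stopping the Brownian motion
  at random times. Let \<open>N(t)\<close> count the adjustments in \<open>(0,t]\<close>, so that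
  \<open>Z(t) = X(t) + S\<^sub>N\<^sub>(\<^sub>t\<^sub>)\<close> with \<open>S\<^sub>j = \<xi>\<^sub>0 + \<dots> + \<xi>\<^sub>j\<close>. Let \<open>f\<close> be a bounded
  \<open>C\<^sup>2\<close> extension of \<open>V\<close> to the real line (lemma \<open>bounded_C2_extension\<close>). Over a grid with
  points \<open>s\<^sub>i\<close>, split each increment of \<open>f(X + S\<^sub>N)\<close> into two parts:

  \<^item> \<open>X\<close> moves while \<open>S\<^sub>N\<close> keeps its value at \<open>s\<^sub>i\<close>. Since \<open>Z(s\<^sub>i)\<close> is known at time \<open>s\<^sub>i\<close>
    (lemma \<open>state_adapted\<close>) and the Brownian increment is independent of that past, a second-order
    Taylor expansion shows that the expected change is \<open>\<Gamma>f\<close> times the step, up to an error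
    that is uniformly of smaller order than the step (lemma \<open>one_step_generator\<close>).

  \<^item> \<open>S\<^sub>N\<close> moves while \<open>X\<close> keeps its value at \<open>s\<^sub>i\<^sub>+\<^sub>1\<close>. These terms add up exactly to a sum over
    the adjustments, in which the adjustment time is replaced by the next grid point
    (lemma \<open>jump_grid_sum\<close>). As the grid is refined, continuity of \<open>X\<close> makes each term converge
    to the change of \<open>f\<close> at the adjustment.

  Refining the grid under the expectation needs a bound on the number of adjustments, which is
  not known to be integrable beforehand. The potential is therefore switched off after the first
  \<open>m\<close> adjustments (lemma \<open>truncated_dynkin\<close>). This perturbs the identity only by a multiple of
  the bound of \<open>f\<close>, uniformly in \<open>m\<close>, and monotone convergence removes the truncation
  afterwards (lemma \<open>expected_cost_near_linear\<close>).
\<close>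

section \<open>The controlled path and its cost\<close>

definition band_shift :: "real \<Rightarrow> real \<Rightarrow> real \<Rightarrow> real \<Rightarrow> (real \<Rightarrow> real) \<Rightarrow> nat \<Rightarrow> real" where
  "band_shift d D U u X n = snd (snd (band d D U u X n))"

text \<open>The time \<open>T\<^sub>0 = 0\<close> is left out of the count, so that the value is the index of the latest
  adjustment and \<open>T\<^sub>n \<le> t\<close> is equivalent to \<open>n \<le> N(t)\<close>.\<close>

definition band_count :: "real \<Rightarrow> real \<Rightarrow> real \<Rightarrow> real \<Rightarrow> (real \<Rightarrow> real) \<Rightarrow> real \<Rightarrow> nat" where
  "band_count d D U u X t = card {n. band_time d D U u X (Suc n) \<le> ereal t}"

definition band_state :: "real \<Rightarrow> real \<Rightarrow> real \<Rightarrow> real \<Rightarrow> (real \<Rightarrow> real) \<Rightarrow> real \<Rightarrow> real" where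
  "band_state d D U u X t = X t + band_shift d D U u X (band_count d D U u X t)"

text \<open>The value \<open>\<xi> = 0\<close> occurs only at time \<open>0\<close>, for a start inside the band; it is not an
  adjustment and is free of charge.\<close>

definition jump_cost :: "real \<Rightarrow> real \<Rightarrow> real \<Rightarrow> real \<Rightarrow> real \<Rightarrow> real" where
  "jump_cost K L k l \<xi> = (if 0 < \<xi> then K + k * \<xi> else if \<xi> < 0 then L - l * \<xi> else 0)"

lemma finite_down_closed_nat:
  fixes A :: "nat set"
  assumes "finite A" "\<And>n. Suc n \<in> A \<Longrightarrow> n \<in> A"
  shows "A = {..<card A}"
proof -
  define k where "k = (LEAST k. k \<notin> A)"
  have k: "k \<notin> A" 
    unfolding k_def using assms(1) by (metis LeastI_ex ex_new_if_finite infinite_UNIV_nat)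
  have "j \<in> A" if "j < k" for j
    using that not_less_Least[of j "\<lambda>k. k \<notin> A"] by (auto simp: k_def)
  moreover have "k + j \<notin> A" for j
    using k assms(2) by (induction j) auto
  ultimately have "A = {..<k}"
    by (auto simp: not_less) (metis le_Suc_ex not_less)
  then show ?thesis by simp
qed

locale band_path =
  fixes d D U u :: real and X :: "real \<Rightarrow> real"
  assumes cont: "continuous_on {0..} X" and order: "d < D" "D < U" "U < u"
begin

abbreviation "T \<equiv> band_time d D U u X"
abbreviation "xi \<equiv> band_adj d D U u X"
abbreviation "S \<equiv> band_shift d D U u X"
abbreviation "N \<equiv> band_count d D U u X"
abbreviation "Z \<equiv> band_state d D U u X"

lemma T_0: "T 0 = 0"
  by (simp add: band_time_def Let_def)

lemma T_Suc: "T (Suc n) = Inf {ereal t | t. T n < ereal t \<and> X t + S n \<in> {d, u}}"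
  by (simp add: band_time_def band_shift_def Let_def split: prod.split)

lemma xi_Suc:
  "T (Suc n) = ereal t \<Longrightarrow> xi (Suc n) = (if X t + S n = d then D - d else U - u)"
  by (cases "band d D U u X n") (simp add: band_time_def band_adj_def band_shift_def Let_def)

lemma S_0: "S 0 = xi 0"
  by (simp add: band_adj_def band_shift_def Let_def)

lemma S_Suc: "S (Suc n) = S n + xi (Suc n)"
  by (simp add: band_adj_def band_shift_def Let_def split: prod.split)

lemma T_mono: "m \<le> n \<Longrightarrow> T m \<le> T n"
  by (rule lift_Suc_mono_le[of T]) (auto simp: T_Suc intro!: Inf_greatest)

lemma T_nonneg: "0 \<le> T n"
  using T_mono[of 0 n] by (simp add: T_0)

lemma inside_0: "d < X 0 + S 0" "X 0 + S 0 < u"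
  unfolding S_0 band_adj_def using order by (auto simp: Let_def)

text \<open>The visits to \<open>{d, u}\<close> after \<open>T\<^sub>n\<close> form a closed set, so the infimum defining \<open>T\<^sub>n\<^sub>+\<^sub>1\<close> is
  attained; by the intermediate value theorem the path cannot leave the band before.\<close>

lemma first_exit:
  assumes T: "T n = ereal a" and inside: "d < X a + S n" "X a + S n < u"
  obtains "T (Suc n) = \<infinity>" "\<And>t. a \<le> t \<Longrightarrow> d < X t + S n \<and> X t + S n < u"
  | b where "T (Suc n) = ereal b" "a < b" "X b + S n \<in> {d, u}"
      "\<And>t. a \<le> t \<Longrightarrow> t < b \<Longrightarrow> d < X t + S n \<and> X t + S n < u"
proof -
  define E where "E = {t \<in> {a..}. X t + S n \<in> {d, u}}"
  have a: "0 \<le> a" using T_nonneg[of n] T by simp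
  have c: "continuous_on {a..} (\<lambda>t. X t + S n)"
    using a by (intro continuous_intros continuous_on_subset[OF cont]) auto
  have "closed ((\<lambda>t. X t + S n) -` {d, u} \<inter> {a..})"
    using c by (intro closed_vimage_Int) auto
  then have cl: "closed E" by (simp add: E_def vimage_def Int_def conj_commute)
  have Ea: "a < t" if "t \<in> E" for t
    using that inside by (cases "t = a") (auto simp: E_def)
  have TE: "T (Suc n) = Inf (ereal ` E)"
    unfolding T_Suc T using Ea by (intro arg_cong[where f=Inf]) (auto simp: E_def)
  have in_band: "d < X t + S n \<and> X t + S n < u" if t: "a \<le> t" "\<And>r. r \<in> E \<Longrightarrow> t < r" for t
  proof -
    have ct: "continuous_on {a..t} (\<lambda>t. X t + S n)"
      by (rule continuous_on_subset[OF c]) auto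
    have "\<not> X t + S n \<le> d"
      using IVT2'[of "\<lambda>t. X t + S n" t d a] ct t inside by (force simp: E_def)
    moreover have "\<not> u \<le> X t + S n"
      using IVT'[of "\<lambda>t. X t + S n" a u t] ct t inside by (force simp: E_def)
    ultimately show ?thesis by auto
  qed
  have bdd: "bdd_below E" by (rule bdd_belowI[of _ a]) (auto simp: E_def)
  show ?thesis
  proof (cases "E = {}")
    case True
    then have "T (Suc n) = \<infinity>" unfolding TE by (simp add: top_ereal_def)
    with True show ?thesis using in_band that(1) by auto
  next
    case False
    then have b: "Inf E \<in> E" using cl bdd by (intro closed_contains_Inf)
    have "T (Suc n) = ereal (Inf E)" unfolding TE using ereal_Inf'[OF bdd False] by simp
    moreover have "d < X t + S n \<and> X t + S n < u" if "a \<le> t" "t < Inf E" for t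
      using that cInf_lower[OF _ bdd] by (intro in_band) (auto intro: less_le_trans)
    ultimately show ?thesis using that(2)[of "Inf E"] b Ea by (auto simp: E_def)
  qed
qed

lemma T_pred: "T (Suc n) = ereal t \<Longrightarrow> \<exists>a. T n = ereal a"
  using T_mono[of n "Suc n"] T_nonneg[of n] by (cases "T n") auto

lemma inside: "T n = ereal t \<Longrightarrow> d < X t + S n \<and> X t + S n < u"
proof (induction n arbitrary: t)
  case 0
  then show ?case using inside_0 by (simp add: T_0 zero_ereal_def)
next
  case (Suc n)
  obtain a where a: "T n = ereal a" using T_pred[OF Suc.prems] by blast
  have ins: "d < X a + S n" "X a + S n < u" using Suc.IH[OF a] by auto
  have "X t + S n \<in> {d, u}"
    by (rule first_exit[OF a ins]) (use Suc.prems in simp_all)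
  then show ?case
    unfolding S_Suc xi_Suc[OF Suc.prems] using order by auto
qed

lemma at_jump:
  assumes "T (Suc n) = ereal b"
  obtains "X b + S n = d" "X b + S (Suc n) = D" "xi (Suc n) = D - d" 
  | "X b + S n = u" "X b + S (Suc n) = U" "xi (Suc n) = U - u"
proof -
  obtain a where a: "T n = ereal a" using T_pred[OF assms] by blast
  have ins: "d < X a + S n" "X a + S n < u" using inside[OF a] by auto
  have "X b + S n \<in> {d, u}"
    by (rule first_exit[OF a ins]) (use assms in simp_all)
  then show ?thesis
    using that order unfolding S_Suc xi_Suc[OF assms] by (auto split: if_splits)
qed

lemma T_less_Suc: "T n \<noteq> \<infinity> \<Longrightarrow> T n < T (Suc n)"
proof (cases "T n")
  case (real a)
  then have ins: "d < X a + S n" "X a + S n < u" using inside by auto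
  show ?thesis by (rule first_exit[OF real ins]) (simp_all add: real)
qed (use T_nonneg[of n] in auto)

lemma in_band_between:
  assumes "T n \<le> ereal t" "ereal t < T (Suc n)"
  shows "d < X t + S n \<and> X t + S n < u"
proof -
  obtain a where a: "T n = ereal a" using assms T_nonneg[of n] by (cases "T n") auto
  then have ins: "d < X a + S n" "X a + S n < u" using inside by auto
  show ?thesis by (rule first_exit[OF a ins]) (use assms a in simp_all)
qed

text \<open>Only finitely many adjustments happen in bounded time, and the times increase, so the indices of
  those up to \<open>t\<close> form an initial segment of the natural numbers.\<close>

lemma T_le_iff: "0 \<le> t \<Longrightarrow> T n \<le> ereal t \<longleftrightarrow> n \<le> N t"
proof (cases n)
  case (Suc m)
  have "{n. T (Suc n) \<le> ereal t} = {..<N t}"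
    unfolding band_count_def
  proof (rule finite_down_closed_nat)
    show "finite {n. T (Suc n) \<le> ereal t}"
      using finite_vimageI[OF band_policy(6)[OF cont order, of t], of Suc] by (simp add: vimage_def)
    show "n \<in> {n. T (Suc n) \<le> ereal t}" if "Suc n \<in> {n. T (Suc n) \<le> ereal t}" for n
      using that T_mono[of "Suc n" "Suc (Suc n)"] by (auto intro: order_trans)
  qed
  then have "m \<in> {n. T (Suc n) \<le> ereal t} \<longleftrightarrow> m \<in> {..<N t}" by simp
  with Suc show ?thesis by auto
qed (simp add: T_0)

lemma T_less_iff: "0 \<le> t \<Longrightarrow> ereal t < T n \<longleftrightarrow> N t < n"
  using T_le_iff[of t n] by auto

lemma N_mono: "0 \<le> s \<Longrightarrow> s \<le> t \<Longrightarrow> N s \<le> N t"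
  by (metis T_le_iff order.refl order_trans ereal_less_eq(3))

lemma N_0: "N 0 = 0"
  using T_less_iff[of 0 "Suc 0"] T_less_Suc[of 0] by (simp add: T_0 zero_ereal_def)

lemma Z_in_band: "0 \<le> t \<Longrightarrow> d < Z t \<and> Z t < u"
  unfolding band_state_def by (rule in_band_between) (simp_all add: T_le_iff T_less_iff)

lemma T_finite: "0 \<le> t \<Longrightarrow> n \<le> N t \<Longrightarrow> \<exists>r. T n = ereal r \<and> 0 \<le> r \<and> r \<le> t"
  using T_le_iff[of t n] T_nonneg[of n] by (cases "T n") auto

lemma T_strict: "m < n \<Longrightarrow> T m \<noteq> \<infinity> \<Longrightarrow> T m < T n"
  using T_less_Suc[of m] T_mono[of "Suc m" n] by auto

lemma Z_eq: "0 \<le> t \<Longrightarrow> X t + band_up d D U u X t - band_down d D U u X t = Z t"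
proof -
  assume t: "0 \<le> t"
  have S: "S n = (\<Sum>i\<le>n. xi i)" for n
    by (induction n) (simp_all add: S_0 S_Suc)
  have "{n. T n \<le> ereal t} = {..N t}" using T_le_iff[OF t] by auto
  then show ?thesis
    by (auto simp: band_up_def band_down_def band_state_def S add_diff_eq[symmetric]
        simp flip: sum_subtractf intro!: sum.cong)
qed

text \<open>Both components of the policy are sums of jumps at the times \<open>T\<^sub>n\<close>, with sizes \<open>max 0 \<xi>\<^sub>n\<close> and
  \<open>max 0 (- \<xi>\<^sub>n)\<close>. This lemma and the next two treat general jump sizes \<open>g\<close>.
  Just before \<open>r\<close>, all jumps strictly before \<open>r\<close> have happened and no other.\<close>

lemma left_lim_jump_sum:
  assumes "0 \<le> r"
  shows "left_lim 0 (\<lambda>t. \<Sum>n | T n \<le> ereal t. g n) r = (\<Sum>n | T n < ereal r. g n)"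
proof (cases "r = 0")
  case True
  have "{n. T n < ereal 0} = {}"
    using T_nonneg by (auto simp: not_less simp flip: zero_ereal_def)
  with True show ?thesis by (simp add: left_lim_def)
next
  case False
  with assms have r: "0 < r" by simp
  have "finite {n. T n < ereal r}"
    by (rule finite_subset[OF _ band_policy(6)[OF cont order, of r]]) auto
  then have "eventually (\<lambda>s. \<forall>n\<in>{n. T n < ereal r}. T n < ereal s) (at_left r)"
  proof (rule eventually_ball_finite, intro ballI)
    fix n assume "n \<in> {n. T n < ereal r}"
    then obtain a where a: "T n = ereal a" "a < r" using T_nonneg[of n] by (cases "T n") auto
    show "eventually (\<lambda>s. T n < ereal s) (at_left r)"
      using eventually_at_left_real[OF a(2)] by eventually_elim (simp add: a)
  qed
  moreover have "eventually (\<lambda>s. s < r) (at_left r)"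
    by (simp add: eventually_at_filter)
  ultimately have "eventually (\<lambda>s. (\<Sum>n | T n \<le> ereal s. g n) = (\<Sum>n | T n < ereal r. g n)) (at_left r)"
  proof eventually_elim
    case (elim s)
    then have "{n. T n \<le> ereal s} = {n. T n < ereal r}"
      by (auto intro: le_less_trans less_imp_le)
    then show ?case by simp
  qed
  then have "((\<lambda>s. \<Sum>n | T n \<le> ereal s. g n) \<longlongrightarrow> (\<Sum>n | T n < ereal r. g n)) (at_left r)"
    by (rule tendsto_eventually)
  then show ?thesis using r
    by (auto simp: left_lim_def trivial_limit_at_left_real intro!: tendsto_Lim)
qed

text \<open>The process grows over \<open>[r,s]\<close> by the jumps in that interval. If there is none at \<open>r\<close> itself, it
  stays constant for \<open>s\<close> up to the next jump time, so \<open>r\<close> is not an increasing point.\<close>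

lemma increasing_points_jump_sum:
  assumes t: "0 \<le> t" and g: "\<And>n. 0 \<le> g n"
  shows "increasing_points (\<lambda>t. \<Sum>n | T n \<le> ereal t. g n) t
    = (\<lambda>n. real_of_ereal (T n)) ` {n. n \<le> N t \<and> 0 < g n}"
proof -
  have diff: "(\<Sum>n | T n \<le> ereal s. g n) - (\<Sum>n | T n < ereal r. g n) 
      = (\<Sum>n | ereal r \<le> T n \<and> T n \<le> ereal s. g n)" if "r \<le> s" for r s
  proof -
    have sub: "{n. T n < ereal r} \<subseteq> {n. T n \<le> ereal s}"
    proof clarify
      fix n assume "T n < ereal r"
      moreover have "ereal r \<le> ereal s" using that by simp
      ultimately show "T n \<le> ereal s" by order
    qed
    have "{n. T n \<le> ereal s} - {n. T n < ereal r} = {n. ereal r \<le> T n \<and> T n \<le> ereal s}" by auto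
    then show ?thesis
      using sum_diff[OF band_policy(6)[OF cont order] sub, of g] by simp
  qed
  have iff: "(\<forall>s>r. (\<Sum>n | T n \<le> ereal s. g n) - (\<Sum>n | T n < ereal r. g n) > 0) 
      \<longleftrightarrow> (\<exists>n. T n = ereal r \<and> 0 < g n)" (is "?L \<longleftrightarrow> ?R") if r: "0 \<le> r" for r
  proof
    assume ?R
    then obtain n where n: "T n = ereal r" "0 < g n" by auto
    show ?L
    proof (intro allI impI)
      fix s assume s: "r < s"
      have fin: "finite {n. ereal r \<le> T n \<and> T n \<le> ereal s}"
        by (rule finite_subset[OF _ band_policy(6)[OF cont order, of s]]) auto
      have "0 < (\<Sum>n | ereal r \<le> T n \<and> T n \<le> ereal s. g n)"
        using fin n g s by (intro sum_pos2[of _ n]) auto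
      then show "(\<Sum>n | T n \<le> ereal s. g n) - (\<Sum>n | T n < ereal r. g n) > 0"
        using diff[of r s] s by simp
    qed
  next
    assume L: ?L
    have "ereal r < T (Suc (N r))" using T_less_iff[OF r] by simp
    then obtain s where s: "r < s" "ereal s < T (Suc (N r))"
      using ereal_dense2[of "ereal r"] by (metis ereal_less(1) less_ereal.simps(1))
    have "0 < (\<Sum>n | ereal r \<le> T n \<and> T n \<le> ereal s. g n)"
      unfolding diff[OF less_imp_le[OF s(1)], symmetric] using L s(1) by blast
    then obtain n where n: "ereal r \<le> T n" "T n \<le> ereal s" "0 < g n"
      using sum_nonpos[of "{n. ereal r \<le> T n \<and> T n \<le> ereal s}" g] by (force simp: not_less)
    then have "T n < T (Suc (N r))" using s by order
    then have "n \<le> N r" using T_mono[of "Suc (N r)" n] by (force simp: not_less_eq_eq)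
    then have "T n \<le> ereal r" using T_le_iff[OF r] by simp
    then show ?R using n by (intro exI[of _ n]) auto
  qed
  have "increasing_points (\<lambda>t. \<Sum>n | T n \<le> ereal t. g n) t = 
    {r \<in> {0..t}. \<exists>n. T n = ereal r \<and> 0 < g n}"
    unfolding increasing_points_def
  proof (intro Collect_cong conj_cong refl)
    fix r assume "r \<in> {0..t}"
    then have r: "0 \<le> r" by simp
    show "(\<forall>s>r. (\<Sum>n | T n \<le> ereal s. g n) - left_lim 0 (\<lambda>t. \<Sum>n | T n \<le> ereal t. g n) r > 0)
        \<longleftrightarrow> (\<exists>n. T n = ereal r \<and> 0 < g n)"
      unfolding left_lim_jump_sum[OF r] by (rule iff[OF r])
  qed
  also have "\<dots> = (\<lambda>n. real_of_ereal (T n)) ` {n. n \<le> N t \<and> 0 < g n}"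
  proof (intro equalityI subsetI)
    fix r assume "r \<in> {r \<in> {0..t}. \<exists>n. T n = ereal r \<and> 0 < g n}"
    then obtain n where n: "T n = ereal r" "0 < g n" "r \<le> t" by auto
    then have "n \<le> N t" using T_le_iff[OF t, of n] by simp
    with n show "r \<in> (\<lambda>n. real_of_ereal (T n)) ` {n. n \<le> N t \<and> 0 < g n}"
      by (intro rev_image_eqI[of n]) simp_all
  next
    fix r assume "r \<in> (\<lambda>n. real_of_ereal (T n)) ` {n. n \<le> N t \<and> 0 < g n}"
    then obtain n where n: "r = real_of_ereal (T n)" "n \<le> N t" "0 < g n" by blast
    then obtain q where "T n = ereal q" "0 \<le> q" "q \<le> t" using T_finite[OF t] by blast
    with n show "r \<in> {r \<in> {0..t}. \<exists>n. T n = ereal r \<and> 0 < g n}"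
      by auto
  qed
  finally show ?thesis .
qed

lemma num_increasing_jump_sum:
  assumes t: "0 \<le> t" and g: "\<And>n. 0 \<le> g n"
  shows "num_increasing (\<lambda>t. \<Sum>n | T n \<le> ereal t. g n) t
    = ennreal (\<Sum>n\<le>N t. if 0 < g n then 1 else 0)"
proof -
  have "inj_on (\<lambda>n. real_of_ereal (T n)) {n. n \<le> N t \<and> 0 < g n}"
  proof (rule linorder_inj_onI')
    fix i j assume ij: "i \<in> {n. n \<le> N t \<and> 0 < g n}" "j \<in> {n. n \<le> N t \<and> 0 < g n}" "i < j"
    then show "real_of_ereal (T i) \<noteq> real_of_ereal (T j)"
      using T_finite[OF t, of i] T_finite[OF t, of j] T_strict[of i j] by auto
  qed
  then have "card (increasing_points (\<lambda>t. \<Sum>n | T n \<le> ereal t. g n) t) = card {n. n \<le> N t \<and> 0 < g n}"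
    unfolding increasing_points_jump_sum[OF t g] by (rule card_image)
  also have "real \<dots> = (\<Sum>n\<le>N t. if 0 < g n then 1 else 0)"
    by (simp add: sum.If_cases Int_def)
  finally show ?thesis
    unfolding num_increasing_def increasing_points_jump_sum[OF t g]
    by (subst emeasure_count_space_finite) (auto simp: ennreal_of_nat_eq_real_of_nat)
qed

text \<open>Fixed and proportional costs combine into one charge per adjustment; the term \<open>n = 0\<close> is the
  charge for the adjustment at time \<open>0\<close>.\<close>

lemma path_cost_band:
  assumes t: "0 \<le> t" and pos: "0 < K" "0 < L" "0 < k" "0 < l"
  shows "path_cost h K L k l X (band_up d D U u X) (band_down d D U u X) t =
    (\<integral>\<^sup>+s\<in>{0..t}. ennreal (h (Z s)) \<partial>lborel) + ennreal (\<Sum>n\<le>N t. jump_cost K L k l (xi n))"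
proof -
  have set: "{n. T n \<le> ereal t} = {..N t}" using T_le_iff[OF t] by auto
  have hold: "(\<integral>\<^sup>+s\<in>{0..t}. ennreal (h (X s + band_up d D U u X s - band_down d D U u X s)) \<partial>lborel)
    = (\<integral>\<^sup>+s\<in>{0..t}. ennreal (h (Z s)) \<partial>lborel)"
    by (intro nn_integral_cong) (auto simp: Z_eq split: split_indicator)
  have up: "num_increasing (band_up d D U u X) t = ennreal (\<Sum>n\<le>N t. if 0 < xi n then 1 else 0)"
    unfolding band_up_def[abs_def] using num_increasing_jump_sum[OF t, of "\<lambda>n. max 0 (xi n)"] by (simp add: less_max_iff_disj)
  have down: "num_increasing (band_down d D U u X) t = ennreal (\<Sum>n\<le>N t. if xi n < 0 then 1 else 0)"
    unfolding band_down_def[abs_def] using num_increasing_jump_sum[OF t, of "\<lambda>n. max 0 (- xi n)"] by (simp add: less_max_iff_disj)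
  have sum: "K * (\<Sum>n\<le>N t. if 0 < xi n then 1 else 0) + L * (\<Sum>n\<le>N t. if xi n < 0 then 1 else 0)
     + k * (\<Sum>n\<le>N t. max 0 (xi n)) + l * (\<Sum>n\<le>N t. max 0 (- xi n)) = (\<Sum>n\<le>N t. jump_cost K L k l (xi n))"
    by (auto simp: sum_distrib_left jump_cost_def simp flip: sum.distrib intro!: sum.cong)
  have "0 \<le> (\<Sum>n\<le>N t. if 0 < xi n then 1 else 0 :: real)" "0 \<le> (\<Sum>n\<le>N t. if xi n < 0 then 1 else 0 :: real)"
    "0 \<le> (\<Sum>n\<le>N t. max 0 (xi n))" "0 \<le> (\<Sum>n\<le>N t. max 0 (- xi n))"
    by (intro sum_nonneg; simp)+
  then show ?thesis
    unfolding path_cost_def hold up down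
    unfolding band_up_def band_down_def set sum[symmetric] add.assoc
    using pos by (simp add: ennreal_mult ennreal_plus del: sum.If_cases)
qed

end

section \<open>Sums over a refining time grid\<close>

lemma grid_ceiling_tendsto:
  fixes t r :: real
  assumes "0 < t"
  shows "(\<lambda>n. t * of_int \<lceil>real n * r / t\<rceil> / real n) \<longlonglongrightarrow> r"
proof (rule real_tendsto_sandwich)
  show "eventually (\<lambda>n. r \<le> t * of_int \<lceil>real n * r / t\<rceil> / real n) sequentially"
    using eventually_gt_at_top[of 0]
  proof eventually_elim
    case (elim n)
    define c :: real where "c = of_int \<lceil>real n * r / t\<rceil>"
    have "real n * r / t \<le> c" by (simp add: c_def)
    with elim assms show ?case unfolding c_def[symmetric] by (simp add: field_simps)
  qed
  show "eventually (\<lambda>n. t * of_int \<lceil>real n * r / t\<rceil> / real n \<le> r + t / real n) sequentially"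
    using eventually_gt_at_top[of 0]
  proof eventually_elim
    case (elim n)
    define c :: real where "c = of_int \<lceil>real n * r / t\<rceil>"
    have "c \<le> real n * r / t + 1" unfolding c_def by linarith
    with elim assms show ?case unfolding c_def[symmetric] by (simp add: field_simps)
  qed
  have "(\<lambda>n. r + t / real n) \<longlonglongrightarrow> r + 0"
    by (intro tendsto_intros lim_const_over_n)
  then show "(\<lambda>n. r + t / real n) \<longlonglongrightarrow> r" by simp
qed simp

lemma grid_floor_tendsto:
  fixes t r :: real
  assumes "0 < t"
  shows "(\<lambda>n. t * of_int \<lfloor>real n * r / t\<rfloor> / real n) \<longlonglongrightarrow> r"
  using tendsto_minus[OF grid_ceiling_tendsto[OF assms, of "- r"]]
  by (simp add: ceiling_def)

text \<open>The sum is the integral of the step function that samples \<open>f\<close> at the grid point to the left.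
  Away from the finite set \<open>E\<close> this step function converges to \<open>f\<close>, and dominated convergence
  applies. In the application \<open>E\<close> consists of the adjustment times.\<close>

lemma riemann_sum_tendsto:
  fixes f :: "real \<Rightarrow> real"
  assumes t: "0 < t" and meas: "set_borel_measurable lborel {0..t} f"
    and bd: "\<And>s. 0 \<le> s \<Longrightarrow> s \<le> t \<Longrightarrow> \<bar>f s\<bar> \<le> B" and fin: "finite E"
    and cont: "\<And>s. 0 < s \<Longrightarrow> s < t \<Longrightarrow> s \<notin> E \<Longrightarrow> isCont f s"
  shows "(\<lambda>n. \<Sum>i<n. t / real n * f (t * real i / real n)) \<longlonglongrightarrow> (LINT s:{0..t}|lborel. f s)"
proof -
  define g where "g n s = (\<Sum>i<n. f (t * real i / real n) *
    indicator {t * real i / real n..<t * real (Suc i) / real n} s)" for n s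
  have int: "(\<integral>s. g n s \<partial>lborel) = (\<Sum>i<n. t / real n * f (t * real i / real n))" for n
    unfolding g_def using t
    by (subst Bochner_Integration.integral_sum)
       (auto intro!: sum.cong simp: divide_right_mono field_simps)
  have gv: "g n s = f (t * of_int \<lfloor>real n * s / t\<rfloor> / real n)" if s: "0 \<le> s" "s < t" "0 < n" for n s
  proof -
    define p where "p = nat \<lfloor>real n * s / t\<rfloor>"
    have p: "of_int \<lfloor>real n * s / t\<rfloor> = real p" using s by (simp add: p_def)
    have "s \<in> {t * real i / real n..<t * real (Suc i) / real n} \<longleftrightarrow> i = p" for i
    proof -
      have "s \<in> {t * real i / real n..<t * real (Suc i) / real n} \<longleftrightarrow>
        real i \<le> real n * s / t \<and> real n * s / t < real i + 1"
        using s t by (simp add: field_simps)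
      also have "\<dots> \<longleftrightarrow> \<lfloor>real n * s / t\<rfloor> = int i"
        using floor_eq_iff[of "real n * s / t" "int i"] by simp
      also have "\<dots> \<longleftrightarrow> i = p" using s t by (auto simp: p_def)
      finally show ?thesis .
    qed
    moreover have "p < n"
    proof -
      have "real n * s / t < real n" using s t by (simp add: field_simps)
      then show ?thesis using p by linarith
    qed
    ultimately show ?thesis
      unfolding g_def p indicator_def by simp
  qed
  have g0: "g n s = 0" if "s < 0 \<or> t \<le> s" for n s
  proof -
    have "s \<notin> {t * real i / real n..<t * real (Suc i) / real n}" if i: "i < n" for i
    proof
      assume s: "s \<in> {t * real i / real n..<t * real (Suc i) / real n}"
      have "0 \<le> t * real i / real n" using t by simp
      moreover have "t * real (Suc i) / real n \<le> t"
        using i t by (simp add: field_simps del: of_nat_Suc)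
      ultimately show False using s \<open>s < 0 \<or> t \<le> s\<close> by auto
    qed
    then show ?thesis unfolding g_def by (intro sum.neutral) auto
  qed
  have gt: "0 \<le> t * of_int \<lfloor>real n * s / t\<rfloor> / real n" "t * of_int \<lfloor>real n * s / t\<rfloor> / real n \<le> s"
    if "0 \<le> s" "0 < n" for n s
  proof -
    define c :: real where "c = of_int \<lfloor>real n * s / t\<rfloor>"
    have "c \<le> real n * s / t" by (simp add: c_def)
    then show "t * of_int \<lfloor>real n * s / t\<rfloor> / real n \<le> s" 
      unfolding c_def[symmetric] using that t by (simp add: field_simps)
    show "0 \<le> t * of_int \<lfloor>real n * s / t\<rfloor> / real n" using that t by simp
  qed
  have B: "0 \<le> B" using bd[of 0] t by linarith
  have gB: "\<bar>g n s\<bar> \<le> B * indicator {0..t} s" for n s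
  proof (cases "n = 0 \<or> s < 0 \<or> t \<le> s")
    case True
    then show ?thesis using g0[of s n] B by (auto simp: g_def)
  next
    case False
    then show ?thesis using gv[of s n] gt[of s n] bd[of "t * of_int \<lfloor>real n * s / t\<rfloor> / real n"]
      by auto
  qed
  have "(\<lambda>n. \<integral>s. g n s \<partial>lborel) \<longlonglongrightarrow> (\<integral>s. indicator {0..t} s *\<^sub>R f s \<partial>lborel)"
  proof (rule integral_dominated_convergence[where w="\<lambda>s. B * indicator {0..t} s"])
    show "(\<lambda>s. indicator {0..t} s *\<^sub>R f s) \<in> borel_measurable lborel"
      using meas by (simp add: set_borel_measurable_def)
    show "g n \<in> borel_measurable lborel" for n unfolding g_def by measurable
    show "AE s in lborel. norm (g n s) \<le> B * indicator {0..t} s" for n using gB by simp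
    show "integrable lborel (\<lambda>s. B * indicator {0..t} s :: real)"
      by (intro integrable_mult_right integrable_real_indicator) (auto simp: emeasure_lborel_Icc_eq)
    have "AE s in lborel. s \<notin> insert 0 (insert t E)"
      using fin by (intro AE_not_in finite_imp_null_set_lborel) simp
    then show "AE s in lborel. (\<lambda>n. g n s) \<longlonglongrightarrow> indicator {0..t} s *\<^sub>R f s"
    proof eventually_elim
      case (elim s)
      show ?case
      proof (cases "0 < s \<and> s < t")
        case False
        then have "s < 0 \<or> t < s" using elim by auto
        then show ?thesis using g0[of s] by (auto simp: indicator_def)
      next
        case True
        then have "isCont f s" using cont elim by auto
        then have "(\<lambda>n. f (t * of_int \<lfloor>real n * s / t\<rfloor> / real n)) \<longlonglongrightarrow> f s"
          by (rule isCont_tendsto_compose) (rule grid_floor_tendsto[OF t])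
        moreover have "eventually (\<lambda>n. f (t * of_int \<lfloor>real n * s / t\<rfloor> / real n) = g n s) sequentially"
          using eventually_gt_at_top[of 0] by eventually_elim (use True in \<open>simp add: gv\<close>)
        ultimately have "(\<lambda>n. g n s) \<longlonglongrightarrow> f s" by (rule Lim_transform_eventually)
        then show ?thesis using True by simp
      qed
    qed
  qed
  then show ?thesis by (simp only: int set_lebesgue_integral_def)
qed

context band_path
begin

text \<open>Within a grid cell \<open>X\<close> is frozen at the right end, so the sum over the adjustments in the cell
  telescopes. The adjustment \<open>j + 1\<close> belongs to the cell \<open>(s\<^sub>i, s\<^sub>i\<^sub>+\<^sub>1]\<close> that contains its time,
  and \<open>c j\<close> is the right end of that cell.\<close>

lemma jump_grid_sum:
  fixes \<psi> :: "nat \<Rightarrow> real \<Rightarrow> real"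
  assumes t: "0 < t" and n: "0 < n"
  defines "s \<equiv> \<lambda>i. t * real i / real n"
  defines "c \<equiv> \<lambda>j. t * of_int \<lceil>real n * real_of_ereal (T (Suc j)) / t\<rceil> / real n"
  shows "(\<Sum>i<n. \<psi> (N (s (Suc i))) (X (s (Suc i))) - \<psi> (N (s i)) (X (s (Suc i))))
    = (\<Sum>j<N t. \<psi> (Suc j) (X (c j)) - \<psi> j (X (c j)))"
proof -
  have s0: "0 \<le> s i" for i using t by (simp add: s_def)
  have "(\<Sum>i<p. \<psi> (N (s (Suc i))) (X (s (Suc i))) - \<psi> (N (s i)) (X (s (Suc i))))
    = (\<Sum>j<N (s p). \<psi> (Suc j) (X (c j)) - \<psi> j (X (c j)))" for p
  proof (induction p)
    case 0
    then show ?case by (simp add: s_def N_0)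
  next
    case (Suc p)
    have mono: "N (s p) \<le> N (s (Suc p))"
      using t s0 by (intro N_mono) (auto simp: s_def divide_right_mono)
    have c: "c j = s (Suc p)" if "N (s p) \<le> j" "j < N (s (Suc p))" for j
    proof -
      have "Suc j \<le> N (s (Suc p))" using that by simp
      then obtain r where r: "T (Suc j) = ereal r" using T_finite[OF s0] by blast
      then have "s p < r" "r \<le> s (Suc p)"
        using T_less_iff[OF s0, of p "Suc j"] T_le_iff[OF s0, of "Suc j" "Suc p"] that by auto
      then have "real p < real n * r / t" "real n * r / t \<le> real p + 1"
        using n t by (simp_all add: s_def field_simps)
      then have "\<lceil>real n * r / t\<rceil> = int (Suc p)"
        by (intro ceiling_unique) auto
      then show ?thesis by (simp add: c_def s_def r)
    qed
    have "\<psi> (N (s (Suc p))) (X (s (Suc p))) - \<psi> (N (s p)) (X (s (Suc p)))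
      = (\<Sum>j=N (s p)..<N (s (Suc p)). \<psi> (Suc j) (X (s (Suc p))) - \<psi> j (X (s (Suc p))))"
      using sum_Suc_diff'[OF mono, of "\<lambda>j. \<psi> j (X (s (Suc p)))"] by simp
    also have "\<dots> = (\<Sum>j=N (s p)..<N (s (Suc p)). \<psi> (Suc j) (X (c j)) - \<psi> j (X (c j)))"
      by (intro sum.cong) (auto simp: c)
    finally show ?case
      using Suc sum.atLeastLessThan_concat[OF le0 mono, of "\<lambda>j. \<psi> (Suc j) (X (c j)) - \<psi> j (X (c j))"]
      by (simp add: lessThan_atLeast0)
  qed
  from this[of n] show ?thesis using n by (simp add: s_def)
qed

lemma jump_grid_sum_tendsto:
  fixes \<psi> :: "nat \<Rightarrow> real \<Rightarrow> real"
  assumes t: "0 < t" and \<psi>: "\<And>j. continuous_on UNIV (\<psi> j)"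
  shows "(\<lambda>n. \<Sum>i<n. \<psi> (N (t * real (Suc i) / real n)) (X (t * real (Suc i) / real n))
      - \<psi> (N (t * real i / real n)) (X (t * real (Suc i) / real n)))
    \<longlonglongrightarrow> (\<Sum>j<N t. \<psi> (Suc j) (X (real_of_ereal (T (Suc j)))) - \<psi> j (X (real_of_ereal (T (Suc j)))))"
    (is "?L \<longlonglongrightarrow> ?R")
proof -
  define c where "c n j = t * of_int \<lceil>real n * real_of_ereal (T (Suc j)) / t\<rceil> / real n" for n j
  have "(\<lambda>n. \<Sum>j<N t. \<psi> (Suc j) (X (c n j)) - \<psi> j (X (c n j))) \<longlonglongrightarrow> ?R"
  proof (intro tendsto_sum tendsto_diff)
    fix j assume "j \<in> {..<N t}"
    then obtain r where r: "T (Suc j) = ereal r" "0 \<le> r" 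
      using T_finite[of t "Suc j"] t by auto
    have "c n j \<ge> 0" for n 
    proof -
      have "0 \<le> real n * r / t" using r t by simp
      then have "0 \<le> \<lceil>real n * r / t\<rceil>" by linarith
      then show ?thesis using r t by (simp add: c_def)
    qed
    moreover have "(\<lambda>n. c n j) \<longlonglongrightarrow> r"
      unfolding c_def r using grid_ceiling_tendsto[OF t] by simp
    ultimately have "(\<lambda>n. X (c n j)) \<longlonglongrightarrow> X r"
      using r by (intro continuous_on_tendsto_compose[OF cont]) auto
    then have "(\<lambda>n. \<psi> i (X (c n j))) \<longlonglongrightarrow> \<psi> i (X (real_of_ereal (T (Suc j))))" for i
      by (intro continuous_on_tendsto_compose[OF \<psi>]) (auto simp: r)
    then show "(\<lambda>n. \<psi> (Suc j) (X (c n j))) \<longlonglongrightarrow> \<psi> (Suc j) (X (real_of_ereal (T (Suc j))))"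
      "(\<lambda>n. \<psi> j (X (c n j))) \<longlonglongrightarrow> \<psi> j (X (real_of_ereal (T (Suc j))))" by this+
  qed
  moreover have "eventually (\<lambda>n. (\<Sum>j<N t. \<psi> (Suc j) (X (c n j)) - \<psi> j (X (c n j))) = ?L n) sequentially"
    using eventually_gt_at_top[of 0]
    by eventually_elim (simp only: jump_grid_sum[OF t] c_def)
  ultimately show ?thesis by (rule Lim_transform_eventually)
qed

text \<open>The indicator keeps negative times out, where the path \<open>X\<close> need not be measurable.\<close>

lemma Z_measurable:
  assumes G: "\<And>j. continuous_on UNIV (G j)"
  shows "set_borel_measurable lborel {0..t} (\<lambda>s. G (N s) (Z s) :: real)"
proof -
  have N_neg: "N s = 0" if "s < 0" for s
  proof -
    have "\<not> T (Suc n) \<le> ereal s" for n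
    proof
      assume "T (Suc n) \<le> ereal s"
      with T_nonneg[of "Suc n"] have "0 \<le> ereal s" by order
      with that show False by simp
    qed
    then show ?thesis by (simp add: band_count_def)
  qed
  have "mono (\<lambda>s. real (N s))"
  proof (rule monoI)
    fix r s :: real assume "r \<le> s"
    then show "real (N r) \<le> real (N s)" using N_mono[of r s] N_neg[of r] by (cases "r < 0") auto
  qed
  then have "(\<lambda>s. real (N s)) \<in> borel_measurable borel" by (rule borel_measurable_mono)
  then have "(\<lambda>s. nat \<lfloor>real (N s)\<rfloor>) \<in> measurable borel (count_space UNIV)" by measurable
  then have N: "N \<in> measurable borel (count_space UNIV)" by simp
  have "continuous_on UNIV (\<lambda>s. X (max 0 s))"
    by (intro continuous_on_compose2[OF cont]) (auto intro!: continuous_intros)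
  then have X: "(\<lambda>s. X (max 0 s)) \<in> borel_measurable borel" 
    by (rule borel_measurable_continuous_onI)
  have G': "G j \<in> borel_measurable borel" for j
    by (rule borel_measurable_continuous_onI[OF G])
  have "(\<lambda>s. indicator {0..t} s * G (N s) (X (max 0 s) + S (N s))) \<in> borel_measurable borel"
    by (rule measurable_compose_countable[OF _ N]) (use X G' in measurable)
  also have "(\<lambda>s. indicator {0..t} s * G (N s) (X (max 0 s) + S (N s))) 
      = (\<lambda>s. indicator {0..t} s *\<^sub>R G (N s) (Z s))"
    by (auto simp: band_state_def indicator_def max_def)
  finally show ?thesis by (simp add: set_borel_measurable_def)
qed

lemma Z_set_integrable:
  assumes G: "\<And>j. continuous_on UNIV (G j)"
    and bd: "\<And>j z. d \<le> z \<Longrightarrow> z \<le> u \<Longrightarrow> \<bar>G j z\<bar> \<le> B"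
  shows "set_integrable lborel {0..t} (\<lambda>s. G (N s) (Z s) :: real)"
  unfolding set_integrable_def
proof (rule Bochner_Integration.integrable_bound)
  show "integrable lborel (\<lambda>s. B * indicator {0..t} s :: real)"
    by (intro integrable_mult_right integrable_real_indicator) (auto simp: emeasure_lborel_Icc_eq)
  show "(\<lambda>s. indicator {0..t} s *\<^sub>R G (N s) (Z s)) \<in> borel_measurable lborel"
    using Z_measurable[OF G] by (simp add: set_borel_measurable_def)
  have "\<bar>G (N s) (Z s)\<bar> \<le> \<bar>B\<bar>" if "0 \<le> s" for s
    using bd[of "Z s" "N s"] Z_in_band[OF that] by auto
  then show "AE s in lborel. norm (indicator {0..t} s *\<^sub>R G (N s) (Z s)) \<le> norm (B * indicator {0..t} s)"
    by (auto simp: indicator_def)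
qed

text \<open>Between consecutive adjustment times the count is constant, so \<open>G (N s) (Z s)\<close> is continuous
  there. The first argument of \<open>G\<close> will carry the truncation after finitely many adjustments.\<close>

lemma Z_riemann_sum_tendsto:
  assumes t: "0 < t" and G: "\<And>j. continuous_on UNIV (G j)"
    and bd: "\<And>j z. d \<le> z \<Longrightarrow> z \<le> u \<Longrightarrow> \<bar>G j z\<bar> \<le> B"
  shows "(\<lambda>n. \<Sum>i<n. t / real n * G (N (t * real i / real n)) (Z (t * real i / real n)))
    \<longlonglongrightarrow> (LINT s:{0..t}|lborel. G (N s) (Z s))"
proof (rule riemann_sum_tendsto[OF t Z_measurable[OF G]])
  show "\<bar>G (N s) (Z s)\<bar> \<le> B" if "0 \<le> s" for s
    using bd[of "Z s" "N s"] Z_in_band[OF that] by auto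
  show "finite ((\<lambda>n. real_of_ereal (T n)) ` {..N t})" by simp
  fix s assume s: "0 < s" "s < t" "s \<notin> (\<lambda>n. real_of_ereal (T n)) ` {..N t}"
  define p where "p = N s"
  have p: "p \<le> N t" "T p \<le> ereal s" "ereal s < T (Suc p)"
    using s N_mono[of s t] T_le_iff[of s p] T_less_iff[of s "Suc p"] by (auto simp: p_def)
  obtain a where a: "T p = ereal a" "0 \<le> a" using T_finite[of t p] p s by auto
  have "a \<le> s" using p a by simp
  moreover have "a \<noteq> s" using s(3) p(1) a by (metis atMost_iff image_eqI real_of_ereal.simps(1))
  ultimately have "a < s" by simp
  obtain b where b: "s < b" "ereal b < T (Suc p)"
    using ereal_dense2[OF p(3)] by auto
  have N: "N r = p" if "r \<in> {a<..<b}" for r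
  proof -
    have "0 \<le> r" using that a by auto
    moreover have "ereal r < T (Suc p)" using that by (intro less_trans[OF _ b(2)]) simp
    moreover have "T p \<le> ereal r" using that a by simp
    ultimately show ?thesis using T_le_iff[of r p] T_less_iff[of r "Suc p"] by auto
  qed
  have "isCont X s"
    using s continuous_on_interior[OF cont, of s] by (simp add: interior_real_atLeast)
  then have X: "isCont (\<lambda>r. X r + S p) s" by (intro continuous_intros)
  have "isCont (G p) (X s + S p)" using G[of p] by (simp add: continuous_on_eq_continuous_at)
  with X have "isCont (\<lambda>r. G p (X r + S p)) s" by (rule isCont_o2)
  moreover have "eventually (\<lambda>r. r \<in> {a<..<b}) (nhds s)"
    using b(1) \<open>a < s\<close> by (intro eventually_nhds_in_open) auto
  then have "eventually (\<lambda>r. G p (X r + S p) = G (N r) (Z r)) (nhds s)"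
    by eventually_elim (simp only: N band_state_def)
  ultimately show "isCont (\<lambda>r. G (N r) (Z r)) s"
    using isCont_cong[of "\<lambda>r. G p (X r + S p)" "\<lambda>r. G (N r) (Z r)" s] by blast
qed

end

section \<open>One step of Brownian motion\<close>

context brownian_motion
begin

lemma space_F: "0 \<le> t \<Longrightarrow> space (F t) = space M"
  using subalgebra_F by (simp add: subalgebra_def)

lemma measurable_F: "0 \<le> s \<Longrightarrow> s \<le> t \<Longrightarrow> f \<in> measurable (F s) A \<Longrightarrow> f \<in> measurable (F t) A"
  by (rule measurable_from_subalg[OF mono_F])

lemma measurable_M: "0 \<le> s \<Longrightarrow> f \<in> measurable (F s) A \<Longrightarrow> f \<in> measurable M A"
  by (rule measurable_from_subalg[OF subalgebra_F])

lemma W_measurable [measurable]: "0 \<le> t \<Longrightarrow> W t \<in> borel_measurable M"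
  by (rule measurable_M[OF _ adapted])

lemma increment_moments:
  assumes s: "0 \<le> s" "s < t"
  shows "integrable M (\<lambda>\<omega>. (W t \<omega> - W s \<omega>) ^ k)"
    and "(\<integral>\<omega>. W t \<omega> - W s \<omega> \<partial>M) = 0"
    and "(\<integral>\<omega>. (W t \<omega> - W s \<omega>) ^ 2 \<partial>M) = t - s"
    and "(\<integral>\<omega>. (W t \<omega> - W s \<omega>) ^ 4 \<partial>M) = 3 * (t - s) ^ 2"
proof -
  let ?\<phi> = "normal_density 0 (sqrt (t - s))"
  have p: "0 < sqrt (t - s)" using s by simp
  note D = normal_increments[OF s]
  show "integrable M (\<lambda>\<omega>. (W t \<omega> - W s \<omega>) ^ k)"
    using distributed_integrable[OF D, of "\<lambda>y. y ^ k"] integrable_normal_moment[OF p, of 0 k] by simp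
  have E: "(\<integral>\<omega>. (W t \<omega> - W s \<omega>) ^ k \<partial>M) = (\<integral>y. ?\<phi> y * y ^ k \<partial>lborel)" for k
    using distributed_integral[OF D, of "\<lambda>y. y ^ k"] by simp
  show "(\<integral>\<omega>. W t \<omega> - W s \<omega> \<partial>M) = 0"
    using E[of 1] integral_normal_moment_odd[OF p, of 0 0] by simp
  show "(\<integral>\<omega>. (W t \<omega> - W s \<omega>) ^ 2 \<partial>M) = t - s"
    using E[of 2] integral_normal_moment_even[OF p, of 0 1] s by (simp add: fact_numeral)
  show "(\<integral>\<omega>. (W t \<omega> - W s \<omega>) ^ 4 \<partial>M) = 3 * (t - s) ^ 2"
    using E[of 4] integral_normal_moment_even[OF p, of 0 2] s 
    by (simp add: fact_numeral power_divide)
qed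

text \<open>The defining independence of the increment from the past sigma-algebra, passed on to
  functions that generate smaller sigma-algebras.\<close>

lemma increment_indep_var:
  assumes s: "0 \<le> s" "s < t" and Y: "Y \<in> borel_measurable (F s)" and g: "g \<in> borel_measurable borel"
  shows "indep_var borel Y borel (\<lambda>\<omega>. g (W t \<omega> - W s \<omega>) :: real)"
  unfolding indep_var_eq
proof (intro conjI)
  have W: "W t \<in> borel_measurable M" "W s \<in> borel_measurable M" using s by auto
  show "random_variable borel Y" using measurable_M[OF s(1) Y] .
  show "random_variable borel (\<lambda>\<omega>. g (W t \<omega> - W s \<omega>))" using W g by measurable
  let ?I = "\<lambda>\<omega>. W t \<omega> - W s \<omega>"
  let ?G = "{?I -` A \<inter> space M |A. A \<in> sets borel}"
  have "Int_stable (sets (F s))" by (rule sets.Int_stable)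
  moreover have "Int_stable ?G"
  proof (rule Int_stableI)
    fix a b assume "a \<in> ?G" "b \<in> ?G"
    then obtain A B where "A \<in> sets borel" "B \<in> sets borel" 
      "a = ?I -` A \<inter> space M" "b = ?I -` B \<inter> space M" by blast
    then show "a \<inter> b \<in> ?G" by (intro CollectI exI[of _ "A \<inter> B"]) auto
  qed
  ultimately have ind: "indep_set (sigma_sets (space M) (sets (F s))) (sigma_sets (space M) ?G)"
    using indep_increments[OF s] by (intro indep_set_sigma_sets)
  have 1: "sigma_sets (space M) {Y -` A \<inter> space M |A. A \<in> sets borel}
      \<subseteq> sigma_sets (space M) (sets (F s))"
    using measurable_sets[OF Y] space_F[OF s(1)] by (intro sigma_sets_mono') auto
  have 2: "sigma_sets (space M) {(\<lambda>\<omega>. g (W t \<omega> - W s \<omega>)) -` A \<inter> space M |A. A \<in> sets borel}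
      \<subseteq> sigma_sets (space M) ?G"
  proof (intro sigma_sets_mono', safe)
    fix A :: "real set" assume "A \<in> sets borel"
    then have "g -` A \<in> sets borel" using measurable_sets[OF g] by simp
    then show "\<exists>B. (\<lambda>\<omega>. g (W t \<omega> - W s \<omega>)) -` A \<inter> space M = ?I -` B \<inter> space M \<and> B \<in> sets borel"
      by (intro exI[of _ "g -` A"]) auto
  qed
  show "indep_set (sigma_sets (space M) {Y -` A \<inter> space M |A. A \<in> sets borel})
     (sigma_sets (space M) {(\<lambda>\<omega>. g (W t \<omega> - W s \<omega>)) -` A \<inter> space M |A. A \<in> sets borel})"
    using ind unfolding indep_set_def
    by (rule indep_sets_mono_sets) (use 1 2 in \<open>auto split: bool.split\<close>)
qed

lemma expectation_mult_increment:
  assumes s: "0 \<le> s" "s < t" and Y: "Y \<in> borel_measurable (F s)" 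
    and B: "\<And>\<omega>. \<omega> \<in> space M \<Longrightarrow> \<bar>Y \<omega>\<bar> \<le> B"
  shows "integrable M Y"
    and "integrable M (\<lambda>\<omega>. Y \<omega> * (W t \<omega> - W s \<omega>) ^ k)"
    and "(\<integral>\<omega>. Y \<omega> * (W t \<omega> - W s \<omega>) ^ k \<partial>M) = (\<integral>\<omega>. Y \<omega> \<partial>M) * (\<integral>\<omega>. (W t \<omega> - W s \<omega>) ^ k \<partial>M)"
proof -
  show Yi: "integrable M Y"
    using measurable_M[OF s(1) Y] B by (intro integrable_const_bound[of _ B] AE_I2) auto
  have "indep_var borel Y borel (\<lambda>\<omega>. (W t \<omega> - W s \<omega>) ^ k)"
    by (rule increment_indep_var[OF s Y]) measurable
  from indep_var_integrable[OF this Yi increment_moments(1)[OF s]] 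
    indep_var_lebesgue_integral[OF this Yi increment_moments(1)[OF s]]
  show "integrable M (\<lambda>\<omega>. Y \<omega> * (W t \<omega> - W s \<omega>) ^ k)"
    "(\<integral>\<omega>. Y \<omega> * (W t \<omega> - W s \<omega>) ^ k \<partial>M) = (\<integral>\<omega>. Y \<omega> \<partial>M) * (\<integral>\<omega>. (W t \<omega> - W s \<omega>) ^ k \<partial>M)" .
qed

text \<open>The first and second moments of the increment turn the Taylor polynomial into \<open>\<delta>\<close> times the
  generator, because \<open>Y\<close> and the weight \<open>G\<close> belong to the past. What is left is the square of the
  drift, of order \<open>\<delta>\<^sup>2\<close>, and the Taylor remainder. The fourth moment is of order \<open>\<delta>\<^sup>2\<close>, so the
  remainder contributes \<open>\<epsilon> \<sigma>\<^sup>2 \<delta>\<close> up to terms of order \<open>\<delta>\<^sup>2\<close>. Summed over the \<open>t / \<delta>\<close>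
  steps up to time \<open>t\<close>, the error tends to a multiple of \<open>\<epsilon>\<close>, and \<open>\<epsilon>\<close> is arbitrary. The weight
  will be the indicator that fewer than \<open>m\<close> adjustments have happened.\<close>

lemma one_step_generator:
  fixes f f' f'' :: "real \<Rightarrow> real" and \<mu> \<sigma> B C \<epsilon> \<delta> s :: real
  assumes s: "0 \<le> s" and \<delta>: "0 < \<delta>"
    and Y: "Y \<in> borel_measurable (F s)" "\<And>\<omega>. \<omega> \<in> space M \<Longrightarrow> Y \<omega> \<in> A"
    and G: "G \<in> borel_measurable (F s)" "\<And>\<omega>. \<omega> \<in> space M \<Longrightarrow> \<bar>G \<omega>\<bar> \<le> 1"
    and meas: "f \<in> borel_measurable borel" "f' \<in> borel_measurable borel" "f'' \<in> borel_measurable borel"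
    and bd: "\<And>z. \<bar>f z\<bar> \<le> B" "\<And>z. z \<in> A \<Longrightarrow> \<bar>f' z\<bar> \<le> B" "\<And>z. z \<in> A \<Longrightarrow> \<bar>f'' z\<bar> \<le> B"
    and rem: "\<And>z y. z \<in> A \<Longrightarrow> \<bar>f (z + y) - f z - f' z * y - f'' z / 2 * y\<^sup>2\<bar> \<le> \<epsilon> * y\<^sup>2 + C * y ^ 4"
    and C: "0 \<le> C"
  shows "\<bar>(\<integral>\<omega>. G \<omega> * (f (Y \<omega> + (\<mu> * \<delta> + \<sigma> * (W (s + \<delta>) \<omega> - W s \<omega>))) - f (Y \<omega>)) \<partial>M)
      - (\<integral>\<omega>. \<delta> * (G \<omega> * (\<sigma>\<^sup>2 / 2 * f'' (Y \<omega>) + \<mu> * f' (Y \<omega>))) \<partial>M)\<bar>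
    \<le> B * \<mu>\<^sup>2 * \<delta>\<^sup>2 / 2 + \<epsilon> * (\<mu>\<^sup>2 * \<delta>\<^sup>2 + \<sigma>\<^sup>2 * \<delta>) + C * (8 * \<mu> ^ 4 * \<delta> ^ 4 + 24 * \<sigma> ^ 4 * \<delta>\<^sup>2)"
proof -
  define I where "I \<omega> = W (s + \<delta>) \<omega> - W s \<omega>" for \<omega>
  define \<xi> where "\<xi> \<omega> = \<mu> * \<delta> + \<sigma> * I \<omega>" for \<omega>
  define a where "a \<omega> = G \<omega> * f' (Y \<omega>)" for \<omega>
  define b where "b \<omega> = G \<omega> * f'' (Y \<omega>)" for \<omega>
  define H where "H \<omega> = G \<omega> * (f (Y \<omega> + \<xi> \<omega>) - f (Y \<omega>))" for \<omega>
  have st: "s < s + \<delta>" using \<delta> by simp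
  note mom = increment_moments[OF s st, folded I_def, simplified]
  have B0: "0 \<le> B" using bd(1)[of 0] by linarith
  have [measurable]: "I \<in> borel_measurable M" unfolding I_def using s \<delta> by (intro borel_measurable_diff W_measurable) auto
  then have [measurable]: "\<xi> \<in> borel_measurable M" unfolding \<xi>_def by measurable
  have [measurable]: "Y \<in> borel_measurable M" "G \<in> borel_measurable M"
    using measurable_M[OF s] Y G by auto
  have aF: "a \<in> borel_measurable (F s)" "b \<in> borel_measurable (F s)"
    unfolding a_def b_def using Y G meas by measurable
  have mult_le: "\<bar>G \<omega> * z\<bar> \<le> \<bar>z\<bar>" if "\<omega> \<in> space M" for \<omega> z
    using mult_right_mono[OF G(2)[OF that], of "\<bar>z\<bar>"] by (simp add: abs_mult)
  have aB: "\<bar>a \<omega>\<bar> \<le> B" "\<bar>b \<omega>\<bar> \<le> B" if "\<omega> \<in> space M" for \<omega>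
    using that mult_le[OF that, of "f' (Y \<omega>)"] mult_le[OF that, of "f'' (Y \<omega>)"] bd(2,3)[OF Y(2)[OF that]] 
    unfolding a_def b_def by linarith+
  have aE: "integrable M a" "integrable M (\<lambda>\<omega>. a \<omega> * I \<omega> ^ k)"
    "(\<integral>\<omega>. a \<omega> * I \<omega> ^ k \<partial>M) = (\<integral>\<omega>. a \<omega> \<partial>M) * (\<integral>\<omega>. I \<omega> ^ k \<partial>M)" for k
    unfolding I_def by (rule expectation_mult_increment[OF s st aF(1) aB(1)]; assumption)+
  have bE: "integrable M b" "integrable M (\<lambda>\<omega>. b \<omega> * I \<omega> ^ k)"
    "(\<integral>\<omega>. b \<omega> * I \<omega> ^ k \<partial>M) = (\<integral>\<omega>. b \<omega> \<partial>M) * (\<integral>\<omega>. I \<omega> ^ k \<partial>M)" for k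
    unfolding I_def by (rule expectation_mult_increment[OF s st aF(2) aB(2)]; assumption)+
  have ai: "integrable M (\<lambda>\<omega>. a \<omega> * \<xi> \<omega>)"
    and aint: "(\<integral>\<omega>. a \<omega> * \<xi> \<omega> \<partial>M) = \<mu> * \<delta> * (\<integral>\<omega>. a \<omega> \<partial>M)"
  proof -
    have e: "a \<omega> * \<xi> \<omega> = \<mu> * \<delta> * a \<omega> + \<sigma> * (a \<omega> * I \<omega> ^ 1)" for \<omega>
      by (simp add: \<xi>_def algebra_simps)
    have i1: "integrable M (\<lambda>\<omega>. \<mu> * \<delta> * a \<omega>)" "integrable M (\<lambda>\<omega>. \<sigma> * (a \<omega> * I \<omega> ^ 1))"
      by (intro integrable_mult_right aE)+
    show "integrable M (\<lambda>\<omega>. a \<omega> * \<xi> \<omega>)" unfolding e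
      by (intro Bochner_Integration.integrable_add i1)
    have "(\<integral>\<omega>. a \<omega> * \<xi> \<omega> \<partial>M) = \<mu> * \<delta> * (\<integral>\<omega>. a \<omega> \<partial>M) + \<sigma> * (\<integral>\<omega>. a \<omega> * I \<omega> ^ 1 \<partial>M)"
      unfolding e using i1
      by (simp only: Bochner_Integration.integral_add integral_mult_right_zero)
    then show "(\<integral>\<omega>. a \<omega> * \<xi> \<omega> \<partial>M) = \<mu> * \<delta> * (\<integral>\<omega>. a \<omega> \<partial>M)"
      unfolding aE(3) using mom by simp
  qed
  have bi: "integrable M (\<lambda>\<omega>. b \<omega> * \<xi> \<omega> ^ 2)"
    and bint: "(\<integral>\<omega>. b \<omega> * \<xi> \<omega> ^ 2 \<partial>M) = (\<mu>\<^sup>2 * \<delta>\<^sup>2 + \<sigma>\<^sup>2 * \<delta>) * (\<integral>\<omega>. b \<omega> \<partial>M)"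
  proof -
    have e: "b \<omega> * \<xi> \<omega> ^ 2 = (\<mu>\<^sup>2 * \<delta>\<^sup>2) * b \<omega> + ((2 * \<mu> * \<delta> * \<sigma>) * (b \<omega> * I \<omega> ^ 1) + \<sigma>\<^sup>2 * (b \<omega> * I \<omega> ^ 2))" for \<omega>
      by (simp add: \<xi>_def power2_eq_square algebra_simps)
    have i1: "integrable M (\<lambda>\<omega>. (\<mu>\<^sup>2 * \<delta>\<^sup>2) * b \<omega>)" "integrable M (\<lambda>\<omega>. (2 * \<mu> * \<delta> * \<sigma>) * (b \<omega> * I \<omega> ^ 1))" 
      "integrable M (\<lambda>\<omega>. \<sigma>\<^sup>2 * (b \<omega> * I \<omega> ^ 2))"
      by (intro integrable_mult_right bE)+
    show "integrable M (\<lambda>\<omega>. b \<omega> * \<xi> \<omega> ^ 2)" unfolding e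
      by (intro Bochner_Integration.integrable_add i1)
    have "(\<integral>\<omega>. b \<omega> * \<xi> \<omega> ^ 2 \<partial>M) = (\<mu>\<^sup>2 * \<delta>\<^sup>2) * (\<integral>\<omega>. b \<omega> \<partial>M) 
      + ((2 * \<mu> * \<delta> * \<sigma>) * (\<integral>\<omega>. b \<omega> * I \<omega> ^ 1 \<partial>M) + \<sigma>\<^sup>2 * (\<integral>\<omega>. b \<omega> * I \<omega> ^ 2 \<partial>M))"
      unfolding e using i1
      by (simp only: Bochner_Integration.integral_add Bochner_Integration.integrable_add integral_mult_right_zero)
    then show "(\<integral>\<omega>. b \<omega> * \<xi> \<omega> ^ 2 \<partial>M) = (\<mu>\<^sup>2 * \<delta>\<^sup>2 + \<sigma>\<^sup>2 * \<delta>) * (\<integral>\<omega>. b \<omega> \<partial>M)"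
      unfolding bE(3) using mom by (simp add: algebra_simps)
  qed
  have Hi: "integrable M H"
  proof (rule integrable_const_bound[of _ "2 * B"])
    show "H \<in> borel_measurable M" unfolding H_def using meas by measurable
    have "\<bar>H \<omega>\<bar> \<le> 2 * B" if "\<omega> \<in> space M" for \<omega>
      using mult_le[OF that, of "f (Y \<omega> + \<xi> \<omega>) - f (Y \<omega>)"] bd(1)[of "Y \<omega> + \<xi> \<omega>"] bd(1)[of "Y \<omega>"]
      unfolding H_def by linarith
    then show "AE \<omega> in M. norm (H \<omega>) \<le> 2 * B" by auto
  qed
  define R where "R \<omega> = H \<omega> - a \<omega> * \<xi> \<omega> - 1 / 2 * (b \<omega> * \<xi> \<omega> ^ 2)" for \<omega>
  have Ri: "integrable M R"
    unfolding R_def by (intro Bochner_Integration.integrable_diff integrable_mult_right Hi ai bi)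
  have Rint: "(\<integral>\<omega>. R \<omega> \<partial>M) = (\<integral>\<omega>. H \<omega> \<partial>M) - \<mu> * \<delta> * (\<integral>\<omega>. a \<omega> \<partial>M) 
      - 1 / 2 * ((\<mu>\<^sup>2 * \<delta>\<^sup>2 + \<sigma>\<^sup>2 * \<delta>) * (\<integral>\<omega>. b \<omega> \<partial>M))"
    unfolding R_def using ai bi Hi 
    by (simp only: Bochner_Integration.integral_diff Bochner_Integration.integrable_diff
        integrable_mult_right integral_mult_right_zero aint bint)
  \<comment> \<open>The remainder is dominated by \<open>\<epsilon> \<xi>\<^sup>2 + C \<xi>\<^sup>4\<close>. The elementary bound
    \<open>(p + q)\<^sup>4 \<le> 8 p\<^sup>4 + 8 q\<^sup>4\<close> separates drift and noise, so that only the fourth moment of the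
    noise is needed.\<close>
  define w where "w \<omega> = \<epsilon> * \<xi> \<omega> ^ 2 + C * (8 * (\<mu> ^ 4 * \<delta> ^ 4) + 8 * \<sigma> ^ 4 * I \<omega> ^ 4)" for \<omega>
  have Rw: "\<bar>R \<omega>\<bar> \<le> w \<omega>" if \<omega>: "\<omega> \<in> space M" for \<omega>
  proof -
    have "R \<omega> = G \<omega> * (f (Y \<omega> + \<xi> \<omega>) - f (Y \<omega>) - f' (Y \<omega>) * \<xi> \<omega> - f'' (Y \<omega>) / 2 * (\<xi> \<omega>)\<^sup>2)"
      by (simp add: R_def H_def a_def b_def algebra_simps)
    then have "\<bar>R \<omega>\<bar> \<le> \<epsilon> * \<xi> \<omega> ^ 2 + C * \<xi> \<omega> ^ 4"
      using mult_le[OF \<omega>] rem[OF Y(2)[OF \<omega>], of "\<xi> \<omega>"] by (metis order_trans)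
    moreover have "\<xi> \<omega> ^ 4 \<le> 8 * (\<mu> ^ 4 * \<delta> ^ 4) + 8 * \<sigma> ^ 4 * I \<omega> ^ 4"
    proof -
      have sq: "(p + q)\<^sup>2 \<le> 2 * p\<^sup>2 + 2 * q\<^sup>2" for p q :: real
        using zero_le_power2[of "p - q"] by (simp add: power2_eq_square algebra_simps)
      have "((p + q)\<^sup>2)\<^sup>2 \<le> (2 * p\<^sup>2 + 2 * q\<^sup>2)\<^sup>2" for p q :: real
        by (intro power_mono sq) simp
      also have "(2 * p\<^sup>2 + 2 * q\<^sup>2)\<^sup>2 \<le> 2 * (2 * p\<^sup>2)\<^sup>2 + 2 * (2 * q\<^sup>2)\<^sup>2" for p q :: real
        by (rule sq)
      finally have "(p + q) ^ 4 \<le> 8 * p ^ 4 + 8 * q ^ 4" for p q :: real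
        by (simp add: power_mult_distrib flip: power_mult)
      from this[of "\<mu> * \<delta>" "\<sigma> * I \<omega>"] show ?thesis
        by (simp add: \<xi>_def power_mult_distrib)
    qed
    ultimately show ?thesis
      unfolding w_def using mult_left_mono[OF _ C] by (smt (verit))
  qed
  have \<xi>2: "integrable M (\<lambda>\<omega>. \<xi> \<omega> ^ 2)" "(\<integral>\<omega>. \<xi> \<omega> ^ 2 \<partial>M) = \<mu>\<^sup>2 * \<delta>\<^sup>2 + \<sigma>\<^sup>2 * \<delta>"
  proof -
    have e: "\<xi> \<omega> ^ 2 = \<mu>\<^sup>2 * \<delta>\<^sup>2 + ((2 * \<mu> * \<delta> * \<sigma>) * I \<omega> ^ 1 + \<sigma>\<^sup>2 * I \<omega> ^ 2)" for \<omega>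
      by (simp add: \<xi>_def power2_eq_square algebra_simps)
    have i: "integrable M (\<lambda>\<omega>. (2 * \<mu> * \<delta> * \<sigma>) * I \<omega> ^ 1)" "integrable M (\<lambda>\<omega>. \<sigma>\<^sup>2 * I \<omega> ^ 2)"
      "integrable M (\<lambda>\<omega>. \<mu>\<^sup>2 * \<delta>\<^sup>2)"
      by (intro integrable_mult_right mom integrable_const)+
    show "integrable M (\<lambda>\<omega>. \<xi> \<omega> ^ 2)" unfolding e
      by (intro Bochner_Integration.integrable_add i)
    have "(\<integral>\<omega>. \<xi> \<omega> ^ 2 \<partial>M) = (\<integral>\<omega>. \<mu>\<^sup>2 * \<delta>\<^sup>2 \<partial>M) 
      + ((2 * \<mu> * \<delta> * \<sigma>) * (\<integral>\<omega>. I \<omega> ^ 1 \<partial>M) + \<sigma>\<^sup>2 * (\<integral>\<omega>. I \<omega> ^ 2 \<partial>M))"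
      unfolding e using i
      by (simp only: Bochner_Integration.integral_add Bochner_Integration.integrable_add integral_mult_right_zero)
    then show "(\<integral>\<omega>. \<xi> \<omega> ^ 2 \<partial>M) = \<mu>\<^sup>2 * \<delta>\<^sup>2 + \<sigma>\<^sup>2 * \<delta>"
      using mom by (simp add: prob_space)
  qed
  have i4: "integrable M (\<lambda>\<omega>. 8 * \<sigma> ^ 4 * I \<omega> ^ 4)" "integrable M (\<lambda>\<omega>. 8 * (\<mu> ^ 4 * \<delta> ^ 4))"
    by (intro integrable_mult_right mom integrable_const)+
  have wi: "integrable M w" unfolding w_def
    by (intro Bochner_Integration.integrable_add integrable_mult_right \<xi>2 i4)
  have wint: "(\<integral>\<omega>. w \<omega> \<partial>M) = \<epsilon> * (\<mu>\<^sup>2 * \<delta>\<^sup>2 + \<sigma>\<^sup>2 * \<delta>) + C * (8 * \<mu> ^ 4 * \<delta> ^ 4 + 24 * \<sigma> ^ 4 * \<delta>\<^sup>2)"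
  proof -
    have "(\<integral>\<omega>. w \<omega> \<partial>M) = \<epsilon> * (\<integral>\<omega>. \<xi> \<omega> ^ 2 \<partial>M) 
      + C * ((\<integral>\<omega>. 8 * (\<mu> ^ 4 * \<delta> ^ 4) \<partial>M) + 8 * \<sigma> ^ 4 * (\<integral>\<omega>. I \<omega> ^ 4 \<partial>M))"
      unfolding w_def using \<xi>2 i4
      by (simp only: Bochner_Integration.integral_add Bochner_Integration.integrable_add 
          integrable_mult_right integral_mult_right_zero)
    then show ?thesis using \<xi>2 mom by (simp add: prob_space)
  qed
  have "\<bar>\<integral>\<omega>. R \<omega> \<partial>M\<bar> \<le> (\<integral>\<omega>. w \<omega> \<partial>M)"
  proof -
    have "\<bar>\<integral>\<omega>. R \<omega> \<partial>M\<bar> \<le> (\<integral>\<omega>. \<bar>R \<omega>\<bar> \<partial>M)" using integral_abs_bound .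
    also have "\<dots> \<le> (\<integral>\<omega>. w \<omega> \<partial>M)" using Rw Ri wi by (intro integral_mono) auto
    finally show ?thesis .
  qed
  moreover have "\<bar>\<integral>\<omega>. b \<omega> \<partial>M\<bar> \<le> B"
  proof -
    have "\<bar>\<integral>\<omega>. b \<omega> \<partial>M\<bar> \<le> (\<integral>\<omega>. \<bar>b \<omega>\<bar> \<partial>M)" using integral_abs_bound .
    also have "\<dots> \<le> (\<integral>\<omega>. B \<partial>M)" using aB bE(1) by (intro integral_mono) auto
    finally show ?thesis by (simp add: prob_space)
  qed
  then have "\<bar>1 / 2 * (\<mu>\<^sup>2 * \<delta>\<^sup>2 * (\<integral>\<omega>. b \<omega> \<partial>M))\<bar> \<le> B * \<mu>\<^sup>2 * \<delta>\<^sup>2 / 2"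
    using mult_left_mono[of "\<bar>\<integral>\<omega>. b \<omega> \<partial>M\<bar>" B "\<mu>\<^sup>2 * \<delta>\<^sup>2"] by (simp add: abs_mult mult_ac)
  moreover have "(\<integral>\<omega>. \<delta> * (G \<omega> * (\<sigma>\<^sup>2 / 2 * f'' (Y \<omega>) + \<mu> * f' (Y \<omega>))) \<partial>M)
      = \<mu> * \<delta> * (\<integral>\<omega>. a \<omega> \<partial>M) + 1 / 2 * (\<sigma>\<^sup>2 * \<delta> * (\<integral>\<omega>. b \<omega> \<partial>M))"
  proof -
    have e: "\<delta> * (G \<omega> * (\<sigma>\<^sup>2 / 2 * f'' (Y \<omega>) + \<mu> * f' (Y \<omega>))) 
        = (\<mu> * \<delta>) * a \<omega> + (1 / 2 * (\<sigma>\<^sup>2 * \<delta>)) * b \<omega>" for \<omega>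
      by (simp add: a_def b_def algebra_simps)
    show ?thesis unfolding e using aE(1) bE(1)
      by (simp only: Bochner_Integration.integral_add integrable_mult_right integral_mult_right_zero mult.assoc)
  qed
  ultimately show ?thesis
    unfolding Rint wint unfolding H_def \<xi>_def I_def[symmetric] by (simp add: distrib_right distrib_left)
qed

end

section \<open>Adaptedness of the adjustment times and of the state\<close>

text \<open>Whether a boundary point has been hit by time \<open>t\<close> refers to uncountably many times. It is
  expressed through rational times before \<open>t\<close>: a continuous path that hits a value comes close to
  it at rational times, and by compactness a path that avoids a value on \<open>[a,b]\<close> keeps a positive
  distance from it.\<close>

lemma stays_away_from_avoided_value:
  fixes Y :: "real \<Rightarrow> real"
  assumes "continuous_on {a..b} Y" "\<And>r. a \<le> r \<Longrightarrow> r \<le> b \<Longrightarrow> Y r \<noteq> p"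
  obtains k where "\<And>r. a \<le> r \<Longrightarrow> r \<le> b \<Longrightarrow> 1 / real (Suc k) \<le> \<bar>Y r - p\<bar>"
proof (cases "a \<le> b")
  case True
  have "continuous_on {a..b} (\<lambda>r. \<bar>Y r - p\<bar>)" by (intro continuous_intros assms)
  then obtain r where r: "r \<in> {a..b}" "\<And>q. q \<in> {a..b} \<Longrightarrow> \<bar>Y r - p\<bar> \<le> \<bar>Y q - p\<bar>"
    using continuous_attains_inf[of "{a..b}" "\<lambda>r. \<bar>Y r - p\<bar>"] True by auto
  have "0 < \<bar>Y r - p\<bar>" using assms(2) r(1) by simp
  then obtain k where "1 / real (Suc k) < \<bar>Y r - p\<bar>" using nat_approx_posE by blast
  then show ?thesis using r(2) by (intro that[of k]) (auto intro: order_trans[OF less_imp_le])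
qed (use that in auto)

lemma rational_times_approach_value:
  fixes Y :: "real \<Rightarrow> real"
  assumes "continuous_on {a..b} Y" "a < b" "0 < e"
  obtains q :: rat where "a < of_rat q" "of_rat q < b" "\<bar>Y (of_rat q) - Y b\<bar> < e"
proof -
  have "\<exists>\<delta>>0. \<forall>r\<in>{a..b}. dist r b < \<delta> \<longrightarrow> dist (Y r) (Y b) < e"
    using assms unfolding continuous_on_iff by auto
  then obtain \<delta> where \<delta>: "0 < \<delta>" "\<And>r. r \<in> {a..b} \<Longrightarrow> dist r b < \<delta> \<Longrightarrow> dist (Y r) (Y b) < e" by blast
  obtain q :: rat where "max a (b - \<delta>) < of_rat q" "of_rat q < b"
    using of_rat_dense[of "max a (b - \<delta>)" b] assms \<delta>(1) by auto
  then show ?thesis using \<delta>(2)[of "of_rat q"] by (intro that[of q]) (auto simp: dist_real_def)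
qed

context band_path
begin

lemma cont_shifted: "0 \<le> a \<Longrightarrow> continuous_on {a..b} (\<lambda>r. X r + c)"
  by (intro continuous_intros continuous_on_subset[OF cont]) auto

text \<open>After \<open>T\<^sub>n\<^sub>+\<^sub>1\<close> the path \<open>X + S\<^sub>n\<close> is no longer confined to the band and may approach the other
  boundary point as well. Only times before \<open>T\<^sub>n\<^sub>+\<^sub>1\<close> tell which of the two was hit first.\<close>

lemma near_value_iff_hit:
  assumes t: "0 \<le> t" and p: "p = d \<or> p = u"
  shows "T (Suc n) \<le> ereal t \<and> X (real_of_ereal (T (Suc n))) + S n = p \<longleftrightarrow>
    (\<forall>k::nat. \<exists>q::rat. 0 \<le> real_of_rat q \<and> real_of_rat q \<le> t \<and> T n \<le> ereal (of_rat q) \<and> 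
      \<not> T (Suc n) \<le> ereal (of_rat q) \<and> \<bar>X (of_rat q) + S n - p\<bar> < 1 / real (Suc k))"
    (is "?L \<longleftrightarrow> ?R")
proof (cases "T n \<le> ereal t")
  case False
  have "\<not> ?L" 
    using False order_trans[OF T_mono[of n "Suc n"], of "ereal t"] by auto
  moreover have "T n \<le> ereal (of_rat q) \<Longrightarrow> \<not> real_of_rat q \<le> t" for q
    using False order_trans[of "T n" "ereal (of_rat q)" "ereal t"] by auto
  then have "\<not> ?R" by blast
  ultimately show ?thesis by (simp only: simp_thms)
next
  case True
  then obtain a where a: "T n = ereal a" "0 \<le> a" "a \<le> t" 
    using T_nonneg[of n] by (cases "T n") auto
  then have ins: "d < X a + S n" "X a + S n < u" using inside by auto
  show ?thesis
  proof
    assume ?L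
    then obtain b where b: "T (Suc n) = ereal b" "b \<le> t" "X b + S n = p" 
      using T_nonneg[of "Suc n"] by (cases "T (Suc n)") auto
    have "a < b" using T_less_Suc[of n] a b by simp
    show ?R
    proof
      fix k :: nat
      obtain q :: rat where "a < of_rat q" "of_rat q < b" "\<bar>X (of_rat q) + S n - (X b + S n)\<bar> < 1 / real (Suc k)"
        by (rule rational_times_approach_value[OF cont_shifted[OF a(2), of b "S n"] \<open>a < b\<close>, of "1 / real (Suc k)"])
          simp_all
      moreover from this a have "0 \<le> real_of_rat q" by linarith
      ultimately show "\<exists>q::rat. 0 \<le> real_of_rat q \<and> real_of_rat q \<le> t \<and> T n \<le> ereal (of_rat q) \<and> 
          \<not> T (Suc n) \<le> ereal (of_rat q) \<and> \<bar>X (of_rat q) + S n - p\<bar> < 1 / real (Suc k)"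
        using a b by (intro exI[of _ q]) auto
    qed
  next
    assume R: ?R
    show ?L
    proof (rule first_exit[OF a(1) ins])
      assume inf: "T (Suc n) = \<infinity>" and stay: "\<And>r. a \<le> r \<Longrightarrow> d < X r + S n \<and> X r + S n < u"
      have "X r + S n \<noteq> p" if "a \<le> r" for r using stay[OF that] p by auto
      then obtain k where k: "\<And>r. a \<le> r \<Longrightarrow> r \<le> t \<Longrightarrow> 1 / real (Suc k) \<le> \<bar>X r + S n - p\<bar>"
        using stays_away_from_avoided_value[OF cont_shifted[OF a(2)], of t "S n" p] by blast
      obtain q :: rat where "real_of_rat q \<le> t" "T n \<le> ereal (of_rat q)" 
        "\<bar>X (of_rat q) + S n - p\<bar> < 1 / real (Suc k)"
        using R[rule_format, of k] by blast
      with k[of "of_rat q"] a show ?L by simp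
    next
      fix b assume b: "T (Suc n) = ereal b" "a < b" "X b + S n \<in> {d, u}"
        and stay: "\<And>r. a \<le> r \<Longrightarrow> r < b \<Longrightarrow> d < X r + S n \<and> X r + S n < u"
      show ?L
      proof (rule ccontr)
        assume nL: "\<not> ?L"
        have "X r + S n \<noteq> p" if "a \<le> r" "r \<le> min t b" for r
        proof (cases "r = b")
          case True
          with nL b that show ?thesis by simp
        next
          case False
          with stay[of r] that p show ?thesis by auto
        qed
        then obtain k where k: "\<And>r. a \<le> r \<Longrightarrow> r \<le> min t b \<Longrightarrow> 1 / real (Suc k) \<le> \<bar>X r + S n - p\<bar>"
          using stays_away_from_avoided_value[OF cont_shifted[OF a(2)], of "min t b" "S n" p] by blast
        obtain q :: rat where "real_of_rat q \<le> t" "T n \<le> ereal (of_rat q)" 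
          "\<not> T (Suc n) \<le> ereal (of_rat q)" "\<bar>X (of_rat q) + S n - p\<bar> < 1 / real (Suc k)"
          using R[rule_format, of k] by blast
        with k[of "of_rat q"] a b show False by simp
      qed
    qed
  qed
qed

lemma near_boundary_iff_jumped:
  assumes t: "0 \<le> t"
  shows "T (Suc n) \<le> ereal t \<longleftrightarrow>
    (\<forall>k::nat. \<exists>q::rat. 0 \<le> real_of_rat q \<and> real_of_rat q \<le> t \<and> T n \<le> ereal (of_rat q) \<and> 
      (\<bar>X (of_rat q) + S n - d\<bar> < 1 / real (Suc k) \<or> \<bar>X (of_rat q) + S n - u\<bar> < 1 / real (Suc k)))"
    (is "?L \<longleftrightarrow> ?R")
proof
  assume L: ?L
  then obtain b where b: "T (Suc n) = ereal b" using T_nonneg[of "Suc n"] by (cases "T (Suc n)") auto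
  have "X b + S n = d \<or> X b + S n = u" by (rule at_jump[OF b]) auto
  then obtain p where p: "p = d \<or> p = u" "X b + S n = p" by auto
  then have "T (Suc n) \<le> ereal t \<and> X (real_of_ereal (T (Suc n))) + S n = p" using L b by simp
  from this[unfolded near_value_iff_hit[OF t p(1)]] p(1) show ?R by blast
next
  assume R: ?R
  show ?L
  proof (rule ccontr)
    assume L: "\<not> ?L"
    obtain q0 :: rat where q0: "real_of_rat q0 \<le> t" "T n \<le> ereal (of_rat q0)" 
      using R[rule_format, of 0] by blast
    then obtain a where a: "T n = ereal a" "0 \<le> a" "a \<le> t"
      using T_nonneg[of n] by (cases "T n") auto
    have stay: "d < X r + S n \<and> X r + S n < u" if "a \<le> r" "r \<le> t" for r
    proof -
      have "ereal r < T (Suc n)" using that(2) L by (intro le_less_trans[of "ereal r" "ereal t"]) auto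
      then show ?thesis using that a by (intro in_band_between) auto
    qed
    obtain k where k: "\<And>r. a \<le> r \<Longrightarrow> r \<le> t \<Longrightarrow> 1 / real (Suc k) \<le> \<bar>X r + S n - d\<bar>"
      using stays_away_from_avoided_value[OF cont_shifted[OF a(2)], of t "S n" d] stay by (metis less_irrefl)
    obtain k' where k': "\<And>r. a \<le> r \<Longrightarrow> r \<le> t \<Longrightarrow> 1 / real (Suc k') \<le> \<bar>X r + S n - u\<bar>"
      using stays_away_from_avoided_value[OF cont_shifted[OF a(2)], of t "S n" u] stay by (metis less_irrefl)
    define m where "m = max k k'"
    have m: "1 / real (Suc m) \<le> 1 / real (Suc k)" "1 / real (Suc m) \<le> 1 / real (Suc k')"
      by (intro divide_left_mono; simp add: m_def)+
    obtain q :: rat where q: "real_of_rat q \<le> t" "T n \<le> ereal (of_rat q)"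
      "\<bar>X (of_rat q) + S n - d\<bar> < 1 / real (Suc m) \<or> \<bar>X (of_rat q) + S n - u\<bar> < 1 / real (Suc m)"
      using R[rule_format, of m] by blast
    then have "a \<le> of_rat q" using a by simp
    with q k[of "of_rat q"] k'[of "of_rat q"] m show False by linarith
  qed
qed

end

text \<open>The path lemmas above hold for each outcome. Inside the following locale \<open>T\<close>, \<open>S\<close>, \<open>N\<close> and
  \<open>Z\<close> are the same quantities as random variables, for the path started in \<open>x\<close>.\<close>

locale band_brownian = brownian_motion M F W for M :: "'a measure" and F W +
  fixes \<mu> \<sigma> x d D U u :: real
  assumes order: "d < D" "D < U" "U < u"
begin

abbreviation "X \<equiv> drifted \<mu> \<sigma> W x"
abbreviation "T n \<omega> \<equiv> band_time d D U u (\<lambda>s. X s \<omega>) n"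
abbreviation "S n \<omega> \<equiv> band_shift d D U u (\<lambda>s. X s \<omega>) n"
abbreviation "xi n \<omega> \<equiv> band_adj d D U u (\<lambda>s. X s \<omega>) n"
abbreviation "N t \<omega> \<equiv> band_count d D U u (\<lambda>s. X s \<omega>) t"
abbreviation "Z t \<omega> \<equiv> band_state d D U u (\<lambda>s. X s \<omega>) t"

lemma band_path: "\<omega> \<in> space M \<Longrightarrow> band_path d D U u (\<lambda>s. X s \<omega>)"
  unfolding drifted_def using order continuous_paths
  by unfold_locales (auto intro!: continuous_intros)

lemma X_adapted: "0 \<le> t \<Longrightarrow> X t \<in> borel_measurable (F t)"
  unfolding drifted_def[abs_def] using adapted[of t] by measurable

lemma X_0: "\<omega> \<in> space M \<Longrightarrow> X 0 \<omega> = x"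
  by (simp add: drifted_def start)

text \<open>Induction over the adjustments. The value \<open>S\<^sub>n\<close> is known at time \<open>t\<close> only if \<open>T\<^sub>n \<le> t\<close>, hence
  the default \<open>0\<close> otherwise. To update \<open>S\<^sub>n\<close> at time \<open>T\<^sub>n\<^sub>+\<^sub>1\<close> one has to know which boundary point
  was hit, and \<open>near_value_iff_hit\<close> describes this in terms of the event \<open>T\<^sub>n\<^sub>+\<^sub>1 \<le> q\<close> for rational
  \<open>q\<close>; this event is therefore treated first.\<close>

lemma jump_time_shift_adapted:
  assumes "0 \<le> t"
  shows "Measurable.pred (F t) (\<lambda>\<omega>. T n \<omega> \<le> ereal t) \<and>
    (\<lambda>\<omega>. if T n \<omega> \<le> ereal t then S n \<omega> else 0) \<in> borel_measurable (F t)"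
  using assms
proof (induction n arbitrary: t)
  case 0
  have T0: "T 0 \<omega> \<le> ereal t" if "\<omega> \<in> space (F t)" for \<omega>
    using band_path.T_0[OF band_path] that 0 space_F[OF 0] by simp
  have S0: "S 0 \<omega> = (if x \<le> d then D - x else if x < u then 0 else U - x)" if "\<omega> \<in> space (F t)" for \<omega>
    using X_0 that space_F[OF 0] by (simp add: band_shift_def Let_def)
  have "Measurable.pred (F t) (\<lambda>\<omega>. T 0 \<omega> \<le> ereal t) \<longleftrightarrow> Measurable.pred (F t) (\<lambda>_. True)"
    by (rule measurable_cong) (simp add: T0)
  moreover have "(\<lambda>\<omega>. if T 0 \<omega> \<le> ereal t then S 0 \<omega> else 0) \<in> borel_measurable (F t) \<longleftrightarrow>
      (\<lambda>_. if x \<le> d then D - x else if x < u then 0 else U - x) \<in> borel_measurable (F t)"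
    by (rule measurable_cong) (simp only: T0 S0 if_True)
  ultimately show ?case by simp
next
  case (Suc n)
  note t = Suc.prems
  define S' where "S' q \<omega> = (if T n \<omega> \<le> ereal q then S n \<omega> else 0)" for q \<omega>
  have ad: "Measurable.pred (F t) (\<lambda>\<omega>. T n \<omega> \<le> ereal q)" "S' q \<in> borel_measurable (F t)"
    "X q \<in> borel_measurable (F t)"
    if "0 \<le> q" "q \<le> t" for q
    using Suc.IH[OF that(1)] X_adapted[OF that(1)] unfolding S'_def by (auto intro: measurable_F[OF that])
  have jumped: "Measurable.pred (F t) (\<lambda>\<omega>. T (Suc n) \<omega> \<le> ereal t)" if t: "0 \<le> t"
    and ad: "\<And>q. 0 \<le> q \<Longrightarrow> q \<le> t \<Longrightarrow> Measurable.pred (F t) (\<lambda>\<omega>. T n \<omega> \<le> ereal q)" 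
      "\<And>q. 0 \<le> q \<Longrightarrow> q \<le> t \<Longrightarrow> S' q \<in> borel_measurable (F t)"
      "\<And>q. 0 \<le> q \<Longrightarrow> q \<le> t \<Longrightarrow> X q \<in> borel_measurable (F t)" for t
  proof -
    have meas: "Measurable.pred (F t) (\<lambda>\<omega>. \<forall>k::nat. \<exists>q\<in>{q::rat. 0 \<le> real_of_rat q \<and> real_of_rat q \<le> t}. T n \<omega> \<le> ereal (of_rat q) \<and> 
      (\<bar>X (of_rat q) \<omega> + S' (of_rat q) \<omega> - d\<bar> < 1 / real (Suc k) \<or> \<bar>X (of_rat q) \<omega> + S' (of_rat q) \<omega> - u\<bar> < 1 / real (Suc k)))"
    proof (rule pred_intros_countable(1)[OF pred_intros_countable_bounded(4)])
      fix k :: nat and q :: rat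
      assume "q \<in> {q. 0 \<le> real_of_rat q \<and> real_of_rat q \<le> t}"
      then have q: "0 \<le> real_of_rat q \<and> real_of_rat q \<le> t" by simp
      note [measurable] = ad[OF conjunct1[OF q] conjunct2[OF q]]
      show "Measurable.pred (F t) (\<lambda>\<omega>. T n \<omega> \<le> ereal (of_rat q) \<and> 
        (\<bar>X (of_rat q) \<omega> + S' (of_rat q) \<omega> - d\<bar> < 1 / real (Suc k) \<or> \<bar>X (of_rat q) \<omega> + S' (of_rat q) \<omega> - u\<bar> < 1 / real (Suc k)))"
        by measurable
    qed
    show ?thesis
    proof (rule measurable_cong[THEN iffD1, OF _ meas])
      fix \<omega> assume "\<omega> \<in> space (F t)"
      then have "\<omega> \<in> space M" using space_F[OF t] by simp
      from band_path.near_boundary_iff_jumped[OF band_path[OF this] t, of n]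
      show "(\<forall>k::nat. \<exists>q\<in>{q::rat. 0 \<le> real_of_rat q \<and> real_of_rat q \<le> t}. T n \<omega> \<le> ereal (of_rat q) \<and> 
        (\<bar>X (of_rat q) \<omega> + S' (of_rat q) \<omega> - d\<bar> < 1 / real (Suc k) \<or> \<bar>X (of_rat q) \<omega> + S' (of_rat q) \<omega> - u\<bar> < 1 / real (Suc k)))
        = (T (Suc n) \<omega> \<le> ereal t)"
        by (simp add: S'_def Bex_def conj_assoc cong: conj_cong)
    qed
  qed
  have jumped_t: "Measurable.pred (F t) (\<lambda>\<omega>. T (Suc n) \<omega> \<le> ereal q)" if q: "0 \<le> q" "q \<le> t" for q
  proof (rule measurable_F[OF q], rule jumped[OF q(1)])
    fix r assume "0 \<le> r" "r \<le> q"
    then show "Measurable.pred (F q) (\<lambda>\<omega>. T n \<omega> \<le> ereal r)" "S' r \<in> borel_measurable (F q)"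
      "X r \<in> borel_measurable (F q)"
      using Suc.IH[of r] X_adapted[of r] unfolding S'_def by (auto intro: measurable_F[of r q])
  qed
  have hit: "Measurable.pred (F t) (\<lambda>\<omega>. T (Suc n) \<omega> \<le> ereal t \<and> X (real_of_ereal (T (Suc n) \<omega>)) \<omega> + S n \<omega> = d)"
    (is ?H)
  proof -
    have meas: "Measurable.pred (F t) (\<lambda>\<omega>. \<forall>k::nat. \<exists>q\<in>{q::rat. 0 \<le> real_of_rat q \<and> real_of_rat q \<le> t}. T n \<omega> \<le> ereal (of_rat q) \<and> 
      \<not> T (Suc n) \<omega> \<le> ereal (of_rat q) \<and> \<bar>X (of_rat q) \<omega> + S' (of_rat q) \<omega> - d\<bar> < 1 / real (Suc k))"
    proof (rule pred_intros_countable(1)[OF pred_intros_countable_bounded(4)])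
      fix k :: nat and q :: rat
      assume "q \<in> {q. 0 \<le> real_of_rat q \<and> real_of_rat q \<le> t}"
      then have q: "0 \<le> real_of_rat q \<and> real_of_rat q \<le> t" by simp
      note [measurable] = ad[OF conjunct1[OF q] conjunct2[OF q]] jumped_t[OF conjunct1[OF q] conjunct2[OF q]]
      show "Measurable.pred (F t) (\<lambda>\<omega>. T n \<omega> \<le> ereal (of_rat q) \<and> 
      \<not> T (Suc n) \<omega> \<le> ereal (of_rat q) \<and> \<bar>X (of_rat q) \<omega> + S' (of_rat q) \<omega> - d\<bar> < 1 / real (Suc k))"
        by measurable
    qed
    show ?thesis
    proof (rule measurable_cong[THEN iffD1, OF _ meas])
      fix \<omega> assume "\<omega> \<in> space (F t)"
      then have "\<omega> \<in> space M" using space_F[OF t] by simp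
      from band_path.near_value_iff_hit[OF band_path[OF this] t, of d n]
      show "(\<forall>k::nat. \<exists>q\<in>{q::rat. 0 \<le> real_of_rat q \<and> real_of_rat q \<le> t}. T n \<omega> \<le> ereal (of_rat q) \<and> 
      \<not> T (Suc n) \<omega> \<le> ereal (of_rat q) \<and> \<bar>X (of_rat q) \<omega> + S' (of_rat q) \<omega> - d\<bar> < 1 / real (Suc k))
        = (T (Suc n) \<omega> \<le> ereal t \<and> X (real_of_ereal (T (Suc n) \<omega>)) \<omega> + S n \<omega> = d)"
        by (simp add: S'_def Bex_def conj_assoc cong: conj_cong)
    qed
  qed
  have pT: "Measurable.pred (F t) (\<lambda>\<omega>. T (Suc n) \<omega> \<le> ereal t)" using jumped_t[of t] t by simp
  have meas: "(\<lambda>\<omega>. if T (Suc n) \<omega> \<le> ereal t \<and> X (real_of_ereal (T (Suc n) \<omega>)) \<omega> + S n \<omega> = d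
      then S' t \<omega> + (D - d) else if T (Suc n) \<omega> \<le> ereal t then S' t \<omega> + (U - u) else 0) \<in> borel_measurable (F t)"
    using hit pT ad(2)[OF t order.refl] by measurable
  have "(\<lambda>\<omega>. if T (Suc n) \<omega> \<le> ereal t then S (Suc n) \<omega> else 0) \<in> borel_measurable (F t)"
  proof (rule measurable_cong[THEN iffD1, OF _ meas])
    fix \<omega> assume "\<omega> \<in> space (F t)"
    then have "\<omega> \<in> space M" using space_F[OF t] by simp
    then interpret p: band_path d D U u "\<lambda>s. X s \<omega>" by (rule band_path)
    show "(if T (Suc n) \<omega> \<le> ereal t \<and> X (real_of_ereal (T (Suc n) \<omega>)) \<omega> + S n \<omega> = d
      then S' t \<omega> + (D - d) else if T (Suc n) \<omega> \<le> ereal t then S' t \<omega> + (U - u) else 0)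
      = (if T (Suc n) \<omega> \<le> ereal t then S (Suc n) \<omega> else 0)"
    proof (cases "T (Suc n) \<omega> \<le> ereal t")
      case True
      then obtain b where b: "T (Suc n) \<omega> = ereal b" 
        using p.T_nonneg[of "Suc n"] by (cases "T (Suc n) \<omega>") auto
      have "T n \<omega> \<le> ereal t" using True p.T_mono[of n "Suc n"] by (auto intro: order_trans)
      with True b show ?thesis by (simp add: S'_def p.S_Suc p.xi_Suc[OF b])
    qed simp
  qed
  then show ?case using pT by simp
qed

lemma count_adapted:
  assumes t: "0 \<le> t"
  shows "N t \<in> measurable (F t) (count_space UNIV)"
proof -
  have "(\<lambda>\<omega>. real (N t \<omega>)) \<in> borel_measurable (F t)"
    unfolding borel_measurable_iff_ge
  proof
    fix a
    have "a \<le> real (N t \<omega>) \<longleftrightarrow> T (nat \<lceil>a\<rceil>) \<omega> \<le> ereal t" if "\<omega> \<in> space (F t)" for \<omega>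
    proof -
      have "a \<le> real (N t \<omega>) \<longleftrightarrow> nat \<lceil>a\<rceil> \<le> N t \<omega>" by linarith
      then show ?thesis using band_path.T_le_iff[OF band_path t] that space_F[OF t] by simp
    qed
    then have "{\<omega> \<in> space (F t). a \<le> real (N t \<omega>)} = {\<omega> \<in> space (F t). T (nat \<lceil>a\<rceil>) \<omega> \<le> ereal t}" by auto
    also have "\<dots> \<in> sets (F t)"
      using jump_time_shift_adapted[OF t] by (simp add: pred_def)
    finally show "{\<omega> \<in> space (F t). a \<le> real (N t \<omega>)} \<in> sets (F t)" .
  qed
  then have "(\<lambda>\<omega>. nat \<lfloor>real (N t \<omega>)\<rfloor>) \<in> measurable (F t) (count_space UNIV)" by measurable
  then show ?thesis by simp
qed

lemma state_adapted:
  assumes t: "0 \<le> t"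
  shows "Z t \<in> borel_measurable (F t)"
proof -
  have meas: "(\<lambda>\<omega>. X t \<omega> + (if T (N t \<omega>) \<omega> \<le> ereal t then S (N t \<omega>) \<omega> else 0)) \<in> borel_measurable (F t)"
    by (rule measurable_compose_countable[OF _ count_adapted[OF t]])
      (use jump_time_shift_adapted[OF t] X_adapted[OF t] in \<open>auto intro!: borel_measurable_add\<close>)
  show ?thesis
  proof (rule measurable_cong[THEN iffD1, OF _ meas])
    fix \<omega> assume "\<omega> \<in> space (F t)"
    then have "\<omega> \<in> space M" using space_F[OF t] by simp
    from band_path.T_le_iff[OF band_path[OF this] t, of "N t \<omega>"]
    show "X t \<omega> + (if T (N t \<omega>) \<omega> \<le> ereal t then S (N t \<omega>) \<omega> else 0) = Z t \<omega>"
      by (simp add: band_state_def)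
  qed
qed

end

section \<open>A bounded extension of the potential\<close>

lemma has_real_derivative_glue:
  fixes a b c a' b' c' :: "real \<Rightarrow> real"
  assumes a: "\<And>x. (a has_real_derivative a' x) (at x)"
    and b: "\<And>x. x \<in> {p..q} \<Longrightarrow> (b has_real_derivative b' x) (at x within {p..q})"
    and c: "\<And>x. (c has_real_derivative c' x) (at x)"
    and eq: "a p = b p" "a' p = b' p" "b q = c q" "b' q = c' q" and pq: "p < q"
  shows "((\<lambda>x. if x < p then a x else if x \<le> q then b x else c x) has_real_derivative
    (if x < p then a' x else if x \<le> q then b' x else c' x)) (at x)"
    (is "(?f has_real_derivative ?D x) (at x)")
proof -
  have outside: "(?f has_real_derivative e) (at x within A)" if "closed A" "x \<notin> A" for A e
  proof -
    have "at x within A = bot" using that by (simp add: at_within_eq_bot_iff closure_closed)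
    then show ?thesis by (simp add: has_field_derivative_iff)
  qed
  have left: "(?f has_real_derivative ?D x) (at x within {..p})"
  proof (cases "x \<in> {..p}")
    case True
    have "(a has_real_derivative ?D x) (at x within {..p})"
      using has_field_derivative_at_within[OF a[of x], of "{..p}"] True eq pq by (cases "x = p") auto
    then show ?thesis unfolding has_field_derivative_def
      by (rule has_derivative_transform[OF True, rotated]) (use eq pq in auto)
  qed (rule outside, auto)
  moreover have mid: "(?f has_real_derivative ?D x) (at x within {p..q})"
  proof (cases "x \<in> {p..q}")
    case True
    have "(b has_real_derivative ?D x) (at x within {p..q})"
      using b[OF True] True by simp
    then show ?thesis unfolding has_field_derivative_def
      by (rule has_derivative_transform[OF True, rotated]) auto
  qed (rule outside, auto)
  moreover have "(?f has_real_derivative ?D x) (at x within {q..})"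
  proof (cases "x \<in> {q..}")
    case True
    have "(c has_real_derivative ?D x) (at x within {q..})"
      using has_field_derivative_at_within[OF c[of x], of "{q..}"] True eq pq by (cases "x = q") auto
    then show ?thesis unfolding has_field_derivative_def
      by (rule has_derivative_transform[OF True, rotated]) (use eq pq in auto)
  qed (rule outside, auto)
  ultimately have "(?f has_real_derivative ?D x) (at x within ({..p} \<union> {p..q} \<union> {q..}))"
    unfolding has_field_derivative_iff
    by (subst at_within_union, subst at_within_union, intro filterlim_sup)
  moreover have "{..p} \<union> {p..q} \<union> {q..} = UNIV" using pq by auto
  ultimately show ?thesis by simp
qed

text \<open>Between grid points the uncontrolled path may leave \<open>[d,u]\<close>, so the potential is needed on the
  whole line, and it must stay bounded there. Beyond an end point \<open>r\<close> it is continued by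
  \<open>V r + V' r sin (x - r) + V'' r (1 - cos (x - r))\<close>, which matches value and first two derivatives
  like a quadratic polynomial would, but is bounded together with all derivatives.\<close>

lemma bounded_C2_extension:
  fixes V V' V'' :: "real \<Rightarrow> real"
  assumes pq: "p < q"
    and V: "\<And>x. x \<in> {p..q} \<Longrightarrow> (V has_real_derivative V' x) (at x within {p..q})"
    and V': "\<And>x. x \<in> {p..q} \<Longrightarrow> (V' has_real_derivative V'' x) (at x within {p..q})"
    and V'': "continuous_on {p..q} V''"
  shows "\<exists>(f :: real \<Rightarrow> real) f' f'' B. (\<forall>x. (f has_real_derivative f' x) (at x)) \<and>
    (\<forall>x. (f' has_real_derivative f'' x) (at x)) \<and> continuous_on UNIV f'' \<and>
    (\<forall>x. \<bar>f x\<bar> \<le> B \<and> \<bar>f' x\<bar> \<le> B \<and> \<bar>f'' x\<bar> \<le> B) \<and>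
    (\<forall>x\<in>{p..q}. f x = V x \<and> f' x = V' x \<and> f'' x = V'' x)"
proof -
  define g where "g r x = V r + V' r * sin (x - r) + V'' r * (1 - cos (x - r))" for r x
  define g' where "g' r x = V' r * cos (x - r) + V'' r * sin (x - r)" for r x
  define g'' where "g'' r x = - V' r * sin (x - r) + V'' r * cos (x - r)" for r x
  have g: "(g r has_real_derivative g' r x) (at x)" "(g' r has_real_derivative g'' r x) (at x)" for r x
    unfolding g_def[abs_def] g'_def[abs_def] g''_def
    by (auto intro!: derivative_eq_intros)
  have g0: "g r r = V r" "g' r r = V' r" "g'' r r = V'' r" for r
    by (simp_all add: g_def g'_def g''_def)
  define glue where "glue F G x = (if x < p then F p x else if x \<le> q then G x else F q x)" 
    for F :: "real \<Rightarrow> real \<Rightarrow> real" and G :: "real \<Rightarrow> real" and x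
  have C: "continuous_on {p..q} V" "continuous_on {p..q} V'"
    unfolding continuous_on_eq_continuous_within
    by (intro ballI, rule DERIV_continuous, erule V) (intro ballI, rule DERIV_continuous, erule V')
  define B where "B = (SUP x\<in>{p..q}. \<bar>V x\<bar>) + (SUP x\<in>{p..q}. \<bar>V' x\<bar>) + 2 * (SUP x\<in>{p..q}. \<bar>V'' x\<bar>)"
  have sup: "\<bar>H x\<bar> \<le> (SUP x\<in>{p..q}. \<bar>H x\<bar>)" if "continuous_on {p..q} H" "x \<in> {p..q}" for H :: "real \<Rightarrow> real" and x
  proof (rule cSUP_upper[OF that(2)])
    have "compact ((\<lambda>x. \<bar>H x\<bar>) ` {p..q})" 
      using that(1) by (intro compact_continuous_image continuous_intros) auto
    then show "bdd_above ((\<lambda>x. \<bar>H x\<bar>) ` {p..q})" by (intro bounded_imp_bdd_above compact_imp_bounded)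
  qed
  have gB: "\<bar>g r x\<bar> \<le> B" "\<bar>g' r x\<bar> \<le> B" "\<bar>g'' r x\<bar> \<le> B" if r: "r \<in> {p..q}" for r x
  proof -
    have s: "\<bar>V r\<bar> \<le> (SUP x\<in>{p..q}. \<bar>V x\<bar>)" "\<bar>V' r\<bar> \<le> (SUP x\<in>{p..q}. \<bar>V' x\<bar>)" "\<bar>V'' r\<bar> \<le> (SUP x\<in>{p..q}. \<bar>V'' x\<bar>)"
      using sup[OF C(1) r] sup[OF C(2) r] sup[OF V'' r] .
    have m: "\<bar>v * y\<bar> \<le> \<bar>v\<bar>" if "\<bar>y\<bar> \<le> 1" for v y :: real
      using mult_left_le[OF that, of "\<bar>v\<bar>"] by (simp add: abs_mult)
    have "\<bar>V' r * sin (x - r)\<bar> \<le> \<bar>V' r\<bar>" "\<bar>V'' r * sin (x - r)\<bar> \<le> \<bar>V'' r\<bar>" 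
      "\<bar>V' r * cos (x - r)\<bar> \<le> \<bar>V' r\<bar>" "\<bar>V'' r * cos (x - r)\<bar> \<le> \<bar>V'' r\<bar>"
      by (auto intro!: m)
    then show "\<bar>g r x\<bar> \<le> B" "\<bar>g' r x\<bar> \<le> B" "\<bar>g'' r x\<bar> \<le> B"
      using s unfolding g_def g'_def g''_def B_def right_diff_distrib by linarith+
  qed
  have B: "\<bar>glue g V x\<bar> \<le> B" "\<bar>glue g' V' x\<bar> \<le> B" "\<bar>glue g'' V'' x\<bar> \<le> B" for x
    using gB[of p x] gB[of q x] gB[of x x] pq unfolding glue_def g0 by auto
  \<comment> \<open>With \<open>r\<close> the projection of \<open>x\<close> to \<open>[p,q]\<close>, one formula covers all three pieces.\<close>
  have "continuous_on UNIV (\<lambda>x. - V' (max p (min q x)) * sin (x - max p (min q x)) 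
      + V'' (max p (min q x)) * cos (x - max p (min q x)))"
    using pq by (intro continuous_intros continuous_on_compose2[OF C(2)] continuous_on_compose2[OF V'']) auto
  also have "(\<lambda>x. - V' (max p (min q x)) * sin (x - max p (min q x)) 
      + V'' (max p (min q x)) * cos (x - max p (min q x))) = glue g'' V''"
    using pq by (auto simp: glue_def g''_def max_def min_def)
  finally have "continuous_on UNIV (glue g'' V'')" .
  moreover have "(glue g V has_real_derivative glue g' V' x) (at x)" 
    "(glue g' V' has_real_derivative glue g'' V'' x) (at x)" for x
    unfolding glue_def[abs_def]
    by (rule has_real_derivative_glue[OF g(1) V g(1) g0(1,2) g0(1,2)[symmetric] pq]; assumption)
       (rule has_real_derivative_glue[OF g(2) V' g(2) g0(2,3) g0(2,3)[symmetric] pq]; assumption)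
  ultimately show ?thesis
    using B by (intro exI[of _ "glue g V"] exI[of _ "glue g' V'"] exI[of _ "glue g'' V''"] exI[of _ B])
      (auto simp: glue_def)
qed

text \<open>The remainder is \<open>y\<^sup>2 / 2\<close> times the oscillation of \<open>f''\<close> between \<open>z\<close> and \<open>z + y\<close>. For small \<open>y\<close>
  it is controlled by uniform continuity of \<open>f''\<close> near \<open>[p,q]\<close>; for the other \<open>y\<close> the bound on
  \<open>f''\<close> is absorbed into the term \<open>C y\<^sup>4\<close>.\<close>

lemma uniform_taylor_remainder:
  fixes f f' f'' :: "real \<Rightarrow> real"
  assumes f: "\<And>x. (f has_real_derivative f' x) (at x)" "\<And>x. (f' has_real_derivative f'' x) (at x)"
    and f'': "continuous_on UNIV f''" "\<And>x. \<bar>f'' x\<bar> \<le> B" and \<epsilon>: "0 < \<epsilon>"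
  obtains C where "0 \<le> C" "\<And>z y. z \<in> {p..q} \<Longrightarrow>
    \<bar>f (z + y) - f z - f' z * y - f'' z / 2 * y\<^sup>2\<bar> \<le> \<epsilon> * y\<^sup>2 + C * y ^ 4"
proof -
  have "uniformly_continuous_on {p - 1..q + 1} f''"
    by (intro compact_uniformly_continuous continuous_on_subset[OF f''(1)]) auto
  then obtain \<eta>0 where \<eta>0: "0 < \<eta>0" "\<And>y z. y \<in> {p - 1..q + 1} \<Longrightarrow> z \<in> {p - 1..q + 1} \<Longrightarrow> 
      dist y z < \<eta>0 \<Longrightarrow> dist (f'' y) (f'' z) < 2 * \<epsilon>"
    using \<epsilon> unfolding uniformly_continuous_on_def by (metis mult_pos_pos zero_less_numeral)
  define \<eta> where "\<eta> = min \<eta>0 1"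
  have \<eta>: "0 < \<eta>" using \<eta>0 by (simp add: \<eta>_def)
  have B: "0 \<le> B" using f''(2)[of 0] by linarith
  define C where "C = B / \<eta>\<^sup>2"
  have osc: "\<bar>f'' b - f'' z\<bar> \<le> 2 * \<epsilon> + 2 * (C * (b - z)\<^sup>2)" if z: "z \<in> {p..q}" for b z
  proof (cases "\<bar>b - z\<bar> < \<eta>")
    case True
    then have bz: "\<bar>b - z\<bar> < 1" "\<bar>b - z\<bar> < \<eta>0" by (auto simp: \<eta>_def)
    then have "b \<in> {p - 1..q + 1}" "z \<in> {p - 1..q + 1}" using z by (auto simp: abs_less_iff)
    then have "\<bar>f'' b - f'' z\<bar> < 2 * \<epsilon>" using \<eta>0(2)[of b z] bz by (simp add: dist_real_def)
    moreover have "0 \<le> 2 * (C * (b - z)\<^sup>2)" using B by (simp add: C_def)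
    ultimately show ?thesis by linarith
  next
    case False
    then have "\<eta>\<^sup>2 \<le> (b - z)\<^sup>2" using \<eta> by (intro abs_le_square_iff[THEN iffD1]) auto
    then have "2 * B \<le> 2 * (C * (b - z)\<^sup>2)"
      using mult_left_mono[of "\<eta>\<^sup>2" "(b - z)\<^sup>2" "2 * B"] B \<eta> by (simp add: C_def field_simps)
    then show ?thesis using f''(2)[of b] f''(2)[of z] \<epsilon> by linarith
  qed
  have rem: "\<bar>f (z + y) - f z - f' z * y - f'' z / 2 * y\<^sup>2\<bar> \<le> \<epsilon> * y\<^sup>2 + C * y ^ 4" if z: "z \<in> {p..q}" for z y
  proof (cases "y = 0")
    case False
    define D where "D m = (if m = 0 then f else if m = 1 then f' else f'')" for m :: nat
    have D0: "D 0 = f" by (simp add: D_def)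
    have DD: "\<forall>m t. m < 2 \<and> z - \<bar>y\<bar> \<le> t \<and> t \<le> z + \<bar>y\<bar> \<longrightarrow> DERIV (D m) t :> D (Suc m) t"
      using f by (auto simp: D_def less_2_cases_iff)
    have "\<exists>b. (if z + y < z then z + y < b \<and> b < z else z < b \<and> b < z + y) \<and>
      f (z + y) = (\<Sum>m<2. D m z / fact m * (z + y - z) ^ m) + D 2 b / fact 2 * (z + y - z) ^ 2"
      by (rule Taylor[OF _ D0 DD]) (use False in auto)
    then obtain b where b: "if z + y < z then z + y < b \<and> b < z else z < b \<and> b < z + y"
      "f (z + y) = (\<Sum>m<2. D m z / fact m * (z + y - z) ^ m) + D 2 b / fact 2 * (z + y - z) ^ 2"
      by blast
    then have "f (z + y) = f z + f' z * y + f'' b / 2 * y\<^sup>2"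
      by (simp add: D_def numeral_2_eq_2)
    then have rem: "\<bar>f (z + y) - f z - f' z * y - f'' z / 2 * y\<^sup>2\<bar> = \<bar>f'' b - f'' z\<bar> / 2 * y\<^sup>2"
      by (simp add: abs_mult flip: left_diff_distrib diff_divide_distrib)
    have "(b - z)\<^sup>2 \<le> y\<^sup>2" using b(1) by (intro abs_le_square_iff[THEN iffD1]) (auto split: if_splits)
    then have "2 * (C * (b - z)\<^sup>2) \<le> 2 * (C * y\<^sup>2)" using B by (intro mult_left_mono) (auto simp: C_def)
    then have "\<bar>f'' b - f'' z\<bar> / 2 \<le> \<epsilon> + C * y\<^sup>2" using osc[OF z, of b] by simp
    then have "\<bar>f'' b - f'' z\<bar> / 2 * y\<^sup>2 \<le> (\<epsilon> + C * y\<^sup>2) * y\<^sup>2" by (intro mult_right_mono) auto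
    also have "\<dots> = \<epsilon> * y\<^sup>2 + C * y ^ 4" by (simp add: algebra_simps flip: power_add)
    finally show ?thesis unfolding rem .
  qed simp
  show ?thesis using that[OF _ rem] B by (simp add: C_def)
qed

section \<open>Expected change of a potential along the controlled process\<close>

context band_brownian
begin

lemma Z_in_band: "\<omega> \<in> space M \<Longrightarrow> 0 \<le> t \<Longrightarrow> d \<le> Z t \<omega> \<and> Z t \<omega> \<le> u"
  using band_path.Z_in_band[OF band_path] by (meson less_imp_le)

lemma weighted_state_adapted:
  assumes t: "0 \<le> t" and G: "\<And>j. continuous_on UNIV (G j)"
  shows "(\<lambda>\<omega>. G (N t \<omega>) (Z t \<omega>) :: real) \<in> borel_measurable (F t)"
proof (rule measurable_compose_countable[OF _ count_adapted[OF t]])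
  fix j
  have "G j \<in> borel_measurable borel" by (rule borel_measurable_continuous_onI[OF G])
  then show "(\<lambda>\<omega>. G j (Z t \<omega>)) \<in> borel_measurable (F t)"
    using state_adapted[OF t] by (rule measurable_compose[rotated])
qed

text \<open>The integral over time is a pathwise limit of Riemann sums. This makes it measurable in the
  outcome, and as the sums are uniformly bounded their expectations converge.\<close>

lemma time_integral:
  fixes G :: "nat \<Rightarrow> real \<Rightarrow> real"
  assumes t: "0 < t" and G: "\<And>j. continuous_on UNIV (G j)"
    and bd: "\<And>j z. d \<le> z \<Longrightarrow> z \<le> u \<Longrightarrow> \<bar>G j z\<bar> \<le> B"
  shows "integrable M (\<lambda>\<omega>. LINT s:{0..t}|lborel. G (N s \<omega>) (Z s \<omega>))" (is ?int)
    and "(\<lambda>n. \<integral>\<omega>. (\<Sum>i<n. t / real n * G (N (t * real i / real n) \<omega>) (Z (t * real i / real n) \<omega>)) \<partial>M)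
      \<longlonglongrightarrow> (\<integral>\<omega>. (LINT s:{0..t}|lborel. G (N s \<omega>) (Z s \<omega>)) \<partial>M)" (is ?lim)
proof -
  let ?A = "\<lambda>\<omega>. LINT s:{0..t}|lborel. G (N s \<omega>) (Z s \<omega>)"
  let ?a = "\<lambda>n \<omega>. \<Sum>i<n. t / real n * G (N (t * real i / real n) \<omega>) (Z (t * real i / real n) \<omega>)"
  have lim: "(\<lambda>n. ?a n \<omega>) \<longlonglongrightarrow> ?A \<omega>" if "\<omega> \<in> space M" for \<omega>
    by (rule band_path.Z_riemann_sum_tendsto[OF band_path[OF that] t G bd])
  have meas: "?a n \<in> borel_measurable M" for n
  proof (intro borel_measurable_sum borel_measurable_times borel_measurable_const)
    fix i
    have s: "0 \<le> t * real i / real n" using t by simp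
    show "(\<lambda>\<omega>. G (N (t * real i / real n) \<omega>) (Z (t * real i / real n) \<omega>)) \<in> borel_measurable M"
      by (rule measurable_M[OF s weighted_state_adapted[OF s G]])
  qed
  have A: "?A \<in> borel_measurable M"
    by (rule borel_measurable_LIMSEQ_real[OF lim meas])
  have B: "0 \<le> B" using bd[of d 0] order by linarith
  have bound: "\<bar>?a n \<omega>\<bar> \<le> t * B" if "\<omega> \<in> space M" for n \<omega>
  proof -
    have "\<bar>?a n \<omega>\<bar> \<le> (\<Sum>i<n. \<bar>t / real n * G (N (t * real i / real n) \<omega>) (Z (t * real i / real n) \<omega>)\<bar>)"
      by (rule sum_abs)
    also have "\<dots> \<le> (\<Sum>i<n. t / real n * B)"
    proof (intro sum_mono)
      fix i
      have "\<bar>G (N (t * real i / real n) \<omega>) (Z (t * real i / real n) \<omega>)\<bar> \<le> B"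
        using Z_in_band[OF that, of "t * real i / real n"] t by (intro bd) auto
      then show "\<bar>t / real n * G (N (t * real i / real n) \<omega>) (Z (t * real i / real n) \<omega>)\<bar> \<le> t / real n * B"
        using t by (simp add: abs_mult mult_left_mono divide_right_mono)
    qed
    also have "\<dots> \<le> t * B" using t B by simp
    finally show ?thesis .
  qed
  have DCT: "integrable M ?A" "(\<lambda>n. \<integral>\<omega>. ?a n \<omega> \<partial>M) \<longlonglongrightarrow> (\<integral>\<omega>. ?A \<omega> \<partial>M)"
    by (rule integrable_dominated_convergence integral_dominated_convergence, rule A, rule meas, 
        rule integrable_const[of "t * B"], rule AE_I2, erule lim, rule AE_I2, simp only: real_norm_def, erule bound)+
  show ?int ?lim using DCT .
qed

text \<open>The process \<open>w(N) f(Z)\<close> equals \<open>f(Z)\<close> until the \<open>m\<close>-th adjustment and vanishes afterwards, so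
  its jumps add up to \<open>J\<close>, to which only the first \<open>m\<close> adjustments contribute; this gives the
  integrable bound needed to pass to the limit in the jump part. The summand of index \<open>m - 1\<close> also
  contains the switching off.\<close>

lemma truncated_dynkin:
  fixes f f' f'' :: "real \<Rightarrow> real" and m :: nat
  assumes t: "0 < t"
    and f: "\<And>x. (f has_real_derivative f' x) (at x)" "\<And>x. (f' has_real_derivative f'' x) (at x)"
    and f'': "continuous_on UNIV f''"
    and bd: "\<And>x. \<bar>f x\<bar> \<le> B" "\<And>x. \<bar>f' x\<bar> \<le> B" "\<And>x. \<bar>f'' x\<bar> \<le> B"
  defines "w \<equiv> \<lambda>j. of_bool (j < m) :: real"
  defines "J \<equiv> \<lambda>\<omega>. \<Sum>j<N t \<omega>. w (Suc j) * f (X (real_of_ereal (T (Suc j) \<omega>)) \<omega> + S (Suc j) \<omega>)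
      - w j * f (X (real_of_ereal (T (Suc j) \<omega>)) \<omega> + S j \<omega>)"
  shows "integrable M J"
    and "(\<integral>\<omega>. w (N t \<omega>) * f (Z t \<omega>) \<partial>M) - (\<integral>\<omega>. w (N 0 \<omega>) * f (Z 0 \<omega>) \<partial>M) =
      (\<integral>\<omega>. (LINT s:{0..t}|lborel. w (N s \<omega>) * (\<sigma>\<^sup>2 / 2 * f'' (Z s \<omega>) + \<mu> * f' (Z s \<omega>))) \<partial>M) + (\<integral>\<omega>. J \<omega> \<partial>M)"
proof -
  define g where "g n i = t * real i / real n" for n i :: nat
  have g0: "0 \<le> g n i" for n i using t by (simp add: g_def)
  have gS: "g n (Suc i) = g n i + t / real n" for n i by (simp add: g_def field_simps add_divide_distrib)
  have gn: "g n n = t" if "0 < n" for n using that by (simp add: g_def)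
  have g_0: "g n 0 = 0" for n by (simp add: g_def)
  define \<xi> where "\<xi> n i \<omega> = \<mu> * (t / real n) + \<sigma> * (W (g n i + t / real n) \<omega> - W (g n i) \<omega>)" for n i \<omega>
  have X\<xi>: "X (g n (Suc i)) \<omega> = X (g n i) \<omega> + \<xi> n i \<omega>" for n i \<omega>
    unfolding gS by (simp add: drifted_def \<xi>_def algebra_simps)
  have w1: "\<bar>w j\<bar> \<le> 1" "0 \<le> w j" for j by (simp_all add: w_def)
  have cf: "continuous_on UNIV f" "continuous_on UNIV f'"
    using f by (auto intro!: DERIV_continuous_on)
  have B: "0 \<le> B" using bd(1)[of 0] by linarith
  define L where "L z = \<sigma>\<^sup>2 / 2 * f'' z + \<mu> * f' z" for z
  have cL: "continuous_on UNIV L" unfolding L_def[abs_def] by (intro continuous_intros cf f'')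
  define P where "P s \<omega> = w (N s \<omega>) * f (Z s \<omega>)" for s \<omega>
  define \<psi> where "\<psi> \<omega> j y = w j * f (y + S j \<omega>)" for \<omega> j y
  have P\<psi>: "P s \<omega> = \<psi> \<omega> (N s \<omega>) (X s \<omega>)" for s \<omega> by (simp add: P_def \<psi>_def band_state_def)
  define I where "I n \<omega> = (\<Sum>i<n. w (N (g n i) \<omega>) * (f (Z (g n i) \<omega> + \<xi> n i \<omega>) - f (Z (g n i) \<omega>)))" for n \<omega>
  define R where "R n \<omega> = (\<Sum>i<n. \<psi> \<omega> (N (g n (Suc i)) \<omega>) (X (g n (Suc i)) \<omega>)
     - \<psi> \<omega> (N (g n i) \<omega>) (X (g n (Suc i)) \<omega>))" for n \<omega>
  define A where "A n \<omega> = (\<Sum>i<n. t / real n * (w (N (g n i) \<omega>) * L (Z (g n i) \<omega>)))" for n \<omega>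
  \<comment> \<open>\<open>I\<close> collects the moves of \<open>X\<close> with \<open>N\<close> frozen at the left end of the cell, \<open>R\<close> the moves of
    \<open>N\<close> with \<open>X\<close> frozen at the right end.\<close>
  have tele: "P t \<omega> - P 0 \<omega> = I n \<omega> + R n \<omega>" if "0 < n" for n \<omega>
  proof -
    have "P t \<omega> - P 0 \<omega> = (\<Sum>i<n. P (g n (Suc i)) \<omega> - P (g n i) \<omega>)"
      using sum_lessThan_telescope[of "\<lambda>i. P (g n i) \<omega>" n] gn[OF that] g_0 by simp
    also have "\<dots> = I n \<omega> + R n \<omega>"
      unfolding I_def R_def sum.distrib[symmetric]
      by (intro sum.cong refl) (simp add: P_def \<psi>_def band_state_def X\<xi> algebra_simps)
    finally show ?thesis .
  qed
  have wm: "(\<lambda>\<omega>. w (N s \<omega>)) \<in> borel_measurable (F s)" if "0 \<le> s" for s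
    using weighted_state_adapted[OF that, of "\<lambda>j z. w j"] by simp
  have Pi: "integrable M (P s)" if s: "0 \<le> s" for s
  proof (rule integrable_const_bound[of _ B])
    show "P s \<in> borel_measurable M" unfolding P_def[abs_def]
      by (rule measurable_M[OF s weighted_state_adapted[OF s, of "\<lambda>j z. w j * f z"]])
         (intro continuous_intros cf)
    have "\<bar>P s \<omega>\<bar> \<le> 1 * B" for \<omega> unfolding P_def abs_mult by (intro mult_mono w1 bd) auto
    then show "AE \<omega> in M. norm (P s \<omega>) \<le> B" by simp
  qed
  have Im: "integrable M (\<lambda>\<omega>. w (N (g n i) \<omega>) * (f (Z (g n i) \<omega> + \<xi> n i \<omega>) - f (Z (g n i) \<omega>)))" for n i
  proof (rule integrable_const_bound[of _ "1 * (2 * B)"])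
    have "W (g n i + t / real n) \<in> borel_measurable M" "W (g n i) \<in> borel_measurable M"
      using g0[of n i] t by (auto intro!: W_measurable)
    then have "\<xi> n i \<in> borel_measurable M" unfolding \<xi>_def[abs_def] by measurable
    moreover have "Z (g n i) \<in> borel_measurable M" 
      by (rule measurable_M[OF g0 state_adapted[OF g0]])
    moreover have "(\<lambda>\<omega>. w (N (g n i) \<omega>)) \<in> borel_measurable M" by (rule measurable_M[OF g0 wm[OF g0]])
    moreover have "f \<in> borel_measurable borel" by (rule borel_measurable_continuous_onI[OF cf(1)])
    ultimately show "(\<lambda>\<omega>. w (N (g n i) \<omega>) * (f (Z (g n i) \<omega> + \<xi> n i \<omega>) - f (Z (g n i) \<omega>))) \<in> borel_measurable M"
      by measurable
    have "\<bar>f y - f z\<bar> \<le> 2 * B" for y z using bd(1)[of y] bd(1)[of z] by linarith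
    then have "\<bar>w (N (g n i) \<omega>) * (f (Z (g n i) \<omega> + \<xi> n i \<omega>) - f (Z (g n i) \<omega>))\<bar> \<le> 1 * (2 * B)" for \<omega>
      unfolding abs_mult by (intro mult_mono w1) auto
    then show "AE \<omega> in M. norm (w (N (g n i) \<omega>) * (f (Z (g n i) \<omega> + \<xi> n i \<omega>) - f (Z (g n i) \<omega>))) \<le> 1 * (2 * B)"
      by simp
  qed
  have Ii: "integrable M (I n)" for n
    unfolding I_def[abs_def] by (intro Bochner_Integration.integrable_sum Im)
  define BL where "BL = \<sigma>\<^sup>2 / 2 * B + \<bar>\<mu>\<bar> * B"
  have L_bd: "\<bar>w j * L z\<bar> \<le> 1 * BL" for j z
  proof -
    have "\<bar>L z\<bar> \<le> \<bar>\<sigma>\<^sup>2 / 2 * f'' z\<bar> + \<bar>\<mu> * f' z\<bar>" unfolding L_def by (rule abs_triangle_ineq)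
    also have "\<dots> \<le> BL" unfolding BL_def abs_mult by (intro add_mono mult_mono bd) auto
    finally show ?thesis unfolding abs_mult by (intro mult_mono w1) auto
  qed
  have cwL: "continuous_on UNIV (\<lambda>z. w j * L z)" for j by (intro continuous_intros cL)
  have A_lim: "(\<lambda>n. \<integral>\<omega>. A n \<omega> \<partial>M) \<longlonglongrightarrow> (\<integral>\<omega>. (LINT s:{0..t}|lborel. w (N s \<omega>) * L (Z s \<omega>)) \<partial>M)"
    unfolding A_def g_def by (rule time_integral(2)[OF t cwL L_bd])
  have Am: "integrable M (\<lambda>\<omega>. t / real n * (w (N (g n i) \<omega>) * L (Z (g n i) \<omega>)))" for n i
  proof (intro integrable_mult_right integrable_const_bound[of _ "1 * BL"])
    show "(\<lambda>\<omega>. w (N (g n i) \<omega>) * L (Z (g n i) \<omega>)) \<in> borel_measurable M"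
      by (rule measurable_M[OF g0 weighted_state_adapted[OF g0 cwL]])
  qed (use L_bd in simp)
  \<comment> \<open>The \<open>n\<close> one-step errors add up to at most \<open>b n\<close>, which tends to \<open>\<epsilon> t \<sigma>\<^sup>2\<close>; the choice of
    \<open>\<epsilon>\<close> keeps this limit below \<open>e\<close>. The summand \<open>1\<close> in its denominator avoids a division by zero.\<close>
  have IA: "(\<lambda>n. (\<integral>\<omega>. I n \<omega> \<partial>M) - (\<integral>\<omega>. A n \<omega> \<partial>M)) \<longlonglongrightarrow> 0"
  proof (rule LIMSEQ_I)
    fix e :: real assume e: "0 < e"
    define \<epsilon> where "\<epsilon> = e / (2 * (t * \<sigma>\<^sup>2 + 1))"
    have ts: "0 < t * \<sigma>\<^sup>2 + 1" using t by (intro add_nonneg_pos) auto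
    have \<epsilon>: "0 < \<epsilon>" using e ts by (simp add: \<epsilon>_def)
    obtain C where C: "0 \<le> C" "\<And>z y. z \<in> {d..u} \<Longrightarrow>
        \<bar>f (z + y) - f z - f' z * y - f'' z / 2 * y\<^sup>2\<bar> \<le> \<epsilon> * y\<^sup>2 + C * y ^ 4"
      using uniform_taylor_remainder[OF f f'' bd(3) \<epsilon>, of d u] by blast
    define b where "b n = t * (B * \<mu>\<^sup>2 * (t / real n) / 2 + \<epsilon> * (\<mu>\<^sup>2 * (t / real n) + \<sigma>\<^sup>2)
      + C * (8 * \<mu> ^ 4 * (t / real n) ^ 3 + 24 * \<sigma> ^ 4 * (t / real n)))" for n
    have est: "\<bar>(\<integral>\<omega>. I n \<omega> \<partial>M) - (\<integral>\<omega>. A n \<omega> \<partial>M)\<bar> \<le> b n" if n: "0 < n" for n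
    proof -
      define \<delta> where "\<delta> = t / real n"
      have \<delta>: "0 < \<delta>" using t n by (simp add: \<delta>_def)
      have one: "\<bar>(\<integral>\<omega>. w (N (g n i) \<omega>) * (f (Z (g n i) \<omega> + \<xi> n i \<omega>) - f (Z (g n i) \<omega>)) \<partial>M)
          - (\<integral>\<omega>. t / real n * (w (N (g n i) \<omega>) * L (Z (g n i) \<omega>)) \<partial>M)\<bar>
        \<le> B * \<mu>\<^sup>2 * \<delta>\<^sup>2 / 2 + \<epsilon> * (\<mu>\<^sup>2 * \<delta>\<^sup>2 + \<sigma>\<^sup>2 * \<delta>) + C * (8 * \<mu> ^ 4 * \<delta> ^ 4 + 24 * \<sigma> ^ 4 * \<delta>\<^sup>2)" for i
        unfolding L_def \<xi>_def \<delta>_def[symmetric]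
      proof (rule one_step_generator[where A="{d..u}", OF g0 \<delta> state_adapted[OF g0] _ wm[OF g0] w1(1)
            borel_measurable_continuous_onI[OF cf(1)] borel_measurable_continuous_onI[OF cf(2)]
            borel_measurable_continuous_onI[OF f''] bd C(2) C(1)])
        show "Z (g n i) \<omega> \<in> {d..u}" if "\<omega> \<in> space M" for \<omega>
          using Z_in_band[OF that g0] by simp
      qed
      have "\<bar>(\<integral>\<omega>. I n \<omega> \<partial>M) - (\<integral>\<omega>. A n \<omega> \<partial>M)\<bar> = 
        \<bar>\<Sum>i<n. (\<integral>\<omega>. w (N (g n i) \<omega>) * (f (Z (g n i) \<omega> + \<xi> n i \<omega>) - f (Z (g n i) \<omega>)) \<partial>M)
          - (\<integral>\<omega>. t / real n * (w (N (g n i) \<omega>) * L (Z (g n i) \<omega>)) \<partial>M)\<bar>"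
        unfolding I_def A_def
        by (subst (1 2) Bochner_Integration.integral_sum) (auto simp only: Im Am sum_subtractf)
      also have "\<dots> \<le> (\<Sum>i<n. B * \<mu>\<^sup>2 * \<delta>\<^sup>2 / 2 + \<epsilon> * (\<mu>\<^sup>2 * \<delta>\<^sup>2 + \<sigma>\<^sup>2 * \<delta>) + C * (8 * \<mu> ^ 4 * \<delta> ^ 4 + 24 * \<sigma> ^ 4 * \<delta>\<^sup>2))"
        by (rule order_trans[OF sum_abs sum_mono[OF one]])
      also have "\<dots> = real n * \<delta> * (B * \<mu>\<^sup>2 * \<delta> / 2 + \<epsilon> * (\<mu>\<^sup>2 * \<delta> + \<sigma>\<^sup>2) + C * (8 * \<mu> ^ 4 * \<delta> ^ 3 + 24 * \<sigma> ^ 4 * \<delta>))"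
        by (simp add: algebra_simps power2_eq_square eval_nat_numeral)
      also have "\<dots> = b n" using n by (simp add: b_def \<delta>_def)
      finally show ?thesis .
    qed
    have "(\<lambda>n. t / real n) \<longlonglongrightarrow> 0" by (rule lim_const_over_n)
    then have "b \<longlonglongrightarrow> t * (B * \<mu>\<^sup>2 * 0 / 2 + \<epsilon> * (\<mu>\<^sup>2 * 0 + \<sigma>\<^sup>2) + C * (8 * \<mu> ^ 4 * 0 ^ 3 + 24 * \<sigma> ^ 4 * 0))"
      unfolding b_def[abs_def] by (intro tendsto_intros) simp_all
    then have "b \<longlonglongrightarrow> \<epsilon> * (t * \<sigma>\<^sup>2)" by (simp add: mult_ac)
    moreover have "\<epsilon> * (t * \<sigma>\<^sup>2) < e"
    proof -
      have "e / (2 * c) * c = e / 2" if "0 < c" for c using that by simp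
      from this[OF ts] have "\<epsilon> * (t * \<sigma>\<^sup>2 + 1) = e / 2" by (simp only: \<epsilon>_def)
      moreover have "\<epsilon> * (t * \<sigma>\<^sup>2) \<le> \<epsilon> * (t * \<sigma>\<^sup>2 + 1)" using \<epsilon> by simp
      ultimately show ?thesis using e by linarith
    qed
    ultimately have "eventually (\<lambda>n. b n < e) sequentially" by (rule order_tendstoD(2))
    then have "eventually (\<lambda>n. \<bar>(\<integral>\<omega>. I n \<omega> \<partial>M) - (\<integral>\<omega>. A n \<omega> \<partial>M)\<bar> < e) sequentially"
      using eventually_gt_at_top[of 0] by eventually_elim (rule le_less_trans[OF est])
    then show "\<exists>no. \<forall>n\<ge>no. norm ((\<integral>\<omega>. I n \<omega> \<partial>M) - (\<integral>\<omega>. A n \<omega> \<partial>M) - 0) < e"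
      by (simp add: eventually_sequentially)
  qed
  have R_lim: "(\<lambda>n. R n \<omega>) \<longlonglongrightarrow> J \<omega>" if "\<omega> \<in> space M" for \<omega>
  proof -
    have "continuous_on UNIV (\<psi> \<omega> j)" for j
      unfolding \<psi>_def[abs_def] by (intro continuous_intros continuous_on_compose2[OF cf(1)]) auto
    from band_path.jump_grid_sum_tendsto[OF band_path[OF that] t this]
    show ?thesis unfolding R_def J_def g_def \<psi>_def .
  qed
  \<comment> \<open>The grid with \<open>0\<close> cells does not reach \<open>t\<close>, hence the shift to \<open>Suc n\<close>. Measurability of \<open>R\<close>
    comes from the decomposition, because its definition involves \<open>S\<close> with a random index.\<close>
  have R_eq: "R (Suc n) = (\<lambda>\<omega>. P t \<omega> - P 0 \<omega> - I (Suc n) \<omega>)" for n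
    using tele[of "Suc n"] by (auto simp: fun_eq_iff)
  have Rm: "R (Suc n) \<in> borel_measurable M" for n
    unfolding R_eq using Pi[of t] Pi[of 0] Ii[of "Suc n"] t 
    by (intro borel_measurable_diff borel_measurable_integrable) auto
  have R_bound: "\<bar>R (Suc n) \<omega>\<bar> \<le> real m * (2 * B)" if \<omega>: "\<omega> \<in> space M" for n \<omega>
  proof -
    have step: "\<bar>\<psi> \<omega> (Suc j) y - \<psi> \<omega> j y\<bar> \<le> (if j < m then 2 * B else 0)" for j y
    proof (cases "j < m")
      case True
      have "\<bar>\<psi> \<omega> i y\<bar> \<le> 1 * B" for i unfolding \<psi>_def abs_mult by (intro mult_mono w1 bd) auto
      from this[of j] this[of "Suc j"] True show ?thesis by auto
    qed (simp add: \<psi>_def w_def)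
    define c where "c j = X (t * of_int \<lceil>real (Suc n) * real_of_ereal (T (Suc j) \<omega>) / t\<rceil> / real (Suc n)) \<omega>" for j
    have "R (Suc n) \<omega> = (\<Sum>j<N t \<omega>. \<psi> \<omega> (Suc j) (c j) - \<psi> \<omega> j (c j))"
      unfolding R_def g_def c_def by (rule band_path.jump_grid_sum[OF band_path[OF \<omega>] t]) simp
    then have "\<bar>R (Suc n) \<omega>\<bar> \<le> (\<Sum>j<N t \<omega>. if j < m then 2 * B else 0)"
      by (simp only:) (rule order_trans[OF sum_abs sum_mono[OF step]])
    also have "\<dots> = (\<Sum>j\<in>{..<N t \<omega>} \<inter> {..<m}. 2 * B)"
      by (subst sum.inter_restrict) simp_all
    also have "\<dots> \<le> (\<Sum>j<m. 2 * B)" using B by (intro sum_mono2) auto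
    finally show ?thesis by simp
  qed
  have J: "J \<in> borel_measurable M"
    by (rule borel_measurable_LIMSEQ_real[OF LIMSEQ_Suc[OF R_lim] Rm])
  have DCT: "integrable M J" "(\<lambda>n. \<integral>\<omega>. R (Suc n) \<omega> \<partial>M) \<longlonglongrightarrow> (\<integral>\<omega>. J \<omega> \<partial>M)"
    by (rule integrable_dominated_convergence integral_dominated_convergence, rule J, rule Rm, 
        rule integrable_const[of "real m * (2 * B)"], rule AE_I2, erule LIMSEQ_Suc[OF R_lim], 
        rule AE_I2, simp only: real_norm_def, erule R_bound)+
  show "integrable M J" by (rule DCT)
  have "(\<integral>\<omega>. P t \<omega> \<partial>M) - (\<integral>\<omega>. P 0 \<omega> \<partial>M) = ((\<integral>\<omega>. I (Suc n) \<omega> \<partial>M) - (\<integral>\<omega>. A (Suc n) \<omega> \<partial>M)) 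
     + (\<integral>\<omega>. A (Suc n) \<omega> \<partial>M) + (\<integral>\<omega>. R (Suc n) \<omega> \<partial>M)" for n
    unfolding R_eq using Pi[of t] Pi[of 0] Ii[of "Suc n"] t by simp
  moreover have "(\<lambda>n. ((\<integral>\<omega>. I (Suc n) \<omega> \<partial>M) - (\<integral>\<omega>. A (Suc n) \<omega> \<partial>M)) 
     + (\<integral>\<omega>. A (Suc n) \<omega> \<partial>M) + (\<integral>\<omega>. R (Suc n) \<omega> \<partial>M)) \<longlonglongrightarrow> 
    0 + (\<integral>\<omega>. (LINT s:{0..t}|lborel. w (N s \<omega>) * L (Z s \<omega>)) \<partial>M) + (\<integral>\<omega>. J \<omega> \<partial>M)"
    by (intro tendsto_add LIMSEQ_Suc[OF IA] LIMSEQ_Suc[OF A_lim] DCT)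
  ultimately have "(\<lambda>n. (\<integral>\<omega>. P t \<omega> \<partial>M) - (\<integral>\<omega>. P 0 \<omega> \<partial>M)) \<longlonglongrightarrow> 
    0 + (\<integral>\<omega>. (LINT s:{0..t}|lborel. w (N s \<omega>) * L (Z s \<omega>)) \<partial>M) + (\<integral>\<omega>. J \<omega> \<partial>M)" by simp
  from LIMSEQ_unique[OF tendsto_const this]
  show "(\<integral>\<omega>. w (N t \<omega>) * f (Z t \<omega>) \<partial>M) - (\<integral>\<omega>. w (N 0 \<omega>) * f (Z 0 \<omega>) \<partial>M) =
      (\<integral>\<omega>. (LINT s:{0..t}|lborel. w (N s \<omega>) * (\<sigma>\<^sup>2 / 2 * f'' (Z s \<omega>) + \<mu> * f' (Z s \<omega>))) \<partial>M) + (\<integral>\<omega>. J \<omega> \<partial>M)"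
    unfolding P_def L_def by simp
qed

end

section \<open>Long-run average cost\<close>

lemma jump_cost_nonneg:
  assumes "0 < K" "0 < L" "0 < k" "0 < l"
  shows "0 \<le> jump_cost K L k l \<xi>"
  unfolding jump_cost_def using assms mult_pos_neg[of l \<xi>] by (auto intro: add_nonneg_nonneg)

context band_brownian
begin

lemma state_around_jump:
  assumes "\<omega> \<in> space M" "0 \<le> t" "j < N t \<omega>"
  shows "(let y = X (real_of_ereal (T (Suc j) \<omega>)) \<omega> in
    (y + S j \<omega> = d \<and> y + S (Suc j) \<omega> = D \<and> xi (Suc j) \<omega> = D - d) \<or>
    (y + S j \<omega> = u \<and> y + S (Suc j) \<omega> = U \<and> xi (Suc j) \<omega> = U - u))"
proof -
  interpret p: band_path d D U u "\<lambda>s. X s \<omega>" using assms(1) by (rule band_path)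
  obtain b where b: "T (Suc j) \<omega> = ereal b" using p.T_finite[OF assms(2), of "Suc j"] assms(3) by auto
  show ?thesis by (rule p.at_jump[OF b]) (simp_all add: b)
qed

lemma jump_function_measurable:
  assumes t: "0 \<le> t" and c: "c \<in> borel_measurable borel"
  shows "(\<lambda>\<omega>. if j < N t \<omega> then c (xi (Suc j) \<omega>) else 0 :: real) \<in> borel_measurable M"
proof -
  define S' where "S' i \<omega> = (if T i \<omega> \<le> ereal t then S i \<omega> else 0)" for i \<omega>
  have [measurable]: "S' i \<in> borel_measurable M" for i
    unfolding S'_def[abs_def] by (rule measurable_M[OF t conjunct2[OF jump_time_shift_adapted[OF t]]])
  have [measurable]: "N t \<in> measurable M (count_space UNIV)"
    by (rule measurable_M[OF t count_adapted[OF t]])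
  have meas: "(\<lambda>\<omega>. if j < N t \<omega> then c (S' (Suc j) \<omega> - S' j \<omega>) else 0) \<in> borel_measurable M"
    using c by measurable
  show ?thesis
  proof (rule measurable_cong[THEN iffD1, OF _ meas])
    fix \<omega> assume "\<omega> \<in> space M"
    then interpret p: band_path d D U u "\<lambda>s. X s \<omega>" by (rule band_path)
    show "(if j < N t \<omega> then c (S' (Suc j) \<omega> - S' j \<omega>) else 0) = (if j < N t \<omega> then c (xi (Suc j) \<omega>) else 0)"
      using p.T_le_iff[OF t, of j] p.T_le_iff[OF t, of "Suc j"] by (simp add: S'_def p.S_Suc)
  qed
qed

text \<open>The first three summands \<open>B\<close> of the error come from the truncated identity: one each for the
  potential at time \<open>0\<close>, at time \<open>t\<close>, and at the moment when it is switched off. None of them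
  depends on the truncation level \<open>m\<close>. The remaining \<open>c0\<close> is the charge at time \<open>0\<close>.\<close>

lemma expected_cost_near_linear:
  fixes f f' f'' h :: "real \<Rightarrow> real"
  assumes t: "0 < t" and pos: "0 < K" "0 < L" "0 < k" "0 < l"
    and f: "\<And>x. (f has_real_derivative f' x) (at x)" "\<And>x. (f' has_real_derivative f'' x) (at x)"
    and f'': "continuous_on UNIV f''"
    and bd: "\<And>x. \<bar>f x\<bar> \<le> B" "\<And>x. \<bar>f' x\<bar> \<le> B" "\<And>x. \<bar>f'' x\<bar> \<le> B"
    and h: "continuous_on UNIV h" "\<And>z. 0 \<le> h z"
    and ode: "\<And>z. d \<le> z \<Longrightarrow> z \<le> u \<Longrightarrow> \<sigma>\<^sup>2 / 2 * f'' z + \<mu> * f' z + h z = \<gamma>"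
    and bc: "f d - f D = K + k * (D - d)" "f u - f U = L + l * (u - U)"
  defines "c0 \<equiv> jump_cost K L k l (if x \<le> d then D - x else if x < u then 0 else U - x)"
  shows "\<exists>C\<ge>0. (\<integral>\<^sup>+\<omega>. path_cost h K L k l (\<lambda>s. X s \<omega>) (band_up d D U u (\<lambda>s. X s \<omega>)) 
      (band_down d D U u (\<lambda>s. X s \<omega>)) t \<partial>M) = ennreal C \<and> \<bar>C - \<gamma> * t\<bar> \<le> 3 * B + c0"
proof -
  have t0: "0 \<le> t" using t by simp
  have B: "0 \<le> B" using bd(1)[of 0] by linarith
  define w where "w m j = (of_bool (j < m) :: real)" for m j :: nat
  have w: "0 \<le> w m j" "w m j \<le> 1" for m j by (simp_all add: w_def)
  define c where "c \<xi> = jump_cost K L k l \<xi>" for \<xi>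
  have c_meas: "c \<in> borel_measurable borel" unfolding c_def[abs_def] jump_cost_def[abs_def] by measurable
  have c_nonneg: "0 \<le> c \<xi>" for \<xi> unfolding c_def using pos by (rule jump_cost_nonneg)
  have c_val: "c (D - d) = K + k * (D - d)" "c (U - u) = L + l * (u - U)"
    using order by (simp_all add: c_def jump_cost_def algebra_simps)
  obtain Hb where Hb: "\<And>z. d \<le> z \<Longrightarrow> z \<le> u \<Longrightarrow> \<bar>h z\<bar> \<le> Hb"
  proof -
    have "compact (h ` {d..u})" by (intro compact_continuous_image continuous_on_subset[OF h(1)]) auto
    then have "bounded (h ` {d..u})" by (rule compact_imp_bounded)
    then obtain b where "\<forall>z\<in>{d..u}. \<bar>h z\<bar> \<le> b" by (auto simp: bounded_iff)
    then show ?thesis by (intro that[of b]) simp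
  qed
  have wh: "continuous_on UNIV (\<lambda>z. w m j * h z)" "continuous_on UNIV (\<lambda>z::real. w m j)" for m j
    by (intro continuous_intros h)+
  have wh_bd: "\<bar>w m j * h z\<bar> \<le> 1 * Hb" if "d \<le> z" "z \<le> u" for m j z
    unfolding abs_mult using w[of m j] Hb[OF that] by (intro mult_mono) auto
  have w_bd: "\<bar>w m j\<bar> \<le> 1" for m j using w[of m j] by simp
  define H where "H m \<omega> = (LINT s:{0..t}|lborel. w m (N s \<omega>) * h (Z s \<omega>))" for m \<omega>
  define \<Delta> where "\<Delta> m \<omega> = (LINT s:{0..t}|lborel. w m (N s \<omega>))" for m \<omega>
  define C where "C m \<omega> = (\<Sum>j<N t \<omega>. w m j * c (xi (Suc j) \<omega>))" for m \<omega>
  define J where "J m \<omega> = (\<Sum>j<N t \<omega>. w m (Suc j) * f (X (real_of_ereal (T (Suc j) \<omega>)) \<omega> + S (Suc j) \<omega>)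
      - w m j * f (X (real_of_ereal (T (Suc j) \<omega>)) \<omega> + S j \<omega>))" for m \<omega>
  have Hi: "integrable M (H m)" for m
    unfolding H_def[abs_def] by (rule time_integral(1)[OF t wh(1) wh_bd])
  have \<Delta>i: "integrable M (\<Delta> m)" for m
    unfolding \<Delta>_def[abs_def] by (rule time_integral(1)[OF t wh(2) w_bd])
  have seti: "set_integrable lborel {0..t} (\<lambda>s. w m (N s \<omega>) * h (Z s \<omega>))"
    "set_integrable lborel {0..t} (\<lambda>s. w m (N s \<omega>))"
    "set_integrable lborel {0..t} (\<lambda>s. h (Z s \<omega>))" if "\<omega> \<in> space M" for m \<omega>
  proof -
    note int = band_path.Z_set_integrable[OF band_path[OF that]]
    show "set_integrable lborel {0..t} (\<lambda>s. w m (N s \<omega>) * h (Z s \<omega>))" by (rule int[OF wh(1) wh_bd])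
    show "set_integrable lborel {0..t} (\<lambda>s. w m (N s \<omega>))" by (rule int[OF wh(2) w_bd])
    show "set_integrable lborel {0..t} (\<lambda>s. h (Z s \<omega>))" by (rule int[OF h(1) Hb])
  qed
  \<comment> \<open>Written as a sum over the fixed range \<open>j < m\<close>, the cost \<open>C\<close> is measurable term by term.\<close>
  have C_eq: "C m \<omega> = (\<Sum>j<m. if j < N t \<omega> then c (xi (Suc j) \<omega>) else 0)" for m \<omega>
  proof -
    have "C m \<omega> = (\<Sum>j<N t \<omega>. if j \<in> {..<m} then c (xi (Suc j) \<omega>) else 0)"
      unfolding C_def by (intro sum.cong) (auto simp: w_def)
    also have "\<dots> = (\<Sum>j\<in>{..<N t \<omega>} \<inter> {..<m}. c (xi (Suc j) \<omega>))"
      by (rule sum.inter_restrict[symmetric]) simp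
    also have "\<dots> = (\<Sum>j\<in>{..<m} \<inter> {..<N t \<omega>}. c (xi (Suc j) \<omega>))" by (simp only: Int_commute)
    also have "\<dots> = (\<Sum>j<m. if j \<in> {..<N t \<omega>} then c (xi (Suc j) \<omega>) else 0)"
      by (rule sum.inter_restrict) simp
    finally show ?thesis by simp
  qed
  have Ci: "integrable M (C m)" for m
    unfolding C_eq
  proof (intro Bochner_Integration.integrable_sum integrable_const_bound[of _ "c (D - d) + c (U - u)"] AE_I2)
    fix j \<omega> assume "\<omega> \<in> space M"
    then show "norm (if j < N t \<omega> then c (xi (Suc j) \<omega>) else 0) \<le> c (D - d) + c (U - u)"
      using state_around_jump[OF _ t0, of \<omega> j] c_nonneg[of "D - d"] c_nonneg[of "U - u"] by (auto simp: Let_def)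
  qed (rule jump_function_measurable[OF t0 c_meas])
  \<comment> \<open>By the boundary conditions each adjustment lowers \<open>f\<close> by its cost. The terms of \<open>J\<close> cancel those
    of \<open>C\<close>, except that the switching off leaves one value of \<open>f\<close>.\<close>
  have regroup: "q = p + r \<Longrightarrow> a' * p - a * q + a * r = (a' - a) * p" for a a' p q r :: real
    by (simp add: algebra_simps)
  have JC: "\<bar>J m \<omega> + C m \<omega>\<bar> \<le> B" if \<omega>: "\<omega> \<in> space M" for m \<omega>
  proof -
    have "J m \<omega> + C m \<omega> = (\<Sum>j<N t \<omega>. (w m (Suc j) - w m j) * f (X (real_of_ereal (T (Suc j) \<omega>)) \<omega> + S (Suc j) \<omega>))"
      unfolding J_def C_def sum.distrib[symmetric]
    proof (intro sum.cong refl)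
      fix j assume j: "j \<in> {..<N t \<omega>}"
      let ?y = "X (real_of_ereal (T (Suc j) \<omega>)) \<omega>"
      have "(?y + S j \<omega> = d \<and> ?y + S (Suc j) \<omega> = D \<and> xi (Suc j) \<omega> = D - d) \<or>
          (?y + S j \<omega> = u \<and> ?y + S (Suc j) \<omega> = U \<and> xi (Suc j) \<omega> = U - u)"
        using state_around_jump[OF \<omega> t0, of j] j by (simp only: Let_def lessThan_iff)
      then have "f (?y + S j \<omega>) = f (?y + S (Suc j) \<omega>) + c (xi (Suc j) \<omega>)"
      proof (elim disjE conjE)
        assume "?y + S j \<omega> = d" "?y + S (Suc j) \<omega> = D" "xi (Suc j) \<omega> = D - d"
        then show ?thesis using bc(1) by (simp only: c_val)
      next
        assume "?y + S j \<omega> = u" "?y + S (Suc j) \<omega> = U" "xi (Suc j) \<omega> = U - u"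
        then show ?thesis using bc(2) by (simp only: c_val)
      qed
      then show "w m (Suc j) * f (X (real_of_ereal (T (Suc j) \<omega>)) \<omega> + S (Suc j) \<omega>)
          - w m j * f (X (real_of_ereal (T (Suc j) \<omega>)) \<omega> + S j \<omega>) + w m j * c (xi (Suc j) \<omega>)
        = (w m (Suc j) - w m j) * f (X (real_of_ereal (T (Suc j) \<omega>)) \<omega> + S (Suc j) \<omega>)"
        by (rule regroup)
    qed
    then have "\<bar>J m \<omega> + C m \<omega>\<bar> \<le> (\<Sum>j<N t \<omega>. (w m j - w m (Suc j)) * B)"
    proof (simp only:, intro order_trans[OF sum_abs sum_mono])
      fix j
      have "\<bar>w m (Suc j) - w m j\<bar> \<le> w m j - w m (Suc j)" by (simp add: w_def)
      then show "\<bar>(w m (Suc j) - w m j) * f (X (real_of_ereal (T (Suc j) \<omega>)) \<omega> + S (Suc j) \<omega>)\<bar>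
          \<le> (w m j - w m (Suc j)) * B"
        unfolding abs_mult by (rule mult_mono) (simp_all add: bd w_def)
    qed
    also have "(\<Sum>j<N t \<omega>. (w m j - w m (Suc j)) * B) = (w m 0 - w m (N t \<omega>)) * B"
      using sum_lessThan_telescope'[of "w m" "N t \<omega>"] by (metis sum_distrib_right)
    also have "(w m 0 - w m (N t \<omega>)) * B \<le> 1 * B"
      using w[of m 0] w[of m "N t \<omega>"] B by (intro mult_right_mono) linarith+
    finally show "\<bar>J m \<omega> + C m \<omega>\<bar> \<le> B" by (simp only: mult_1)
  qed
  have trunc: "\<bar>(\<integral>\<omega>. H m \<omega> + C m \<omega> \<partial>M) - \<gamma> * (\<integral>\<omega>. \<Delta> m \<omega> \<partial>M)\<bar> \<le> 3 * B" for m
  proof -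
    have dyn: "integrable M (J m)"
      "(\<integral>\<omega>. w m (N t \<omega>) * f (Z t \<omega>) \<partial>M) - (\<integral>\<omega>. w m (N 0 \<omega>) * f (Z 0 \<omega>) \<partial>M) =
        (\<integral>\<omega>. (LINT s:{0..t}|lborel. w m (N s \<omega>) * (\<sigma>\<^sup>2 / 2 * f'' (Z s \<omega>) + \<mu> * f' (Z s \<omega>))) \<partial>M) + (\<integral>\<omega>. J m \<omega> \<partial>M)"
      using truncated_dynkin[OF t f f'' bd, of m] unfolding J_def[abs_def] w_def by blast+
    have "(LINT s:{0..t}|lborel. w m (N s \<omega>) * (\<sigma>\<^sup>2 / 2 * f'' (Z s \<omega>) + \<mu> * f' (Z s \<omega>))) 
        = \<gamma> * \<Delta> m \<omega> - H m \<omega>" if \<omega>: "\<omega> \<in> space M" for \<omega>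
    proof -
      have "(LINT s:{0..t}|lborel. w m (N s \<omega>) * (\<sigma>\<^sup>2 / 2 * f'' (Z s \<omega>) + \<mu> * f' (Z s \<omega>)))
        = (LINT s:{0..t}|lborel. \<gamma> * w m (N s \<omega>) - w m (N s \<omega>) * h (Z s \<omega>))"
      proof (rule set_lebesgue_integral_cong)
        show "\<forall>s. s \<in> {0..t} \<longrightarrow> w m (N s \<omega>) * (\<sigma>\<^sup>2 / 2 * f'' (Z s \<omega>) + \<mu> * f' (Z s \<omega>)) 
          = \<gamma> * w m (N s \<omega>) - w m (N s \<omega>) * h (Z s \<omega>)"
        proof (intro allI impI)
          fix s assume "s \<in> {0..t}"
          then have "d \<le> Z s \<omega>" "Z s \<omega> \<le> u" using Z_in_band[OF \<omega>, of s] by auto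
          from ode[OF this] have "\<sigma>\<^sup>2 / 2 * f'' (Z s \<omega>) + \<mu> * f' (Z s \<omega>) = \<gamma> - h (Z s \<omega>)" by linarith
          then show "w m (N s \<omega>) * (\<sigma>\<^sup>2 / 2 * f'' (Z s \<omega>) + \<mu> * f' (Z s \<omega>)) 
            = \<gamma> * w m (N s \<omega>) - w m (N s \<omega>) * h (Z s \<omega>)"
            by (simp only: right_diff_distrib) (simp only: mult.commute)
        qed
      qed simp
      also have "\<dots> = \<gamma> * \<Delta> m \<omega> - H m \<omega>"
        unfolding \<Delta>_def H_def using seti(1,2)[OF \<omega>, of m]
        by (subst set_integral_diff) (auto intro: set_integrable_mult_right)
      finally show ?thesis .
    qed
    then have "(\<integral>\<omega>. (LINT s:{0..t}|lborel. w m (N s \<omega>) * (\<sigma>\<^sup>2 / 2 * f'' (Z s \<omega>) + \<mu> * f' (Z s \<omega>))) \<partial>M)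
        = (\<integral>\<omega>. \<gamma> * \<Delta> m \<omega> - H m \<omega> \<partial>M)" by (intro Bochner_Integration.integral_cong) auto
    also have "\<dots> = \<gamma> * (\<integral>\<omega>. \<Delta> m \<omega> \<partial>M) - (\<integral>\<omega>. H m \<omega> \<partial>M)" using Hi \<Delta>i by simp
    finally have gen: "(\<integral>\<omega>. (LINT s:{0..t}|lborel. w m (N s \<omega>) * (\<sigma>\<^sup>2 / 2 * f'' (Z s \<omega>) + \<mu> * f' (Z s \<omega>))) \<partial>M)
        = \<gamma> * (\<integral>\<omega>. \<Delta> m \<omega> \<partial>M) - (\<integral>\<omega>. H m \<omega> \<partial>M)" .
    have E_bd: "\<bar>\<integral>\<omega>. g \<omega> \<partial>M\<bar> \<le> B" if g: "\<And>\<omega>. \<omega> \<in> space M \<Longrightarrow> \<bar>g \<omega>\<bar> \<le> B" for g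
    proof (cases "integrable M g")
      case True
      have "\<bar>\<integral>\<omega>. g \<omega> \<partial>M\<bar> \<le> (\<integral>\<omega>. \<bar>g \<omega>\<bar> \<partial>M)" using integral_abs_bound .
      also have "\<dots> \<le> (\<integral>\<omega>. B \<partial>M)" using True g by (intro integral_mono) auto
      finally show ?thesis by (simp add: prob_space)
    qed (simp add: not_integrable_integral_eq B)
    have "\<bar>w m j * f z\<bar> \<le> 1 * B" for j z unfolding abs_mult by (intro mult_mono w_bd bd) auto
    then have "\<bar>\<integral>\<omega>. w m (N t \<omega>) * f (Z t \<omega>) \<partial>M\<bar> \<le> B" "\<bar>\<integral>\<omega>. w m (N 0 \<omega>) * f (Z 0 \<omega>) \<partial>M\<bar> \<le> B"
      by (intro E_bd; simp)+
    moreover have "\<bar>\<integral>\<omega>. J m \<omega> + C m \<omega> \<partial>M\<bar> \<le> B" by (intro E_bd JC)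
    then have "\<bar>(\<integral>\<omega>. J m \<omega> \<partial>M) + (\<integral>\<omega>. C m \<omega> \<partial>M)\<bar> \<le> B" using dyn(1) Ci by simp
    moreover have "(\<integral>\<omega>. H m \<omega> + C m \<omega> \<partial>M) = (\<integral>\<omega>. H m \<omega> \<partial>M) + (\<integral>\<omega>. C m \<omega> \<partial>M)" using Hi Ci by simp
    ultimately show ?thesis using dyn(2) gen by linarith
  qed
  \<comment> \<open>For each outcome the truncation has no effect once \<open>m\<close> exceeds the number of adjustments up to
    \<open>t\<close>. The truncated costs increase with \<open>m\<close> and their expectations are bounded, which yields
    integrability of the full cost and the same error bound for it.\<close>
  define Q where "Q \<omega> = (LINT s:{0..t}|lborel. h (Z s \<omega>)) + (\<Sum>j<N t \<omega>. c (xi (Suc j) \<omega>))" for \<omega>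
  have w_one: "w m (N s \<omega>) = 1" if "\<omega> \<in> space M" "N t \<omega> < m" "0 \<le> s" "s \<le> t" for m s \<omega>
    using band_path.N_mono[OF band_path[OF that(1)] that(3,4)] that(2) by (simp add: w_def)
  have full: "H m \<omega> + C m \<omega> = Q \<omega>" "\<Delta> m \<omega> = t" if \<omega>: "\<omega> \<in> space M" and m: "N t \<omega> < m" for m \<omega>
  proof -
    have "H m \<omega> = (LINT s:{0..t}|lborel. h (Z s \<omega>))"
      unfolding H_def using w_one[OF \<omega> m] by (intro set_lebesgue_integral_cong) auto
    moreover have "C m \<omega> = (\<Sum>j<N t \<omega>. c (xi (Suc j) \<omega>))"
      unfolding C_def using m by (intro sum.cong) (auto simp: w_def)
    ultimately show "H m \<omega> + C m \<omega> = Q \<omega>" by (simp add: Q_def)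
    have "\<Delta> m \<omega> = (LINT s:{0..t}|lborel. 1)"
      unfolding \<Delta>_def using w_one[OF \<omega> m] by (intro set_lebesgue_integral_cong) auto
    then show "\<Delta> m \<omega> = t" using t by (simp add: set_integral_const)
  qed
  have lim: "(\<lambda>m. H m \<omega> + C m \<omega>) \<longlonglongrightarrow> Q \<omega>" "(\<lambda>m. \<Delta> m \<omega>) \<longlonglongrightarrow> t" if \<omega>: "\<omega> \<in> space M" for \<omega>
    by (rule tendsto_eventually, use eventually_gt_at_top[of "N t \<omega>"] in eventually_elim, rule full[OF \<omega>], assumption)+
  have mono: "mono (\<lambda>m. H m \<omega> + C m \<omega>)" if \<omega>: "\<omega> \<in> space M" for \<omega>
  proof (rule monoI)
    fix m m' :: nat assume mm: "m \<le> m'"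
    then have ww: "w m j \<le> w m' j" for j by (simp add: w_def)
    have "H m \<omega> \<le> H m' \<omega>"
      unfolding H_def by (intro set_integral_mono seti[OF \<omega>] mult_right_mono ww h)
    moreover have "C m \<omega> \<le> C m' \<omega>"
      unfolding C_def by (intro sum_mono mult_right_mono ww c_nonneg)
    ultimately show "H m \<omega> + C m \<omega> \<le> H m' \<omega> + C m' \<omega>" by simp
  qed
  have HCi: "integrable M (\<lambda>\<omega>. H m \<omega> + C m \<omega>)" for m using Hi Ci by simp
  have \<Delta>_bd: "\<bar>\<Delta> m \<omega>\<bar> \<le> t" if \<omega>: "\<omega> \<in> space M" for m \<omega>
  proof -
    have "\<Delta> m \<omega> \<le> (LINT s:{0..t}|lborel. 1)"
      unfolding \<Delta>_def by (intro set_integral_mono seti[OF \<omega>] w)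
        (simp add: set_integrable_def integrable_indicator_iff emeasure_lborel_Icc_eq)
    moreover have "0 \<le> \<Delta> m \<omega>"
      unfolding \<Delta>_def set_lebesgue_integral_def using w by (intro integral_nonneg_AE) simp
    ultimately show ?thesis using t by (simp add: set_integral_const)
  qed
  have E\<Delta>: "(\<lambda>m. \<integral>\<omega>. \<Delta> m \<omega> \<partial>M) \<longlonglongrightarrow> t"
  proof -
    have "(\<lambda>m. \<integral>\<omega>. \<Delta> m \<omega> \<partial>M) \<longlonglongrightarrow> (\<integral>\<omega>. t \<partial>M)"
      by (rule integral_dominated_convergence[where w="\<lambda>_. t"])
         (use \<Delta>i lim(2) \<Delta>_bd in auto)
    then show ?thesis by (simp add: prob_space)
  qed
  have "incseq (\<lambda>m. \<integral>\<omega>. H m \<omega> + C m \<omega> \<partial>M)"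
    using mono by (intro incseq_SucI integral_mono HCi) (auto simp: mono_def)
  moreover have "(\<integral>\<omega>. H m \<omega> + C m \<omega> \<partial>M) \<le> \<bar>\<gamma>\<bar> * t + 3 * B" for m
  proof -
    have "\<bar>\<integral>\<omega>. \<Delta> m \<omega> \<partial>M\<bar> \<le> (\<integral>\<omega>. \<bar>\<Delta> m \<omega>\<bar> \<partial>M)" using integral_abs_bound .
    also have "\<dots> \<le> (\<integral>\<omega>. t \<partial>M)" using \<Delta>i \<Delta>_bd by (intro integral_mono) auto
    finally have "\<bar>\<gamma> * (\<integral>\<omega>. \<Delta> m \<omega> \<partial>M)\<bar> \<le> \<bar>\<gamma>\<bar> * t"
      by (simp add: abs_mult prob_space mult_left_mono)
    then show ?thesis using trunc[of m] by linarith
  qed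
  ultimately obtain q where q: "(\<lambda>m. \<integral>\<omega>. H m \<omega> + C m \<omega> \<partial>M) \<longlonglongrightarrow> q"
    using incseq_convergent by blast
  have Qm: "Q \<in> borel_measurable M"
    by (rule borel_measurable_LIMSEQ_real[OF lim(1) borel_measurable_integrable[OF HCi]])
  have AE: "AE \<omega> in M. mono (\<lambda>m. H m \<omega> + C m \<omega>)" "AE \<omega> in M. (\<lambda>m. H m \<omega> + C m \<omega>) \<longlonglongrightarrow> Q \<omega>"
    by (rule AE_I2, erule mono, rule AE_I2, erule lim(1))
  have Q: "integrable M Q" "(\<integral>\<omega>. Q \<omega> \<partial>M) = q"
    by (rule integrable_monotone_convergence[OF HCi AE q Qm] integral_monotone_convergence[OF HCi AE q Qm])+
  have "(\<lambda>m. \<bar>(\<integral>\<omega>. H m \<omega> + C m \<omega> \<partial>M) - \<gamma> * (\<integral>\<omega>. \<Delta> m \<omega> \<partial>M)\<bar>) \<longlonglongrightarrow> \<bar>q - \<gamma> * t\<bar>"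
    by (intro tendsto_intros q E\<Delta>)
  then have q_bd: "\<bar>q - \<gamma> * t\<bar> \<le> 3 * B"
    by (rule LIMSEQ_le_const2) (intro exI allI impI trunc)
  have Q0: "0 \<le> Q \<omega>" for \<omega>
    unfolding Q_def set_lebesgue_integral_def using h(2) c_nonneg 
    by (intro add_nonneg_nonneg integral_nonneg_AE sum_nonneg) auto
  then have q0: "0 \<le> q" unfolding Q(2)[symmetric] by (intro integral_nonneg_AE) simp
  have c00: "0 \<le> c0" unfolding c0_def using pos by (rule jump_cost_nonneg)
  have "path_cost h K L k l (\<lambda>s. X s \<omega>) (band_up d D U u (\<lambda>s. X s \<omega>)) (band_down d D U u (\<lambda>s. X s \<omega>)) t
      = ennreal (Q \<omega> + c0)" if \<omega>: "\<omega> \<in> space M" for \<omega>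
  proof -
    have "(\<integral>\<^sup>+s\<in>{0..t}. ennreal (h (Z s \<omega>)) \<partial>lborel) = (\<integral>\<^sup>+s. ennreal (indicator {0..t} s *\<^sub>R h (Z s \<omega>)) \<partial>lborel)"
      by (intro nn_integral_cong) (auto simp: indicator_def)
    also have "\<dots> = ennreal (LINT s:{0..t}|lborel. h (Z s \<omega>))"
      unfolding set_lebesgue_integral_def
      using seti(3)[OF \<omega>] h(2) by (intro nn_integral_eq_integral) (auto simp: set_integrable_def)
    finally have 1: "(\<integral>\<^sup>+s\<in>{0..t}. ennreal (h (Z s \<omega>)) \<partial>lborel) = ennreal (LINT s:{0..t}|lborel. h (Z s \<omega>))" .
    have "xi 0 \<omega> = (if x \<le> d then D - x else if x < u then 0 else U - x)"
      using X_0[OF \<omega>] by (simp add: band_adj_def Let_def)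
    then have 2: "(\<Sum>n\<le>N t \<omega>. jump_cost K L k l (xi n \<omega>)) = c0 + (\<Sum>j<N t \<omega>. c (xi (Suc j) \<omega>))"
      by (simp add: sum.atMost_shift c0_def c_def)
    have "0 \<le> (LINT s:{0..t}|lborel. h (Z s \<omega>))" 
      unfolding set_lebesgue_integral_def using h(2) by (intro integral_nonneg_AE) auto
    moreover have "0 \<le> c0 + (\<Sum>j<N t \<omega>. c (xi (Suc j) \<omega>))"
      using c00 c_nonneg by (intro add_nonneg_nonneg sum_nonneg) auto
    ultimately show ?thesis
      unfolding band_path.path_cost_band[OF band_path[OF \<omega>] t0 pos] 1 2
      by (simp add: Q_def add_ac flip: ennreal_plus)
  qed
  then have "(\<integral>\<^sup>+\<omega>. path_cost h K L k l (\<lambda>s. X s \<omega>) (band_up d D U u (\<lambda>s. X s \<omega>)) 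
      (band_down d D U u (\<lambda>s. X s \<omega>)) t \<partial>M) = (\<integral>\<^sup>+\<omega>. ennreal (Q \<omega> + c0) \<partial>M)"
    by (rule nn_integral_cong)
  also have "\<dots> = ennreal (\<integral>\<omega>. Q \<omega> + c0 \<partial>M)"
    using Q(1) Q0 c00 by (intro nn_integral_eq_integral) auto
  also have "(\<integral>\<omega>. Q \<omega> + c0 \<partial>M) = q + c0" using Q by (simp add: prob_space)
  finally show ?thesis using q_bd q0 c00 by (intro exI[of _ "q + c0"]) auto
qed

end

lemma average_of_near_linear:
  fixes R :: "real \<Rightarrow> ennreal" and \<gamma> b :: real
  assumes "\<And>t. 0 < t \<Longrightarrow> \<exists>C\<ge>0. R t = ennreal C \<and> \<bar>C - \<gamma> * t\<bar> \<le> b"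
  shows "Limsup at_top (\<lambda>t::real. ereal (1 / t) * enn2ereal (R t)) = ereal \<gamma>"
proof -
  obtain C where C: "\<And>t. 0 < t \<Longrightarrow> 0 \<le> C t \<and> R t = ennreal (C t) \<and> \<bar>C t - \<gamma> * t\<bar> \<le> b"
    using assms by metis
  have b: "((\<lambda>t. b / t) \<longlongrightarrow> 0) at_top"
    by (intro tendsto_divide_0[OF tendsto_const] filterlim_at_top_imp_at_infinity filterlim_ident)
  have "((\<lambda>t. C t / t - \<gamma>) \<longlongrightarrow> 0) at_top"
  proof (rule Lim_null_comparison[OF _ b])
    show "eventually (\<lambda>t. norm (C t / t - \<gamma>) \<le> b / t) at_top"
      using eventually_gt_at_top[of 0]
    proof eventually_elim
      case (elim t)
      have "C t / t - \<gamma> = (C t - \<gamma> * t) / t" using elim by (simp add: field_simps)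
      then show ?case using C[OF elim] elim by (simp add: divide_right_mono)
    qed
  qed
  then have "((\<lambda>t. C t / t) \<longlongrightarrow> \<gamma>) at_top" by (rule LIM_zero_cancel)
  then have "((\<lambda>t. ereal (C t / t)) \<longlongrightarrow> ereal \<gamma>) at_top" by simp
  moreover have "eventually (\<lambda>t. ereal (C t / t) = ereal (1 / t) * enn2ereal (R t)) at_top"
    using eventually_gt_at_top[of 0]
  proof eventually_elim
    case (elim t)
    then show ?case using C[OF elim] by (simp add: enn2ereal_ennreal)
  qed
  ultimately have "((\<lambda>t. ereal (1 / t) * enn2ereal (R t)) \<longlongrightarrow> ereal \<gamma>) at_top"
    by (rule Lim_transform_eventually)
  then show ?thesis by (intro lim_imp_Limsup) (auto simp: trivial_limit_at_top_linorder)
qed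

theorem theorem5p1:
  fixes M :: "'a measure" and F :: "real \<Rightarrow> 'a measure" and W :: "real \<Rightarrow> 'a \<Rightarrow> real"
    and \<mu> \<sigma> K L k l d D U u \<gamma> :: real
    and h V V' V'' :: "real \<Rightarrow> real"
  assumes "brownian_motion M F W"
    and "0 < \<sigma>" "0 < K" "0 < L" "0 < k" "0 < l"
    and "holding_cost (2 * \<mu> / \<sigma>\<^sup>2) h"
    and "d < D" "D < U" "U < u"
    and "\<And>x. x \<in> {d..u} \<Longrightarrow> (V has_real_derivative V' x) (at x within {d..u})"
    and "\<And>x. x \<in> {d..u} \<Longrightarrow> (V' has_real_derivative V'' x) (at x within {d..u})"
    and "continuous_on {d..u} V''"
    and "\<And>x. x \<in> {d..u} \<Longrightarrow> \<sigma>\<^sup>2 / 2 * V'' x + \<mu> * V' x + h x = \<gamma>"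
    and "V d - V D = K + k * (D - d)"
    and "V u - V U = L + l * (u - U)"
  shows "\<forall>x. band_cost M h K L k l (drifted \<mu> \<sigma> W x) d D U u = ereal \<gamma>"
proof
  fix x
  have "d < u" using assms(8-10) by simp
  obtain f f' f'' B where f: "\<And>x. (f has_real_derivative f' x) (at x)" "\<And>x. (f' has_real_derivative f'' x) (at x)"
    "continuous_on UNIV f''" "\<And>x. \<bar>f x\<bar> \<le> B" "\<And>x. \<bar>f' x\<bar> \<le> B" "\<And>x. \<bar>f'' x\<bar> \<le> B"
    and fV: "\<And>x. x \<in> {d..u} \<Longrightarrow> f x = V x \<and> f' x = V' x \<and> f'' x = V'' x"
    using bounded_C2_extension[OF \<open>d < u\<close> assms(11-13)] by blast
  interpret band_brownian M F W \<mu> \<sigma> x d D U u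
    using assms(1,8-10) by (simp add: band_brownian_def band_brownian_axioms_def)
  have h: "continuous_on UNIV h" "\<And>z. 0 \<le> h z" using assms(7) by (auto simp: holding_cost_def)
  have ode: "\<sigma>\<^sup>2 / 2 * f'' z + \<mu> * f' z + h z = \<gamma>" if "d \<le> z" "z \<le> u" for z
    using fV[of z] assms(14)[of z] that by simp
  have bc: "f d - f D = K + k * (D - d)" "f u - f U = L + l * (u - U)"
    using fV[of d] fV[of D] fV[of U] fV[of u] assms(8-10,15,16) by simp_all
  show "band_cost M h K L k l (drifted \<mu> \<sigma> W x) d D U u = ereal \<gamma>"
    unfolding band_cost_def avg_cost_def
    by (rule average_of_near_linear, rule expected_cost_near_linear[OF _ assms(3-6) f h ode bc])
qed

end
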